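(* Let $\lambda_0\in(0,\pi)$. Let $\{U_t,t\in\mathbb{Z}\}$ be a zero-mean weakly stationary process with spectral density $f_U$ continuous on $[0,\pi]$ with $\inf_{\lambda\in[0,\pi]}f_U(\lambda)>0$, whose autocovariance $\gamma_U$ and fourth-order cumulants satisfy $$\sum_{h\in\mathbb{Z}}|h||\gamma_U(h)|<\infty,\qquad \sum_{h_1,h_2,h_3\in\mathbb{Z}}(1+|h_1|+|h_2|+|h_3|)\,|\mathrm{cum}(U_0,U_{h_1},U_{h_2},U_{h_3})|<\infty.$$ Let $(\delta_n)\subset(0,1)$ satisfy $\delta_n\sim n^{-\alpha}$ for some $\alpha\in(0,1/3)$, and for each $n$ let $X_{t,\delta_n}=A_{\delta_n}(L)^{-1}U_t$ with $A_\delta(z)=1-2(1-\delta)\cos(\lambda_0)z+(1-\delta)^2z^2$. Let $\rho_{\delta_n}(h)$ be the autocorrelation function of $\{X_{t,\delta_n}\}$ and $$a_{1,\delta_n}=\frac{\rho_{\delta_n}(1)(1-\rho_{\delta_n}(2))}{1-\rho^2_{\delta_n}(1)},\quad a_{2,\delta_n}=\frac{\rho_{\delta_n}(2)-\rho^2_{\delta_n}(1)}{1-\rho^2_{\delta_n}(1)},\quad \lambda_{0,\delta_n}=\arccos\Big(\frac{a_{1,\delta_n}(1-a_{2,\delta_n})}{-4a_{2,\delta_n}}\Big)$$ (the latter when $a_{2,\delta_n}<0$). Based on $X_{1,\delta_n},\dots,X_{n,\delta_n}$, let $I_{n}(\lambda)=(2\pi n)^{-1}|\sum_{t=1}^nX_{t,\delta_n}e^{-i\lambda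 t}|^2$, $\widehat\gamma(h)=\frac{2\pi}{n}\sum_{j\in\mathcal{G}(n)}I_n(\lambda_{j,n})\cos(\lambda_{j,n}h)$ with $\lambda_{j,n}=2\pi j/n$, $\mathcal{G}(n)=\{-N,\dots,-1,1,\dots,N\}$, $N=\lfloor n/2\rfloor$, $\widehat\rho(h)=\widehat\gamma(h)/\widehat\gamma(0)$, and let $\widehat a_{1,\delta_n},\widehat a_{2,\delta_n},\widehat\lambda_{0,\delta_n}$ be defined by the same formulas as $a_{1,\delta_n},a_{2,\delta_n},\lambda_{0,\delta_n}$ with $\rho_{\delta_n}(h)$ replaced by $\widehat\rho(h)$ (the last when $\widehat a_{2,\delta_n}<0$). Then, as $n\to\infty$, (i) $\widehat a_{1,\delta_n}-a_{1,\delta_n}=\mathcal{O}_P(n^{-(1+\alpha)/2})$ and $\widehat a_{2,\delta_n}-a_{2,\delta_n}=\mathcal{O}_P(n^{-(1+\alpha)/2})$; (ii) $\widehat\lambda_{0,\delta_n}=\lambda_{0,\delta_n}+\mathcal{O}_P(n^{-(1+\alpha)/2})$.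
   Context: $L$ is the lag operator and $A_\delta(L)^{-1}$ the causal inverse filter: $X_{t,\delta}=\sum_{j\ge0}b_{j,\delta}U_{t-j}$ with $1/A_\delta(z)=\sum_{j\ge0}b_{j,\delta}z^j$; its spectral density is $f_\delta(\lambda)=|1-(1-\delta)e^{-i(\lambda-\lambda_0)}|^{-2}|1-(1-\delta)e^{-i(\lambda+\lambda_0)}|^{-2}f_U(\lambda)$. $(a_{1,\delta},a_{2,\delta})$ coincide with the coefficients of the mean-square best AR(2) approximation of $X_{t,\delta}$ by $X_{t-1,\delta},X_{t-2,\delta}$. $\delta_n\sim n^{-\alpha}$ means $\delta_n$ is of exact order $n^{-\alpha}$.
   Formalization: The process U is assumed to have finite fourth moments and fourth-order cumulants invariant under time shifts (fourth-order stationarity); with weak stationarity and a condition only on cumulants anchored at U_0, the claim can fail. *)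

theory Defs
  imports "HOL-Probability.Probability" "HOL-Computational_Algebra.Formal_Power_Series"
begin

definition Apoly :: "real \<Rightarrow> real \<Rightarrow> real fps" where
  "Apoly lam0 d = 1 - fps_const (2 * (1 - d) * cos lam0) * fps_X + fps_const ((1 - d)^2) * fps_X^2"

definition bcoef :: "real \<Rightarrow> real \<Rightarrow> nat \<Rightarrow> real" where
  "bcoef lam0 d j = fps_nth (inverse (Apoly lam0 d)) j"

definition Xproc :: "real \<Rightarrow> real \<Rightarrow> (int \<Rightarrow> 'a \<Rightarrow> real) \<Rightarrow> int \<Rightarrow> 'a \<Rightarrow> real" where
  "Xproc lam0 d U t \<omega> = (\<Sum>j. bcoef lam0 d j * U (t - int j) \<omega>)"

definition acov :: "'a measure \<Rightarrow> (int \<Rightarrow> 'a \<Rightarrow> real) \<Rightarrow> int \<Rightarrow> real" where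
  "acov M Y h = (LINT \<omega>|M. (Y h \<omega> - (LINT w|M. Y h w)) * (Y 0 \<omega> - (LINT w|M. Y 0 w)))"

definition acor :: "'a measure \<Rightarrow> (int \<Rightarrow> 'a \<Rightarrow> real) \<Rightarrow> int \<Rightarrow> real" where
  "acor M Y h = acov M Y h / acov M Y 0"

definition cum4 :: "'a measure \<Rightarrow> ('a \<Rightarrow> real) \<Rightarrow> ('a \<Rightarrow> real) \<Rightarrow> ('a \<Rightarrow> real) \<Rightarrow> ('a \<Rightarrow> real) \<Rightarrow> real" where
  "cum4 M A B C D =
    (let a = (\<lambda>\<omega>. A \<omega> - (LINT w|M. A w)); b = (\<lambda>\<omega>. B \<omega> - (LINT w|M. B w));
         c = (\<lambda>\<omega>. C \<omega> - (LINT w|M. C w)); d = (\<lambda>\<omega>. D \<omega> - (LINT w|M. D w));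
         E = (\<lambda>f. LINT w|M. f w)
     in E (\<lambda>w. a w * b w * c w * d w)
        - E (\<lambda>w. a w * b w) * E (\<lambda>w. c w * d w)
        - E (\<lambda>w. a w * c w) * E (\<lambda>w. b w * d w)
        - E (\<lambda>w. a w * d w) * E (\<lambda>w. b w * c w))"

definition ar2_a1 :: "(int \<Rightarrow> real) \<Rightarrow> real" where
  "ar2_a1 r = r 1 * (1 - r 2) / (1 - (r 1)^2)"

definition ar2_a2 :: "(int \<Rightarrow> real) \<Rightarrow> real" where
  "ar2_a2 r = (r 2 - (r 1)^2) / (1 - (r 1)^2)"

definition peak_freq :: "(int \<Rightarrow> real) \<Rightarrow> real" where
  "peak_freq r = arccos (ar2_a1 r * (1 - ar2_a2 r) / (- 4 * ar2_a2 r))"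

definition periodogram :: "nat \<Rightarrow> (int \<Rightarrow> real) \<Rightarrow> real \<Rightarrow> real" where
  "periodogram n x l =
     (cmod (\<Sum>t=1..n. complex_of_real (x (int t)) * cis (- l * real t)))^2 / (2 * pi * real n)"

definition Gset :: "nat \<Rightarrow> int set" where
  "Gset n = {- int (n div 2) .. -1} \<union> {1 .. int (n div 2)}"

definition freq :: "nat \<Rightarrow> int \<Rightarrow> real" where
  "freq n j = 2 * pi * real_of_int j / real n"

definition gamma_hat :: "nat \<Rightarrow> (int \<Rightarrow> real) \<Rightarrow> int \<Rightarrow> real" where
  "gamma_hat n x h = 2 * pi / real n * (\<Sum>j\<in>Gset n. periodogram n x (freq n j) * cos (freq n j * real_of_int h))"

definition rho_hat :: "nat \<Rightarrow> (int \<Rightarrow> real) \<Rightarrow> int \<Rightarrow> real" where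
  "rho_hat n x h = gamma_hat n x h / gamma_hat n x 0"

text \<open>Y_n = O_P(r_n), restricted to the events E n (which must also hold with high probability)\<close>
definition bigOP_on :: "'a measure \<Rightarrow> (nat \<Rightarrow> 'a set) \<Rightarrow> (nat \<Rightarrow> 'a \<Rightarrow> real) \<Rightarrow> (nat \<Rightarrow> real) \<Rightarrow> bool" where
  "bigOP_on M E Y r \<longleftrightarrow>
     (\<forall>\<epsilon>>0. \<exists>K>0. \<exists>N. \<forall>n\<ge>N. measure M {\<omega>\<in>space M. \<omega> \<in> E n \<and> \<bar>Y n \<omega>\<bar> \<le> K * r n} \<ge> 1 - \<epsilon>)"

definition bigOP :: "'a measure \<Rightarrow> (nat \<Rightarrow> 'a \<Rightarrow> real) \<Rightarrow> (nat \<Rightarrow> real) \<Rightarrow> bool" where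
  "bigOP M Y r \<longleftrightarrow> bigOP_on M (\<lambda>_. UNIV) Y r"

end

(* Write A(z) = 1 - p z - q z^2, so that U_t = X_t - p X_{t-1} - q X_{t-2} almost surely. Apply the
   Yule-Walker expressions g(k) - p g(k-1) - q g(k-2), k = 0, 1, 2, to an autocovariance g of X:
   for the true one they give the cross-covariances E(U_k X_0), and for the periodogram estimate
   they give, up to boundary terms and the contributions of the frequencies 0 and pi, the averages
   of U_t X_{t-k}. These averages are unbiased with variance O(1/(n d)): only one factor of each
   product is resonant, so the variance of X, of order 1/d, enters once. Inverting the Yule-Walker
   map costs a factor 1/d, which makes the errors of the autocovariances relative to their size
   1/d of order (n d)^(-1/2), and (a_1, a_2) - (p, q) is 1/g(0) times a Lipschitz function of the
   Yule-Walker values and of 1/g(0). Hence the estimation error is O(d (n d)^(-1/2)), that is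
   O(n^(-(1+alpha)/2)). The arccosine is Lipschitz near cos lam0, which gives the last claim. *)

theory Submission
  imports Defs "HOL-Real_Asymp.Real_Asymp"
begin

text \<open>The obstacle is a factor d. With relative errors of order (n d)^(-1/2) in the
  autocovariances, a direct perturbation of the correlations bounds the error of (a_1, a_2) only by
  (n d)^(-1/2). The missing factor comes from a cancellation: the dominant error of the estimated
  autocovariances lies in the direction in which the Yule-Walker map is nearly singular, and that
  direction barely moves the coefficients. Writing everything in Yule-Walker values y_k makes this
  automatic, because the lag-one correlation is (y_1 / g(0) + p) / (1 - q) and no other ratio of
  autocovariances is needed. Nor would it do to show that both coefficient pairs are close to (p,
  q): that gives O(d), which is larger than the required d (n d)^(-1/2), as n d tends to infinity.
  So the two pairs are compared with each other, and their closeness to (p, q) serves only to keep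
  a_2 near -1 and the argument of the arccosine inside (-1, 1).\<close>

subsection \<open>Coefficients of the inverse filter\<close>

lemma sin_Suc_Suc_mult:
  "sin (real (Suc (Suc j)) * l) = 2 * cos l * sin (real (Suc j) * l) - sin (real j * l)"
  using sin_add[of "real (Suc j) * l" l] sin_diff[of "real (Suc j) * l" l]
  by (simp add: algebra_simps)

text \<open>The two roots of A are complex conjugate with modulus 1 / (1 - d) and arguments
  \<open>l\<close> and \<open>-l\<close>, and partial fractions give this quotient of sines. It is
  verified by multiplying back: the three-term recurrence of the sine annihilates every coefficient
  of the product after the zeroth.\<close>

lemma bcoef_eq:
  assumes "sin l \<noteq> 0"
  shows "bcoef l d j = (1 - d) ^ j * sin (real (Suc j) * l) / sin l"
proof -
  define B where "B = Abs_fps (\<lambda>j. (1 - d) ^ j * sin (real (Suc j) * l) / sin l)"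
  have "fps_nth (Apoly l d * B) n = fps_nth 1 n" for n
  proof -
    have "fps_nth (Apoly l d * B) n = fps_nth B n
        - 2 * (1 - d) * cos l * (if n = 0 then 0 else fps_nth B (n - 1))
        + (1 - d)\<^sup>2 * (if n < 2 then 0 else fps_nth B (n - 2))"
      by (simp add: Apoly_def left_diff_distrib distrib_right mult.assoc fps_X_power_mult_nth)
    also consider "n = 0" | "n = 1" | m where "n = Suc (Suc m)"
      by (metis One_nat_def not0_implies_Suc)
    then have "fps_nth B n
        - 2 * (1 - d) * cos l * (if n = 0 then 0 else fps_nth B (n - 1))
        + (1 - d)\<^sup>2 * (if n < 2 then 0 else fps_nth B (n - 2)) = fps_nth 1 n"
    proof cases
      case 1
      then show ?thesis using assms by (simp add: B_def)
    next
      case 2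
      then show ?thesis using assms by (simp add: B_def sin_double)
    next
      case 3
      show ?thesis using assms unfolding 3 B_def fps_nth_Abs_fps sin_Suc_Suc_mult[of "Suc m"]
        by (simp add: field_simps power2_eq_square)
    qed
    finally show ?thesis .
  qed
  then have "Apoly l d * B = 1" by (simp add: fps_eq_iff)
  then have "inverse (Apoly l d) = B" by (rule fps_inverse_unique)
  then show ?thesis by (simp add: bcoef_def B_def)
qed

lemma bcoef_abs_le:
  assumes "0 < sin l" "d \<in> {0<..<1}"
  shows "\<bar>bcoef l d j\<bar> \<le> (1 - d) ^ j / sin l"
  using assms by (auto simp: bcoef_eq abs_mult intro!: divide_right_mono mult_left_le)

lemma bcoef_abs_le':
  assumes "0 < sin l" "d \<in> {0<..<1}"
  shows "\<bar>bcoef l d j\<bar> \<le> 1 / sin l"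
proof -
  have "(1 - d) ^ j \<le> 1" using assms by (intro power_le_one) auto
  then have "(1 - d) ^ j / sin l \<le> 1 / sin l" using assms by (intro divide_right_mono) auto
  then show ?thesis using bcoef_abs_le[OF assms, of j] by linarith
qed

lemma bcoef_rec:
  assumes "sin l \<noteq> 0"
  shows "bcoef l d 0 = 1" "bcoef l d (Suc 0) = 2 * (1 - d) * cos l"
    "bcoef l d (Suc (Suc j)) = 2 * (1 - d) * cos l * bcoef l d (Suc j) - (1 - d)\<^sup>2 * bcoef l d j"
proof -
  show "bcoef l d 0 = 1" "bcoef l d (Suc 0) = 2 * (1 - d) * cos l"
    using assms by (simp_all add: bcoef_eq sin_double)
  show "bcoef l d (Suc (Suc j)) = 2 * (1 - d) * cos l * bcoef l d (Suc j) - (1 - d)\<^sup>2 * bcoef l d j"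
    using assms unfolding bcoef_eq[OF assms] sin_Suc_Suc_mult[of "Suc j"]
    by (simp add: field_simps power2_eq_square)
qed

lemma
  assumes "0 < sin l" "d \<in> {0<..<1}"
  shows summable_abs_bcoef: "summable (\<lambda>j. \<bar>bcoef l d j\<bar>)"
    and suminf_abs_bcoef_le: "(\<Sum>j. \<bar>bcoef l d j\<bar>) \<le> 1 / (sin l * d)"
proof -
  have g: "(\<lambda>j. (1 - d) ^ j / sin l) sums (1 / d / sin l)"
    using geometric_sums[of "1 - d"] assms by (intro sums_divide) auto
  show s: "summable (\<lambda>j. \<bar>bcoef l d j\<bar>)"
    using bcoef_abs_le[OF assms] by (intro summable_comparison_test'[OF sums_summable[OF g]]) auto
  have "(\<Sum>j. \<bar>bcoef l d j\<bar>) \<le> 1 / d / sin l"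
    using bcoef_abs_le[OF assms] by (intro sums_le[OF _ summable_sums[OF s] g]) auto
  then show "(\<Sum>j. \<bar>bcoef l d j\<bar>) \<le> 1 / (sin l * d)" by (simp add: field_simps)
qed

text \<open>The coefficients are bounded uniformly in \<open>d\<close>, so squaring them costs a
  constant: this sum has the order 1/d of the absolute sum, whereas the square of the absolute sum
  would have order 1/d^2. The variance bounds below rest on this.\<close>

lemma
  assumes "0 < sin l" "d \<in> {0<..<1}"
  shows summable_bcoef_sq: "summable (\<lambda>j. (bcoef l d j)\<^sup>2)"
    and suminf_bcoef_sq_le: "(\<Sum>j. (bcoef l d j)\<^sup>2) \<le> 1 / ((sin l)\<^sup>2 * d)"
proof -
  have *: "(bcoef l d j)\<^sup>2 \<le> 1 / sin l * \<bar>bcoef l d j\<bar>" for j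
    using mult_right_mono[OF bcoef_abs_le'[OF assms, of j], of "\<bar>bcoef l d j\<bar>"]
    by (simp add: power2_eq_square)
  have s1: "summable (\<lambda>j. 1 / sin l * \<bar>bcoef l d j\<bar>)"
    using summable_abs_bcoef[OF assms] by (intro summable_mult)
  show s: "summable (\<lambda>j. (bcoef l d j)\<^sup>2)"
    using * by (intro summable_comparison_test'[OF s1]) auto
  have "(\<Sum>j. (bcoef l d j)\<^sup>2) \<le> (\<Sum>j. 1 / sin l * \<bar>bcoef l d j\<bar>)"
    using * by (intro suminf_le s s1) auto
  also have "\<dots> = 1 / sin l * (\<Sum>j. \<bar>bcoef l d j\<bar>)"
    using summable_abs_bcoef[OF assms] by (rule suminf_mult)
  also have "\<dots> \<le> 1 / sin l * (1 / (sin l * d))"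
    using suminf_abs_bcoef_le[OF assms] assms by (intro mult_left_mono) auto
  finally show "(\<Sum>j. (bcoef l d j)\<^sup>2) \<le> 1 / ((sin l)\<^sup>2 * d)"
    by (simp add: power2_eq_square mult.assoc)
qed

text \<open>Two consecutive values of the sine cannot both be small.\<close>

lemma suminf_bcoef_sq_ge:
  assumes "0 < sin l" "d \<in> {0<..1/2}"
  shows "1 / (32 * d) \<le> (\<Sum>j. (bcoef l d j)\<^sup>2)"
proof -
  have d: "d \<in> {0<..<1}" using assms by auto
  have s: "summable (\<lambda>j. (bcoef l d j)\<^sup>2)" by (rule summable_bcoef_sq[OF assms(1) d])
  \<comment> \<open>The sine addition formula writes \<open>sin l\<close> as a combination of two
    consecutive sines with coefficients bounded by 1. The larger power of 1 - d is lowered to the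
    smaller one, so that the pairs sum to a geometric series.\<close>
  have pair: "(1 - d) ^ (2 * Suc j) / 2 \<le> (bcoef l d j)\<^sup>2 + (bcoef l d (Suc j))\<^sup>2" for j
  proof -
    define x y where "x = sin (real (Suc j) * l)" and "y = sin (real (Suc (Suc j)) * l)"
    define q where "q = 1 - d"
    have q: "0 \<le> q" "q \<le> 1" using d by (auto simp: q_def)
    have "sin l = y * cos (real (Suc j) * l) - cos (real (Suc (Suc j)) * l) * x"
      unfolding x_def y_def using sin_diff[of "real (Suc (Suc j)) * l" "real (Suc j) * l"]
      by (simp add: algebra_simps)
    also have "\<dots> \<le> \<bar>y\<bar> + \<bar>x\<bar>"
    proof -
      have "\<bar>y * cos (real (Suc j) * l)\<bar> \<le> \<bar>y\<bar>" "\<bar>cos (real (Suc (Suc j)) * l) * x\<bar> \<le> \<bar>x\<bar>"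
        by (auto simp: abs_mult intro: mult_left_le mult_left_le_one_le)
      then show ?thesis by linarith
    qed
    finally have "sin l \<le> \<bar>y\<bar> + \<bar>x\<bar>" .
    then have "(sin l)\<^sup>2 \<le> (\<bar>y\<bar> + \<bar>x\<bar>)\<^sup>2" using assms by (intro power_mono) auto
    also have "\<dots> \<le> 2 * (x\<^sup>2 + y\<^sup>2)"
      using sum_squares_bound[of "\<bar>y\<bar>" "\<bar>x\<bar>"] by (simp add: power2_sum)
    finally have xy: "(sin l)\<^sup>2 / 2 \<le> x\<^sup>2 + y\<^sup>2" by simp
    have "q ^ (2 * Suc j) * ((sin l)\<^sup>2 / 2) \<le> q ^ (2 * Suc j) * x\<^sup>2 + q ^ (2 * Suc j) * y\<^sup>2"
      using mult_left_mono[OF xy, of "q ^ (2 * Suc j)"] q by (simp add: distrib_left)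
    also have "\<dots> \<le> q ^ (2 * j) * x\<^sup>2 + q ^ (2 * Suc j) * y\<^sup>2"
      using q by (intro add_right_mono mult_right_mono power_decreasing) auto
    finally have "q ^ (2 * Suc j) / 2 * (sin l)\<^sup>2 \<le> q ^ (2 * j) * x\<^sup>2 + q ^ (2 * Suc j) * y\<^sup>2"
      by simp
    then have "q ^ (2 * Suc j) / 2 \<le> (q ^ (2 * j) * x\<^sup>2 + q ^ (2 * Suc j) * y\<^sup>2) / (sin l)\<^sup>2"
      using assms by (subst pos_le_divide_eq) auto
    also have "\<dots> = (bcoef l d j)\<^sup>2 + (bcoef l d (Suc j))\<^sup>2"
      using assms unfolding x_def y_def q_def
      by (simp add: bcoef_eq power_mult_distrib power_divide power_mult[symmetric] mult.commute
          add_divide_distrib del: power_Suc of_nat_Suc)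
    finally show ?thesis by (simp add: q_def)
  qed
  have sS: "summable (\<lambda>j. (bcoef l d (Suc j))\<^sup>2)" using s by (subst summable_Suc_iff)
  have q2: "(1 - d)\<^sup>2 < 1" using d by (intro power_less_one_iff[THEN iffD2]) auto
  have geo: "(\<lambda>j. (1 - d)\<^sup>2 / 2 * ((1 - d)\<^sup>2) ^ j) sums ((1 - d)\<^sup>2 / 2 * (1 / (1 - (1 - d)\<^sup>2)))"
    using q2 by (intro sums_mult geometric_sums) auto
  have "(1 - d)\<^sup>2 / 2 * (1 / (1 - (1 - d)\<^sup>2)) \<le> (\<Sum>j. (bcoef l d j)\<^sup>2 + (bcoef l d (Suc j))\<^sup>2)"
  proof (rule sums_le[OF _ geo summable_sums])
    show "summable (\<lambda>j. (bcoef l d j)\<^sup>2 + (bcoef l d (Suc j))\<^sup>2)" by (intro summable_add s sS)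
    show "(1 - d)\<^sup>2 / 2 * ((1 - d)\<^sup>2) ^ j \<le> (bcoef l d j)\<^sup>2 + (bcoef l d (Suc j))\<^sup>2" for j
      using pair[of j] by (simp only: power_mult power_Suc times_divide_eq_left)
  qed
  also have "\<dots> = (\<Sum>j. (bcoef l d j)\<^sup>2) + (\<Sum>j. (bcoef l d (Suc j))\<^sup>2)"
    by (rule suminf_add[OF s sS, symmetric])
  also have "(\<Sum>j. (bcoef l d (Suc j))\<^sup>2) \<le> (\<Sum>j. (bcoef l d j)\<^sup>2)"
    using suminf_split_head[OF s] by simp
  finally have *: "(1 - d)\<^sup>2 / 2 * (1 / (1 - (1 - d)\<^sup>2)) \<le> 2 * (\<Sum>j. (bcoef l d j)\<^sup>2)" by simp
  \<comment> \<open>For d at most 1/2 the geometric sum is at least 1/8 times 1 / (2 d). Every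
    coefficient occurs in at most two pairs, and halving gives 1 / (32 d).\<close>
  have "1 / 4 \<le> (1 - d)\<^sup>2" using power_mono[of "1/2" "1 - d" 2] assms by (simp add: power2_eq_square)
  moreover have "1 - (1 - d)\<^sup>2 \<le> 2 * d" by (simp add: power2_eq_square algebra_simps)
  ultimately have "1 / 4 / 2 * (1 / (2 * d)) \<le> (1 - d)\<^sup>2 / 2 * (1 / (1 - (1 - d)\<^sup>2))"
    using q2 assms by (intro mult_mono divide_right_mono divide_left_mono mult_pos_pos) auto
  with * show ?thesis by (simp add: field_simps)
qed

subsection \<open>The periodogram autocovariance in the time domain\<close>

text \<open>The cosines are real parts of a geometric progression in a root of unity, and its ratio
  is 1 exactly when \<open>n\<close> divides \<open>m\<close>. The starting point \<open>a\<close>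
  is left free because the grid is centred at 0 and the windows used later begin at -N or at -N +
  1.\<close>

lemma sum_cos_full_period:
  fixes a m :: int
  assumes "0 < n"
  shows "(\<Sum>j\<in>{a..<a + int n}. cos (freq n j * real_of_int m)) = (if int n dvd m then real n else 0)"
proof -
  define z where "z = cis (2 * pi * real_of_int m / real n)"
  have img: "{a..<a + int n} = (\<lambda>k. a + int k) ` {..<n}"
  proof (intro equalityI subsetI)
    fix x assume "x \<in> {a..<a + int n}"
    then have "x = a + int (nat (x - a))" "nat (x - a) \<in> {..<n}" by auto
    then show "x \<in> (\<lambda>k. a + int k) ` {..<n}" by blast
  qed auto
  have "(\<Sum>j\<in>{a..<a + int n}. cis (freq n j * real_of_int m))
      = (\<Sum>k<n. cis (freq n (a + int k) * real_of_int m))"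
    unfolding img by (subst sum.reindex) (auto simp: inj_on_def o_def)
  also have "\<dots> = (\<Sum>k<n. cis (freq n a * real_of_int m) * z ^ k)"
  proof (intro sum.cong refl)
    fix k
    have "freq n (a + int k) * real_of_int m
        = freq n a * real_of_int m + real k * (2 * pi * real_of_int m / real n)"
      by (simp add: freq_def ring_distribs add_divide_distrib)
    then show "cis (freq n (a + int k) * real_of_int m) = cis (freq n a * real_of_int m) * z ^ k"
      unfolding z_def Complex.DeMoivre cis_mult by presburger
  qed
  also have "\<dots> = cis (freq n a * real_of_int m) * (\<Sum>k<n. z ^ k)"
    by (simp add: sum_distrib_left)
  finally have S: "(\<Sum>j\<in>{a..<a + int n}. cis (freq n j * real_of_int m))
      = cis (freq n a * real_of_int m) * (\<Sum>k<n. z ^ k)" .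
  have zn: "z ^ n = 1"
    using assms cis_multiple_2pi[of "real_of_int m"] by (simp add: z_def Complex.DeMoivre)
  have Re: "(\<Sum>j\<in>{a..<a + int n}. cos (freq n j * real_of_int m))
      = Re (\<Sum>j\<in>{a..<a + int n}. cis (freq n j * real_of_int m))" by simp
  show ?thesis
  proof (cases "int n dvd m")
    case True
    then obtain q where q: "m = int n * q" by (auto simp: dvd_def)
    have "freq n j * real_of_int m = 2 * pi * real_of_int (j * q)" for j
      using assms by (simp add: q freq_def)
    then have "cos (freq n j * real_of_int m) = 1" for j
      by (simp only: cos_int_2pin)
    then show ?thesis using True by simp
  next
    case False
    have "z \<noteq> 1"
    proof
      assume "z = 1"
      then have "cos (2 * pi * real_of_int m / real n) = 1" by (metis Re_complex_of_real cis.sel(1) of_real_1 z_def)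
      then obtain k :: int where "2 * pi * real_of_int m / real n = real_of_int k * 2 * pi"
        unfolding cos_one_2pi_int by blast
      then have "real_of_int m = real_of_int (k * int n)" using assms by (simp add: field_simps)
      then have "m = k * int n" by linarith
      with False show False by simp
    qed
    then have "(\<Sum>k<n. z ^ k) = 0" using geometric_sum[of z n] zn by simp
    then show ?thesis unfolding Re S using False by simp
  qed
qed

lemma cmod_sum_cis_sq:
  fixes x :: "nat \<Rightarrow> real"
  assumes "finite A"
  shows "(cmod (\<Sum>t\<in>A. complex_of_real (x t) * cis (- l * real t)))\<^sup>2
     = (\<Sum>t\<in>A. \<Sum>s\<in>A. x t * x s * cos (l * (real t - real s)))"
proof -
  define S where "S = (\<Sum>t\<in>A. complex_of_real (x t) * cis (- l * real t))"
  have R: "Re S = (\<Sum>t\<in>A. x t * cos (l * real t))" "Im S = - (\<Sum>t\<in>A. x t * sin (l * real t))"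
    unfolding S_def by (simp_all add: sum_negf)
  show ?thesis unfolding S_def[symmetric] cmod_power2 R
    by (simp add: power2_eq_square sum_product flip: sum.distrib)
      (simp add: right_diff_distrib cos_diff algebra_simps)
qed

lemma periodogram_eq:
  "periodogram n x l = (\<Sum>t=1..n. \<Sum>s=1..n. x (int t) * x (int s) * cos (l * (real t - real s))) / (2 * pi * real n)"
  unfolding periodogram_def by (subst cmod_sum_cis_sq) auto

text \<open>The circular sample autocovariance: lags are read modulo \<open>n\<close>, so pairs wrap
  around the end of the sample. A sum over all Fourier frequencies produces it exactly, with no
  quadrature error to control.\<close>

definition circ_acov :: "nat \<Rightarrow> (int \<Rightarrow> real) \<Rightarrow> int \<Rightarrow> real" where
  "circ_acov n x h = (\<Sum>t=1..n. \<Sum>s=1..n. x (int t) * x (int s) * of_bool (int n dvd int t - int s - h)) / real n"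

lemma sum_periodogram_full_period:
  assumes "0 < n"
  shows "2 * pi / real n * (\<Sum>j\<in>{a..<a + int n}. periodogram n x (freq n j) * cos (freq n j * real_of_int h))
     = circ_acov n x h"
proof -
  define C where "C m = (\<Sum>j\<in>{a..<a + int n}. cos (freq n j * real_of_int m))" for m
  have C: "C m = (if int n dvd m then real n else 0)" for m
    unfolding C_def by (rule sum_cos_full_period[OF assms])
  have "(\<Sum>j\<in>{a..<a + int n}. periodogram n x (freq n j) * cos (freq n j * real_of_int h))
    = (\<Sum>j\<in>{a..<a + int n}. \<Sum>t=1..n. \<Sum>s=1..n. x (int t) * x (int s) / (2 * pi * real n) *
         (cos (freq n j * real_of_int (int t - int s - h)) + cos (freq n j * real_of_int (int t - int s + h))) / 2)"
    unfolding periodogram_eq sum_divide_distrib sum_distrib_right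
    by (intro sum.cong refl) (simp add: ring_distribs cos_add cos_diff add_divide_distrib mult_ac)
  also have "\<dots> = (\<Sum>t=1..n. \<Sum>s=1..n. x (int t) * x (int s) / (2 * pi * real n) *
         (C (int t - int s - h) + C (int t - int s + h)) / 2)"
    unfolding C_def sum.distrib[symmetric] sum_distrib_left sum_divide_distrib
    by (subst sum.swap, rule sum.cong, rule refl, rule sum.swap)
  also have "\<dots> = (\<Sum>t=1..n. \<Sum>s=1..n. x (int t) * x (int s) / (4 * pi) * of_bool (int n dvd int t - int s - h))
     + (\<Sum>t=1..n. \<Sum>s=1..n. x (int t) * x (int s) / (4 * pi) * of_bool (int n dvd int t - int s + h))"
    unfolding C sum.distrib[symmetric] using assms
    by (intro sum.cong refl) (auto simp: field_simps)
  \<comment> \<open>The product formula for cosines produces the lags \<open>h\<close> and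
    \<open>-h\<close>; exchanging the two time indices identifies their contributions.\<close>
  also have "(\<Sum>t=1..n. \<Sum>s=1..n. x (int t) * x (int s) / (4 * pi) * of_bool (int n dvd int t - int s + h))
     = (\<Sum>t=1..n. \<Sum>s=1..n. x (int t) * x (int s) / (4 * pi) * of_bool (int n dvd int t - int s - h))"
  proof (subst sum.swap, intro sum.cong refl)
    fix t s :: nat
    have "int n dvd int s - int t + h \<longleftrightarrow> int n dvd int t - int s - h"
      by (subst dvd_minus_iff[symmetric]) (simp add: algebra_simps)
    then show "x (int s) * x (int t) / (4 * pi) * of_bool (int n dvd int s - int t + h)
      = x (int t) * x (int s) / (4 * pi) * of_bool (int n dvd int t - int s - h)" by simp
  qed
  also have "(\<Sum>t=1..n. \<Sum>s=1..n. x (int t) * x (int s) / (4 * pi) * of_bool (int n dvd int t - int s - h))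
     = real n * circ_acov n x h / (4 * pi)"
    using assms unfolding circ_acov_def by (simp flip: sum_divide_distrib)
  finally show ?thesis using assms by (simp add: field_simps)
qed

text \<open>For odd n the grid misses only the frequency 0; for even n it also counts the frequency pi twice.\<close>

lemma gamma_hat_eq:
  assumes "0 < n"
  shows "gamma_hat n x h = circ_acov n x h - (\<Sum>t=1..n. x (int t))\<^sup>2 / (real n)\<^sup>2
     + (if even n then cos (pi * real_of_int h) * (\<Sum>t=1..n. (-1) ^ t * x (int t))\<^sup>2 / (real n)\<^sup>2 else 0)"
proof -
  define N where "N = int (n div 2)"
  define F where "F j = periodogram n x (freq n j) * cos (freq n j * real_of_int h)" for j
  have "0 \<le> N" by (simp add: N_def)
  have F0: "2 * pi / real n * F 0 = (\<Sum>t=1..n. x (int t))\<^sup>2 / (real n)\<^sup>2"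
    using assms by (simp add: F_def freq_def periodogram_eq power2_eq_square sum_product)
  have full: "2 * pi / real n * (\<Sum>j\<in>{a..<a + int n}. F j) = circ_acov n x h" for a
    unfolding F_def by (rule sum_periodogram_full_period[OF assms])
  have g: "gamma_hat n x h = 2 * pi / real n * (\<Sum>j\<in>Gset n. F j)"
    unfolding gamma_hat_def F_def by simp
  show ?thesis
  proof (cases "even n")
    case False
    then have n: "int n = 2 * N + 1" unfolding N_def by presburger
    have "{-N..<-N + int n} = insert 0 (Gset n)" "0 \<notin> Gset n"
      using n \<open>0 \<le> N\<close> by (auto simp: Gset_def N_def[symmetric])
    then have "(\<Sum>j\<in>{-N..<-N + int n}. F j) = F 0 + (\<Sum>j\<in>Gset n. F j)"
      by (simp add: Gset_def)
    then show ?thesis using full[of "-N"] F0 False unfolding g by (simp add: ring_distribs)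
  next
    case True
    then have n: "int n = 2 * N" unfolding N_def by presburger
    then have "0 < N" using assms by linarith
    then have "insert (-N) {-N + 1..<-N + 1 + int n} = insert 0 (Gset n)" "0 \<notin> Gset n" "-N \<notin> {-N + 1..<-N + 1 + int n}"
      using n by (auto simp: Gset_def N_def[symmetric])
    then have sums: "(\<Sum>j\<in>{-N + 1..<-N + 1 + int n}. F j) + F (-N) = F 0 + (\<Sum>j\<in>Gset n. F j)"
      using sum.insert[of "Gset n" 0 F] sum.insert[of "{-N + 1..<-N + 1 + int n}" "-N" F]
      by (simp add: Gset_def)
    have fr: "freq n (-N) = - pi"
    proof -
      have "real n = 2 * real_of_int N" using n by linarith
      then show ?thesis using \<open>0 < N\<close> by (simp add: freq_def)
    qed
    have "2 * pi / real n * F (-N) = cos (pi * real_of_int h) * (\<Sum>t=1..n. (-1) ^ t * x (int t))\<^sup>2 / (real n)\<^sup>2"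
    proof -
      have c: "cos (- pi * (real t - real s)) = (-1) ^ t * (-1) ^ s" for t s
        by (simp add: right_diff_distrib cos_diff mult.commute[of pi])
      show ?thesis unfolding F_def fr periodogram_eq c using assms
        by (simp add: power2_eq_square sum_product sum_distrib_left sum_divide_distrib mult_ac)
    qed
    moreover have "2 * pi / real n * (\<Sum>j\<in>Gset n. F j)
        = 2 * pi / real n * (\<Sum>j\<in>{-N + 1..<-N + 1 + int n}. F j) - 2 * pi / real n * F 0 + 2 * pi / real n * F (-N)"
      unfolding ring_distribs[symmetric] right_diff_distrib[symmetric] using sums
      by (intro arg_cong[where f = "(*) _"]) linarith
    ultimately show ?thesis using full[of "-N + 1"] F0 True unfolding g by simp
  qed
qed

text \<open>For a lag below \<open>n\<close>, each \<open>t\<close> has exactly one partner in 1..n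
  congruent to t - h: either t - h itself or its wrapped copy t - h + n.\<close>

lemma circ_acov_nat:
  assumes "h < n"
  shows "real n * circ_acov n x (int h) =
    (\<Sum>t=1..n. x (int t) * (if h < t then x (int t - int h) else x (int t - int h + int n)))"
proof -
  have "(\<Sum>s=1..n. x (int t) * x (int s) * of_bool (int n dvd int t - int s - int h))
      = x (int t) * (if h < t then x (int t - int h) else x (int t - int h + int n))"
    if t: "t \<in> {1..n}" for t
  proof -
    define r where "r = (if h < t then t - h else t + n - h)"
    have r: "r \<in> {1..n}" using t assms by (auto simp: r_def)
    have "(int n dvd int t - int s - int h) = (s = r)" if s: "s \<in> {1..n}" for s
    proof
      assume "s = r"
      then show "int n dvd int t - int s - int h" using t assms by (auto simp: r_def of_nat_diff)
    next
      assume "int n dvd int t - int s - int h"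
      moreover have "int n dvd int t - int r - int h" using t assms by (auto simp: r_def of_nat_diff)
      ultimately have "int n dvd int r - int s"
        using dvd_diff[of "int n" "int t - int s - int h" "int t - int r - int h"] by (simp add: algebra_simps)
      moreover have "\<bar>int r - int s\<bar> < int n" using r s by auto
      ultimately show "s = r" using zdvd_imp_le[of "int n" "\<bar>int r - int s\<bar>"] by fastforce
    qed
    then have "(\<Sum>s=1..n. x (int t) * x (int s) * of_bool (int n dvd int t - int s - int h))
        = (\<Sum>s=1..n. x (int t) * x (int s) * of_bool (s = r))" by (intro sum.cong) auto
    also have "\<dots> = x (int t) * x (int r)" using r by (simp add: of_bool_def if_distrib[of "\<lambda>c. _ * c"] sum.delta cong: if_cong)
    finally show ?thesis using t assms by (auto simp: r_def of_nat_diff add.commute add_diff_eq)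
  qed
  then have "(\<Sum>t=1..n. \<Sum>s=1..n. x (int t) * x (int s) * of_bool (int n dvd int t - int s - int h))
    = (\<Sum>t=1..n. x (int t) * (if h < t then x (int t - int h) else x (int t - int h + int n)))"
    by (rule sum.cong[OF refl])
  then show ?thesis using assms by (simp add: circ_acov_def)
qed

text \<open>An autocovariance is even; the absolute values let yw use only its values at 0, 1, 2.\<close>

definition yw :: "real \<Rightarrow> real \<Rightarrow> (int \<Rightarrow> real) \<Rightarrow> nat \<Rightarrow> real" where
  "yw p q g k = g (int k) - p * g \<bar>int k - 1\<bar> - q * g \<bar>int k - 2\<bar>"

section \<open>Shifted sums and wrap-around terms\<close>

lemma sum_shift_Suc0:
  fixes f :: "int \<Rightarrow> real"
  shows "(\<Sum>t=1..n. f (int t - 1)) = (\<Sum>t=1..n. f (int t)) + f 0 - f (int n)"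
proof (induction n)
  case (Suc n)
  then show ?case by simp
qed simp

lemma sum_shift_two:
  fixes f :: "int \<Rightarrow> real"
  shows "(\<Sum>t=1..n. f (int t - 2)) = (\<Sum>t=1..n. f (int t)) + f 0 + f (-1) - f (int n) - f (int n - 1)"
  using sum_shift_Suc0[of "\<lambda>t. f (t - 1)" n] sum_shift_Suc0[of f n] by simp

lemma circ_acov_0: "0 < n \<Longrightarrow> real n * circ_acov n x 0 = (\<Sum>t=1..n. x (int t) * x (int t))"
  using circ_acov_nat[of 0 n x] by simp

text \<open>Only t = 1 wraps. The linear sum reaches back to the unobserved value
  \<open>x 0\<close>, which is harmless: the process is defined at all integer times, and the
  correction will be bounded through second moments.\<close>

lemma circ_acov_1:
  assumes "1 < n"
  shows "real n * circ_acov n x 1 = (\<Sum>t=1..n. x (int t) * x (int t - 1)) + x 1 * x (int n) - x 1 * x 0"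
proof -
  have "real n * circ_acov n x 1 - (\<Sum>t=1..n. x (int t) * x (int t - 1))
     = (\<Sum>t=1..n. x (int t) * ((if 1 < t then x (int t - 1) else x (int t - 1 + int n)) - x (int t - 1)))"
    using circ_acov_nat[OF assms, of x] unfolding right_diff_distrib sum_subtractf
    by (simp cong: if_cong)
  also have "\<dots> = (\<Sum>t\<in>{1::nat}. x (int t) * ((if 1 < t then x (int t - 1) else x (int t - 1 + int n)) - x (int t - 1)))"
    using assms by (intro sum.mono_neutral_right) auto
  finally show ?thesis by (simp add: algebra_simps)
qed

lemma circ_acov_2:
  assumes "2 < n"
  shows "real n * circ_acov n x 2 = (\<Sum>t=1..n. x (int t) * x (int t - 2))
    + x 1 * x (int n - 1) - x 1 * x (-1) + x 2 * x (int n) - x 2 * x 0"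
proof -
  have "real n * circ_acov n x 2 - (\<Sum>t=1..n. x (int t) * x (int t - 2))
     = (\<Sum>t=1..n. x (int t) * ((if 2 < t then x (int t - 2) else x (int t - 2 + int n)) - x (int t - 2)))"
    using circ_acov_nat[OF assms, of x] unfolding right_diff_distrib sum_subtractf
    by (simp cong: if_cong)
  also have "\<dots> = (\<Sum>t\<in>{1::nat,2}. x (int t) * ((if 2 < t then x (int t - 2) else x (int t - 2 + int n)) - x (int t - 2)))"
    using assms by (intro sum.mono_neutral_right) auto
  finally show ?thesis by (simp add: algebra_simps)
qed

text \<open>The values that enter the wrap-around and shift corrections, two of them from before the
  sample. Being a sum of squares, it dominates every product of two of these values, and its mean
  needs only second moments of the process.\<close>

definition bdry :: "nat \<Rightarrow> (int \<Rightarrow> real) \<Rightarrow> real" where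
  "bdry n x = (x (-1))\<^sup>2 + (x 0)\<^sup>2 + (x 1)\<^sup>2 + (x 2)\<^sup>2 + (x (int n - 1))\<^sup>2 + (x (int n))\<^sup>2"

lemma abs_mult_le_bdry:
  assumes "i \<in> {-1, 0, 1, 2, int n - 1, int n}" "j \<in> {-1, 0, 1, 2, int n - 1, int n}"
  shows "\<bar>x i * x j\<bar> \<le> bdry n x"
proof -
  have "\<bar>x i\<bar> * \<bar>x j\<bar> \<le> ((x i)\<^sup>2 + (x j)\<^sup>2) / 2" using sum_squares_bound[of "\<bar>x i\<bar>" "\<bar>x j\<bar>"] by simp
  moreover have "(x i)\<^sup>2 \<le> bdry n x" "(x j)\<^sup>2 \<le> bdry n x"
    using assms unfolding bdry_def by (auto simp: add_increasing add_increasing2)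
  ultimately show ?thesis by (simp add: abs_mult)
qed

lemma abs_add_le: "\<bar>a\<bar> \<le> A \<Longrightarrow> \<bar>b\<bar> \<le> B \<Longrightarrow> \<bar>a + b\<bar> \<le> A + B"
  and abs_diff_le: "\<bar>a\<bar> \<le> A \<Longrightarrow> \<bar>b\<bar> \<le> B \<Longrightarrow> \<bar>a - b\<bar> \<le> A + B" for a b A B :: real
  by linarith+

text \<open>Substituting for \<open>u\<close> leaves sums of x(t - i) x(t - k); shifting the index
  turns them into the lagged sums that also make up the circular autocovariances, and only boundary
  products remain. With the bounds 2 and 1 on the coefficients, the cases k = 0, 1, 2 cost 8, 10 and
  16 copies of \<open>bdry\<close>, whence the common 20.\<close>

lemma yw_circ_acov:
  assumes "2 < n" "\<bar>p\<bar> \<le> 2" "\<bar>q\<bar> \<le> 1" "k \<le> 2"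
    and u: "\<And>t. u t = x t - p * x (t - 1) - q * x (t - 2)"
  shows "\<bar>real n * yw p q (circ_acov n x) k - (\<Sum>t=1..n. u (int t) * x (int t - int k))\<bar> \<le> 20 * bdry n x"
proof -
  define J where "J = {-1, 0, 1, 2, int n - 1, int n}"
  have mm: "-1 \<in> J" and m0: "0 \<in> J" and m1: "1 \<in> J" and m2: "2 \<in> J"
    and ml: "int n - 1 \<in> J" and mn: "int n \<in> J" by (simp_all add: J_def)
  note b = abs_mult_le_bdry[where n = n and x = x, folded J_def]
  define S where "S h = (\<Sum>t=1..n. x (int t) * x (int t - h))" for h
  have c0: "real n * circ_acov n x 0 = S 0"
    using circ_acov_0[of n x] assms by (simp add: S_def)
  have c1: "real n * circ_acov n x 1 = S 1 + x 1 * x (int n) - x 1 * x 0"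
    using circ_acov_1[of n x] assms by (simp add: S_def)
  have c2: "real n * circ_acov n x 2 = S 2 + x 1 * x (int n - 1) - x 1 * x (-1) + x 2 * x (int n) - x 2 * x 0"
    using circ_acov_2[of n x] assms by (simp add: S_def)
  have U: "(\<Sum>t=1..n. u (int t) * x (int t - int k))
    = (\<Sum>t=1..n. x (int t) * x (int t - int k)) - p * (\<Sum>t=1..n. x (int t - 1) * x (int t - int k))
      - q * (\<Sum>t=1..n. x (int t - 2) * x (int t - int k))"
    unfolding u by (simp add: algebra_simps sum_subtractf sum.distrib sum_distrib_left)
  define C where "C = circ_acov n x"
  have N: "real n * yw p q C 0 = real n * C 0 - p * (real n * C 1) - q * (real n * C 2)"
    "real n * yw p q C 1 = real n * C 1 - p * (real n * C 0) - q * (real n * C 1)"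
    "real n * yw p q C 2 = real n * C 2 - p * (real n * C 1) - q * (real n * C 0)"
    by (simp_all add: yw_def algebra_simps)
  note N = N[unfolded C_def c0 c1 c2]
  have P: "\<bar>p * y\<bar> \<le> 2 * c" and Q: "\<bar>q * y\<bar> \<le> c" if "\<bar>y\<bar> \<le> c" for y c
    using mult_mono[OF assms(2) that] mult_mono[OF assms(3) that] by (simp_all add: abs_mult)
  have pos: "0 \<le> bdry n x" by (simp add: bdry_def)
  consider "k = 0" | "k = 1" | "k = 2" using assms(4) by linarith
  then show ?thesis
  proof cases
    case 1
    have e: "real n * yw p q (circ_acov n x) k - (\<Sum>t=1..n. u (int t) * x (int t - int k))
      = p * (x 1 * x 0 - x 1 * x (int n))
        - q * (x 1 * x (int n - 1) - x 1 * x (-1) + x 2 * x (int n) - x 2 * x 0)"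
      unfolding U[unfolded 1] 1 N by (simp add: algebra_simps S_def)
    have "\<bar>real n * yw p q (circ_acov n x) k - (\<Sum>t=1..n. u (int t) * x (int t - int k))\<bar>
      \<le> 2 * (bdry n x + bdry n x) + (bdry n x + bdry n x + bdry n x + bdry n x)"
      unfolding e by (intro abs_add_le abs_diff_le P Q b; fact)
    also have "\<dots> \<le> 20 * bdry n x" using pos by simp
    finally show ?thesis .
  next
    case 2
    have s0: "(\<Sum>t=1..n. x (int t - 1) * x (int t - 1)) = S 0 + x 0 * x 0 - x (int n) * x (int n)"
      using sum_shift_Suc0[of "\<lambda>t. x t * x t" n] by (simp add: S_def)
    have s1: "(\<Sum>t=1..n. x (int t - 2) * x (int t - 1)) = S 1 + x 0 * x (-1) - x (int n) * x (int n - 1)"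
      using sum_shift_Suc0[of "\<lambda>t. x t * x (t - 1)" n] by (simp add: S_def mult.commute)
    have e: "real n * yw p q (circ_acov n x) k - (\<Sum>t=1..n. u (int t) * x (int t - int k))
      = x 1 * x (int n) - x 1 * x 0
        - p * (x (int n) * x (int n) - x 0 * x 0)
        - q * (x 1 * x (int n) - x 1 * x 0 - x 0 * x (-1) + x (int n) * x (int n - 1))"
      unfolding U[unfolded 2 of_nat_1] 2 N of_nat_1 s0 s1 by (simp add: algebra_simps S_def)
    have "\<bar>real n * yw p q (circ_acov n x) k - (\<Sum>t=1..n. u (int t) * x (int t - int k))\<bar>
      \<le> bdry n x + bdry n x + 2 * (bdry n x + bdry n x) + (bdry n x + bdry n x + bdry n x + bdry n x)"
      unfolding e by (intro abs_add_le abs_diff_le P Q b; fact)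
    also have "\<dots> \<le> 20 * bdry n x" using pos by simp
    finally show ?thesis .
  next
    case 3
    have s1: "(\<Sum>t=1..n. x (int t - 1) * x (int t - 2)) = S 1 + x 0 * x (-1) - x (int n) * x (int n - 1)"
      using sum_shift_Suc0[of "\<lambda>t. x t * x (t - 1)" n] by (simp add: S_def)
    have s0: "(\<Sum>t=1..n. x (int t - 2) * x (int t - 2)) = S 0 + x 0 * x 0 + x (-1) * x (-1)
        - x (int n) * x (int n) - x (int n - 1) * x (int n - 1)"
      using sum_shift_two[of "\<lambda>t. x t * x t" n] by (simp add: S_def)
    have e: "real n * yw p q (circ_acov n x) k - (\<Sum>t=1..n. u (int t) * x (int t - int k))
      = x 1 * x (int n - 1) - x 1 * x (-1) + x 2 * x (int n) - x 2 * x 0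
        - p * (x 1 * x (int n) - x 1 * x 0 - x 0 * x (-1) + x (int n) * x (int n - 1))
        - q * (x (int n) * x (int n) + x (int n - 1) * x (int n - 1) - x 0 * x 0 - x (-1) * x (-1))"
      unfolding U[unfolded 3 of_nat_numeral] 3 N of_nat_numeral s0 s1 by (simp add: algebra_simps S_def)
    have "\<bar>real n * yw p q (circ_acov n x) k - (\<Sum>t=1..n. u (int t) * x (int t - int k))\<bar>
      \<le> bdry n x + bdry n x + bdry n x + bdry n x + 2 * (bdry n x + bdry n x + bdry n x + bdry n x) + (bdry n x + bdry n x + bdry n x + bdry n x)"
      unfolding e by (intro abs_add_le abs_diff_le P Q b; fact)
    also have "\<dots> \<le> 20 * bdry n x" using pos by simp
    finally show ?thesis .
  qed
qed

text \<open>At the frequencies 0 and pi (e = 1, e = -1) the transfer function is bounded away from 0,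
  so the plain and the alternating sum of the process are controlled by those of the innovations.\<close>

lemma sum_filtered_sq_le:
  assumes e: "e = 1 \<or> e = (-1::real)" and r: "0 \<le> r" "r \<le> 1"
    and u: "\<And>t. u t = x t - 2 * r * cos l * x (t - 1) + r\<^sup>2 * x (t - 2)"
  shows "(sin l)^4 * (\<Sum>t=1..n. e ^ t * x (int t))\<^sup>2
    \<le> 2 * (\<Sum>t=1..n. e ^ t * u (int t))\<^sup>2 + 128 * bdry n x"
proof -
  define W where "W = (\<Sum>t=1..n. e ^ t * x (int t))"
  define V where "V = (\<Sum>t=1..n. e ^ t * u (int t))"
  have ee: "e * e = 1" using e by auto
  \<comment> \<open>Since e * e = 1, a shift of the index multiplies the signed sum by e, up to
    boundary values. Filtering therefore multiplies it by 1 - 2 r cos l e + r^2, the value of the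
    filter polynomial at e.\<close>
  have s1: "(\<Sum>t=1..n. e ^ t * x (int t - 1)) = e * W + e * x 0 - e * e ^ n * x (int n)"
    unfolding W_def using ee by (induction n) (auto simp: algebra_simps)
  have s2: "(\<Sum>t=1..n. e ^ t * x (int t - 2)) = W + x 0 + e * x (-1) - e ^ n * x (int n) - e * e ^ n * x (int n - 1)"
    unfolding W_def
  proof (induction n)
    case (Suc n)
    have eey: "e * (e * y) = y" for y using ee by (simp flip: mult.assoc)
    show ?case using Suc by (simp add: algebra_simps eey)
  qed simp
  define R where "R = 2 * r * cos l * (e * x 0 - e * e ^ n * x (int n))
      - r\<^sup>2 * (x 0 + e * x (-1) - e ^ n * x (int n) - e * e ^ n * x (int n - 1))"
  have "V = W - 2 * r * cos l * (e * W + e * x 0 - e * e ^ n * x (int n))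
      + r\<^sup>2 * (W + x 0 + e * x (-1) - e ^ n * x (int n) - e * e ^ n * x (int n - 1))"
    unfolding V_def u s1[symmetric] s2[symmetric]
    by (simp add: W_def algebra_simps sum_subtractf sum.distrib sum_distrib_left)
  then have VW: "(1 - 2 * r * cos l * e + r\<^sup>2) * W = V + R"
    by (simp add: R_def algebra_simps)
  have en: "\<bar>e ^ n\<bar> = 1" "\<bar>e\<bar> = 1" using e by (auto simp: power_abs)
  have "\<bar>2 * r * cos l * (e * x 0 - e * e ^ n * x (int n))\<bar> \<le> 2 * (\<bar>x 0\<bar> + \<bar>x (int n)\<bar>)"
  proof -
    have "\<bar>2 * r * cos l\<bar> \<le> 2 * 1 * 1" unfolding abs_mult using r by (intro mult_mono) auto
    moreover have "\<bar>e * x 0 - e * e ^ n * x (int n)\<bar> \<le> \<bar>e * x 0\<bar> + \<bar>e * e ^ n * x (int n)\<bar>" by linarith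
    ultimately show ?thesis using en by (subst abs_mult, intro mult_mono) (auto simp: abs_mult)
  qed
  moreover have "\<bar>r\<^sup>2 * (x 0 + e * x (-1) - e ^ n * x (int n) - e * e ^ n * x (int n - 1))\<bar>
      \<le> 1 * (\<bar>x 0\<bar> + \<bar>x (-1)\<bar> + \<bar>x (int n)\<bar> + \<bar>x (int n - 1)\<bar>)"
  proof -
    have "\<bar>r\<^sup>2\<bar> \<le> 1" using r by (simp add: power_le_one)
    moreover have "\<bar>x 0 + e * x (-1) - e ^ n * x (int n) - e * e ^ n * x (int n - 1)\<bar>
      \<le> \<bar>x 0\<bar> + \<bar>e * x (-1)\<bar> + \<bar>e ^ n * x (int n)\<bar> + \<bar>e * e ^ n * x (int n - 1)\<bar>" by linarith
    ultimately show ?thesis using en by (subst abs_mult, intro mult_mono) (auto simp: abs_mult)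
  qed
  ultimately have Rle: "\<bar>R\<bar> \<le> 3 * \<bar>x 0\<bar> + \<bar>x (-1)\<bar> + 3 * \<bar>x (int n)\<bar> + \<bar>x (int n - 1)\<bar>"
    using abs_triangle_ineq4[of "2 * r * cos l * (e * x 0 - e * e ^ n * x (int n))"
      "r\<^sup>2 * (x 0 + e * x (-1) - e ^ n * x (int n) - e * e ^ n * x (int n - 1))"]
    unfolding R_def by (simp del: abs_mult)
  have sq: "\<bar>x i\<bar> \<le> sqrt (bdry n x)" if "i \<in> {-1, 0, int n - 1, int n}" for i
    using abs_mult_le_bdry[of i n i x] that by (intro real_le_rsqrt) (auto simp: power2_eq_square)
  \<comment> \<open>The four weights 3, 1, 3, 1 add up to 8. Squaring gives 64, and (V + R)^2 <= 2
    V^2 + 2 R^2 doubles it to the 128 of the statement.\<close>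
  have "\<bar>R\<bar> \<le> 8 * sqrt (bdry n x)"
    using Rle sq[of 0] sq[of "-1"] sq[of "int n"] sq[of "int n - 1"] by simp
  then have "\<bar>R\<bar>\<^sup>2 \<le> (8 * sqrt (bdry n x))\<^sup>2" by (intro power_mono) auto
  then have R2: "R\<^sup>2 \<le> 64 * bdry n x" by (simp add: power_mult_distrib bdry_def)
  \<comment> \<open>Completing the square in \<open>r\<close> leaves exactly sin^2 l, a lower bound
    uniform in \<open>r\<close>.\<close>
  have "(sin l)\<^sup>2 \<le> 1 - 2 * r * cos l * e + r\<^sup>2"
  proof -
    have "1 - 2 * r * cos l * e + r\<^sup>2 = (r - e * cos l)\<^sup>2 + (sin l)\<^sup>2"
      using ee by (simp add: power2_diff power_mult_distrib sin_squared_eq power2_eq_square[of e])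
    then show ?thesis by simp
  qed
  then have "((sin l)\<^sup>2)\<^sup>2 \<le> (1 - 2 * r * cos l * e + r\<^sup>2)\<^sup>2" by (intro power_mono) auto
  then have "(sin l)^4 * W\<^sup>2 \<le> (1 - 2 * r * cos l * e + r\<^sup>2)\<^sup>2 * W\<^sup>2"
    by (intro mult_right_mono) (auto simp: power_mult[symmetric])
  also have "\<dots> = (V + R)\<^sup>2" unfolding VW[symmetric] by (simp add: power_mult_distrib)
  also have "\<dots> \<le> 2 * V\<^sup>2 + 2 * R\<^sup>2" using sum_squares_bound[of V R] by (simp add: power2_sum)
  also have "\<dots> \<le> 2 * V\<^sup>2 + 128 * bdry n x" using R2 by simp
  finally show ?thesis by (simp add: W_def V_def)
qed

text \<open>The frequencies 0 and pi change each autocovariance by at most 1/n^2 times the squared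
  plain and alternating sums of \<open>x\<close>, hence a Yule-Walker value by at most 4 times that,
  as 1 + 2 + 1 bounds the coefficients. Trading these sums for those of \<open>u\<close> gives the
  factors 4 * 2 = 8 and 4 * 256 = 1024, and the wrap-around terms raise the latter to 1044.\<close>

lemma yw_gamma_hat:
  assumes n: "2 < n" and r: "0 \<le> r" "r \<le> 1" and k: "k \<le> 2" and l: "0 < sin l"
    and u: "\<And>t. u t = x t - 2 * r * cos l * x (t - 1) + r\<^sup>2 * x (t - 2)"
  shows "\<bar>yw (2 * r * cos l) (- r\<^sup>2) (gamma_hat n x) k - (\<Sum>t=1..n. u (int t) * x (int t - int k)) / real n\<bar>
    \<le> 1044 / (sin l)^4 * bdry n x / real n
      + 8 / (sin l)^4 * ((\<Sum>t=1..n. u (int t))\<^sup>2 + (\<Sum>t=1..n. (-1) ^ t * u (int t))\<^sup>2) / (real n)\<^sup>2"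
proof -
  define p q where "p = 2 * r * cos l" and "q = - r\<^sup>2"
  define s where "s = (sin l)^4"
  have s: "0 < s" "s \<le> 1" using l by (auto simp: s_def intro!: power_le_one)
  have pq: "\<bar>p\<bar> \<le> 2" "\<bar>q\<bar> \<le> 1"
  proof -
    have "\<bar>p\<bar> \<le> 2 * 1 * 1" unfolding p_def abs_mult using r by (intro mult_mono) auto
    then show "\<bar>p\<bar> \<le> 2" by simp
    show "\<bar>q\<bar> \<le> 1" using r by (simp add: q_def power_le_one)
  qed
  have u': "u t = x t - p * x (t - 1) - q * x (t - 2)" for t by (simp add: u p_def q_def)
  define B where "B = bdry n x"
  have B: "0 \<le> B" by (simp add: B_def bdry_def)
  define W1 W2 V1 V2 where "W1 = (\<Sum>t=1..n. x (int t))\<^sup>2" and "W2 = (\<Sum>t=1..n. (-1) ^ t * x (int t))\<^sup>2"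
    and "V1 = (\<Sum>t=1..n. u (int t))\<^sup>2" and "V2 = (\<Sum>t=1..n. (-1) ^ t * u (int t))\<^sup>2"
  have W: "s * W1 \<le> 2 * V1 + 128 * B" "s * W2 \<le> 2 * V2 + 128 * B"
    using sum_filtered_sq_le[of 1 r u x l n] sum_filtered_sq_le[of "-1" r u x l n] r u
    by (simp_all add: s_def W1_def W2_def V1_def V2_def B_def)
  define E where "E h = gamma_hat n x h - circ_acov n x h" for h
  have Eb: "\<bar>E h\<bar> \<le> (W1 + W2) / (real n)\<^sup>2" for h
  proof -
    have 1: "0 \<le> W1 / (real n)\<^sup>2" "0 \<le> W2 / (real n)\<^sup>2" by (simp_all add: W1_def W2_def)
    have "\<bar>cos (pi * real_of_int h) * W2 / (real n)\<^sup>2\<bar> \<le> W2 / (real n)\<^sup>2"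
      by (auto simp: abs_mult W2_def intro!: divide_right_mono mult_left_le_one_le)
    moreover have "E h = - (W1 / (real n)\<^sup>2) + (if even n then cos (pi * real_of_int h) * W2 / (real n)\<^sup>2 else 0)"
      using n gamma_hat_eq[of n x h] by (simp only: E_def W1_def W2_def)
    ultimately show ?thesis using 1 by (cases "even n") (simp_all only: add_divide_distrib if_True if_False simp_thms)
  qed
  have yE: "yw p q (gamma_hat n x) k - yw p q (circ_acov n x) k
      = E (int k) - p * E \<bar>int k - 1\<bar> - q * E \<bar>int k - 2\<bar>"
    by (simp add: yw_def E_def algebra_simps)
  have "\<bar>p * E \<bar>int k - 1\<bar>\<bar> \<le> 2 * ((W1 + W2) / (real n)\<^sup>2)" "\<bar>q * E \<bar>int k - 2\<bar>\<bar> \<le> 1 * ((W1 + W2) / (real n)\<^sup>2)"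
    unfolding abs_mult using pq Eb by (intro mult_mono; simp)+
  then have a: "\<bar>yw p q (gamma_hat n x) k - yw p q (circ_acov n x) k\<bar> \<le> 4 * ((W1 + W2) / (real n)\<^sup>2)"
    unfolding yE using Eb[of "int k"] by linarith
  have "4 * ((W1 + W2) / (real n)\<^sup>2) \<le> 8 / s * (V1 + V2) / (real n)\<^sup>2 + 1024 / s * B / real n"
  proof -
    have "W1 + W2 \<le> (2 * (V1 + V2) + 256 * B) / s"
      using W s(1) by (subst pos_le_divide_eq) (simp_all add: ring_distribs mult.commute[of _ s])
    then have "4 * ((W1 + W2) / (real n)\<^sup>2) \<le> 4 * ((2 * (V1 + V2) + 256 * B) / s / (real n)\<^sup>2)"
      by (intro mult_left_mono divide_right_mono) auto
    also have "\<dots> = 8 / s * (V1 + V2) / (real n)\<^sup>2 + 1024 / s * B / (real n)\<^sup>2"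
      by (simp add: add_divide_distrib ring_distribs)
    also have "1024 / s * B / (real n)\<^sup>2 \<le> 1024 / s * B / real n"
      using n s B by (intro divide_left_mono) (auto simp: power2_eq_square)
    finally show ?thesis by simp
  qed
  moreover have "\<bar>yw p q (circ_acov n x) k - (\<Sum>t=1..n. u (int t) * x (int t - int k)) / real n\<bar> \<le> 20 / s * B / real n"
  proof -
    have "\<bar>real n * yw p q (circ_acov n x) k - (\<Sum>t=1..n. u (int t) * x (int t - int k))\<bar> \<le> 20 * B"
      unfolding B_def by (rule yw_circ_acov[OF n pq k u'])
    also have "\<dots> \<le> 20 / s * B" using s B by (intro mult_right_mono) (auto simp: field_simps)
    finally have "\<bar>real n * yw p q (circ_acov n x) k - (\<Sum>t=1..n. u (int t) * x (int t - int k))\<bar> / real n \<le> 20 / s * B / real n"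
      by (rule divide_right_mono) simp
    moreover have "(real n * yw p q (circ_acov n x) k - (\<Sum>t=1..n. u (int t) * x (int t - int k))) / real n
       = yw p q (circ_acov n x) k - (\<Sum>t=1..n. u (int t) * x (int t - int k)) / real n"
      using n by (simp add: diff_divide_distrib)
    moreover have "\<bar>X\<bar> / real n = \<bar>X / real n\<bar>" for X by simp
    ultimately show ?thesis by (simp only:)
  qed
  ultimately have "\<bar>yw p q (gamma_hat n x) k - (\<Sum>t=1..n. u (int t) * x (int t - int k)) / real n\<bar>
    \<le> (8 / s * (V1 + V2) / (real n)\<^sup>2 + 1024 / s * B / real n) + 20 / s * B / real n"
    using a by linarith
  also have "\<dots> = 1044 / s * B / real n + 8 / s * (V1 + V2) / (real n)\<^sup>2"
    by (simp add: add_divide_distrib[symmetric] distrib_right[symmetric])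
  finally show ?thesis
    unfolding p_def q_def s_def B_def V1_def V2_def .
qed

subsection \<open>Stability of the AR(2) coefficients\<close>

lemma abs_mult_diff_le:
  fixes a a' b b' :: real
  assumes "\<bar>a\<bar> \<le> A" "\<bar>b'\<bar> \<le> B" "\<bar>a' - a\<bar> \<le> \<alpha>" "\<bar>b' - b\<bar> \<le> \<beta>"
  shows "\<bar>a' * b' - a * b\<bar> \<le> \<alpha> * B + A * \<beta>"
proof -
  have "a' * b' - a * b = (a' - a) * b' + a * (b' - b)" by (simp add: algebra_simps)
  also have "\<bar>\<dots>\<bar> \<le> \<bar>a' - a\<bar> * \<bar>b'\<bar> + \<bar>a\<bar> * \<bar>b' - b\<bar>"
    by (metis abs_mult abs_triangle_ineq)
  also have "\<dots> \<le> \<alpha> * B + A * \<beta>" using assms by (intro add_mono mult_mono) auto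
  finally show ?thesis .
qed

lemma abs_mult_le:
  fixes a b :: real
  shows "\<bar>a\<bar> \<le> A \<Longrightarrow> \<bar>b\<bar> \<le> B \<Longrightarrow> \<bar>a * b\<bar> \<le> A * B"
  by (auto simp: abs_mult intro!: mult_mono)

lemma arccos_lipschitz:
  assumes "\<bar>x\<bar> \<le> m" "\<bar>y\<bar> \<le> m" "m < 1"
  shows "\<bar>arccos y - arccos x\<bar> \<le> 1 / sqrt (1 - m\<^sup>2) * \<bar>y - x\<bar>"
proof -
  have "norm (arccos y - arccos x) \<le> 1 / sqrt (1 - m\<^sup>2) * norm (y - x)"
  proof (rule field_differentiable_bound[where S = "{-m..m}" and f' = "\<lambda>z. inverse (- sqrt (1 - z\<^sup>2))"])
    fix z assume z: "z \<in> {-m..m}"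
    then show "(arccos has_field_derivative inverse (- sqrt (1 - z\<^sup>2))) (at z within {-m..m})"
      using assms by (intro DERIV_subset[OF DERIV_arccos]) auto
    have "z\<^sup>2 \<le> m\<^sup>2" using z by (intro power2_le_iff_abs_le[THEN iffD2]) auto
    moreover have "m\<^sup>2 < 1" using assms by (auto simp: abs_square_less_1)
    ultimately show "norm (inverse (- sqrt (1 - z\<^sup>2))) \<le> 1 / sqrt (1 - m\<^sup>2)"
      by (simp add: divide_inverse)
  qed (use assms in auto)
  then show ?thesis by simp
qed

text \<open>The pair (a_1, a_2) solves the Yule-Walker equations for k = 1, 2, while (p, q) leaves
  the residuals \<open>yw p q g 1\<close> and \<open>yw p q g 2\<close>. The difference of the pairs
  is the inverse of the correlation matrix with off-diagonal entry \<open>\<rho>\<close>, applied to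
  the residuals divided by \<open>g 0\<close>. Expressing \<open>\<rho>\<close> through the first
  residual keeps \<open>g 1\<close>, whose error is large, out of the formula.\<close>

lemma ar2_coeffs_yw:
  assumes g: "g 0 \<noteq> 0" and q: "1 - q \<noteq> 0"
    and \<rho>: "\<rho> = (yw p q g 1 * (1 / g 0) + p) / (1 - q)" "\<rho>\<^sup>2 \<noteq> 1"
  shows "ar2_a1 (\<lambda>h. g h / g 0) = p + 1 / g 0 * ((yw p q g 1 - \<rho> * yw p q g 2) * (1 / (1 - \<rho>\<^sup>2)))"
    "ar2_a2 (\<lambda>h. g h / g 0) = q + 1 / g 0 * ((yw p q g 2 - \<rho> * yw p q g 1) * (1 / (1 - \<rho>\<^sup>2)))"
proof -
  define \<sigma> where "\<sigma> = g 2 / g 0"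
  define w v1 v2 where "w = 1 / g 0" and "v1 = yw p q g 1" and "v2 = yw p q g 2"
  have "v1 * w = g 1 / g 0 * (1 - q) - p"
    using g by (simp add: v1_def yw_def w_def field_simps)
  with \<rho>(1) q have r1: "g 1 / g 0 = \<rho>" by (simp add: w_def v1_def)
  with \<open>v1 * w = _\<close> have v1: "w * v1 = \<rho> * (1 - q) - p" by (simp add: mult.commute)
  have v2: "w * v2 = \<sigma> - p * \<rho> - q"
    using g unfolding r1[symmetric] by (simp add: v2_def yw_def w_def \<sigma>_def field_simps)
  have D: "1 - \<rho>\<^sup>2 \<noteq> 0" using \<rho>(2) by simp
  have "p + w * ((v1 - \<rho> * v2) * (1 / (1 - \<rho>\<^sup>2))) = p + (w * v1 - \<rho> * (w * v2)) / (1 - \<rho>\<^sup>2)"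
    by (simp add: algebra_simps)
  also have "\<dots> = \<rho> * (1 - \<sigma>) / (1 - \<rho>\<^sup>2)"
    unfolding v1 v2 using D by (simp add: field_simps power2_eq_square)
  finally show "ar2_a1 (\<lambda>h. g h / g 0) = p + 1 / g 0 * ((yw p q g 1 - \<rho> * yw p q g 2) * (1 / (1 - \<rho>\<^sup>2)))"
    unfolding ar2_a1_def r1 \<sigma>_def[symmetric] w_def v1_def v2_def by simp
  have "q + w * ((v2 - \<rho> * v1) * (1 / (1 - \<rho>\<^sup>2))) = q + (w * v2 - \<rho> * (w * v1)) / (1 - \<rho>\<^sup>2)"
    by (simp add: algebra_simps)
  also have "\<dots> = (\<sigma> - \<rho>\<^sup>2) / (1 - \<rho>\<^sup>2)"
    unfolding v1 v2 using D by (simp add: field_simps power2_eq_square)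
  finally show "ar2_a2 (\<lambda>h. g h / g 0) = q + 1 / g 0 * ((yw p q g 2 - \<rho> * yw p q g 1) * (1 / (1 - \<rho>\<^sup>2)))"
    unfolding ar2_a2_def r1 \<sigma>_def[symmetric] w_def v1_def v2_def by simp
qed

text \<open>Cramer's rule for the three Yule-Walker equations in g 0, g 1, g 2, solved for g 0. If
  the values for k = 1, 2 vanish, it is the classical variance formula of an AR(2) process.\<close>

lemma yw_solve_0:
  "(1 - r\<^sup>2) * ((1 + r\<^sup>2)\<^sup>2 - p\<^sup>2) * g 0
    = (1 + r\<^sup>2) * (yw p (- r\<^sup>2) g 0 - r\<^sup>2 * yw p (- r\<^sup>2) g 2) + p * (1 - r\<^sup>2) * yw p (- r\<^sup>2) g 1"
  by (simp add: yw_def power2_eq_square algebra_simps)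

text \<open>The Yule--Walker matrix has determinant of order d: dividing by it costs a factor 1/d.\<close>

lemma yw_inverse_bound:
  assumes l: "0 < sin l" and d: "0 < d" "d \<le> 1/2"
    and v: "\<And>k. k \<le> 2 \<Longrightarrow>
      \<bar>yw (2 * (1 - d) * cos l) (- (1 - d)\<^sup>2) g' k - yw (2 * (1 - d) * cos l) (- (1 - d)\<^sup>2) g k\<bar> \<le> \<eta>"
  shows "\<bar>g' 0 - g 0\<bar> \<le> 6 * \<eta> / (d * (sin l)\<^sup>2)"
proof -
  define r p where "r = 1 - d" and "p = 2 * r * cos l"
  define y y' where "y k = yw p (- r\<^sup>2) g k" and "y' k = yw p (- r\<^sup>2) g' k" for k
  have v: "\<bar>y' k - y k\<bar> \<le> \<eta>" if "k \<le> 2" for k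
    using v[OF that] by (simp add: y_def y'_def p_def r_def)
  have r: "1/2 \<le> r" "r \<le> 1" using d by (auto simp: r_def)
  have r2: "0 \<le> r\<^sup>2" "r\<^sup>2 \<le> 1" using r by (auto simp: power_le_one)
  have \<eta>: "0 \<le> \<eta>" using v[of 0] by linarith
  have p: "\<bar>p\<bar> \<le> 2"
  proof -
    have "\<bar>p\<bar> \<le> 2 * 1 * 1" unfolding p_def abs_mult using r by (intro mult_mono) auto
    then show ?thesis by simp
  qed
  \<comment> \<open>This factor of the determinant carries the whole degeneracy: it equals d (2 -
    d). The other factor is a square plus 4 r^2 sin^2 l, which is at least sin^2 l because r >=
    1/2.\<close>
  have d1: "d \<le> 1 - r\<^sup>2" using d by (simp add: r_def power2_eq_square algebra_simps)
  have "(1 + r\<^sup>2)\<^sup>2 - p\<^sup>2 = (1 - r\<^sup>2)\<^sup>2 + 4 * r\<^sup>2 * (sin l)\<^sup>2"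
    unfolding p_def power_mult_distrib cos_squared_eq by (simp add: power2_eq_square algebra_simps)
  moreover have "1 * (sin l)\<^sup>2 \<le> 4 * r\<^sup>2 * (sin l)\<^sup>2"
    using power_mono[of "1/2" r 2] r by (intro mult_right_mono) (auto simp: power2_eq_square)
  ultimately have d2: "(sin l)\<^sup>2 \<le> (1 + r\<^sup>2)\<^sup>2 - p\<^sup>2" by (simp add: add_increasing)
  have "(1 - r\<^sup>2) * ((1 + r\<^sup>2)\<^sup>2 - p\<^sup>2) * (g' 0 - g 0)
      = (1 + r\<^sup>2) * ((y' 0 - y 0) - r\<^sup>2 * (y' 2 - y 2)) + p * (1 - r\<^sup>2) * (y' 1 - y 1)"
    using yw_solve_0[of r p g] yw_solve_0[of r p g'] unfolding y_def y'_def
    by (simp add: right_diff_distrib)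
  also have "\<bar>\<dots>\<bar> \<le> 2 * (\<eta> + 1 * \<eta>) + 2 * 1 * \<eta>"
  proof -
    have "\<bar>r\<^sup>2 * (y' 2 - y 2)\<bar> \<le> 1 * \<eta>" using r2 by (intro abs_mult_le v) auto
    then have "\<bar>(y' 0 - y 0) - r\<^sup>2 * (y' 2 - y 2)\<bar> \<le> \<eta> + 1 * \<eta>" using v[of 0] by linarith
    then have "\<bar>(1 + r\<^sup>2) * ((y' 0 - y 0) - r\<^sup>2 * (y' 2 - y 2))\<bar> \<le> 2 * (\<eta> + 1 * \<eta>)"
      using r2 by (intro abs_mult_le) auto
    moreover have "\<bar>p * (1 - r\<^sup>2) * (y' 1 - y 1)\<bar> \<le> 2 * 1 * \<eta>"
      using r2 p by (intro abs_mult_le v) auto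
    ultimately show ?thesis by (rule abs_add_le)
  qed
  finally have *: "\<bar>(1 - r\<^sup>2) * ((1 + r\<^sup>2)\<^sup>2 - p\<^sup>2) * (g' 0 - g 0)\<bar> \<le> 6 * \<eta>" by simp
  have "(d * (sin l)\<^sup>2) * \<bar>g' 0 - g 0\<bar> \<le> ((1 - r\<^sup>2) * ((1 + r\<^sup>2)\<^sup>2 - p\<^sup>2)) * \<bar>g' 0 - g 0\<bar>"
    using d d1 d2 l by (intro mult_right_mono mult_mono) auto
  also have "\<dots> \<le> \<bar>(1 - r\<^sup>2) * ((1 + r\<^sup>2)\<^sup>2 - p\<^sup>2)\<bar> * \<bar>g' 0 - g 0\<bar>"
    by (intro mult_right_mono) auto
  also have "\<dots> \<le> 6 * \<eta>" using * by (simp add: abs_mult)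
  finally show ?thesis using d l by (simp add: pos_le_divide_eq mult.commute)
qed

text \<open>The box contains the limit (2 cos lam0, -1) of the coefficients, at which the argument
  of the arccosine is cos lam0. The map is \<open>a\<close> times (1 - 1/b) / 4; the second factor
  is bounded by 3/4 and moves by at most \<open>\<epsilon>\<close>, so 3/4 + 3 <= 4 is a Lipschitz
  constant.\<close>

lemma peak_arg_lipschitz:
  fixes a b a' b' :: real
  assumes "\<bar>a\<bar> \<le> 3" "b \<in> {-3/2..-1/2}" "b' \<in> {-3/2..-1/2}" "\<bar>a' - a\<bar> \<le> \<epsilon>" "\<bar>b' - b\<bar> \<le> \<epsilon>"
  shows "\<bar>a' * (1 - b') / (- 4 * b') - a * (1 - b) / (- 4 * b)\<bar> \<le> 4 * \<epsilon>"
proof -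
  have \<epsilon>: "0 \<le> \<epsilon>" using assms by linarith
  have z: "x * (1 - y) / (- 4 * y) = x * ((1 - 1 / y) / 4)" if "y \<in> {-3/2..-1/2}" for x y :: real
    using that by (auto simp: field_simps)
  have "\<bar>1 / b\<bar> \<le> 2" "\<bar>1 / b'\<bar> \<le> 2" using assms(2,3) le_imp_inverse_le[of "1/2" "\<bar>b\<bar>"] le_imp_inverse_le[of "1/2" "\<bar>b'\<bar>"]
    by (simp_all add: inverse_eq_divide abs_divide)
  have "\<bar>1 / b' - 1 / b\<bar> = \<bar>(1 / b) * ((1 / b') * (b' - b))\<bar>"
    using assms(2,3) by (subst abs_minus_commute) (auto simp: field_simps)
  also have "\<dots> \<le> 2 * (2 * \<epsilon>)" by (intro abs_mult_le; fact)
  finally have "\<bar>1 / b' - 1 / b\<bar> \<le> 4 * \<epsilon>" by simp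
  moreover have "\<bar>(1 - y) / 4 - (1 - x) / 4\<bar> \<le> \<epsilon>" if "\<bar>y - x\<bar> \<le> 4 * \<epsilon>" for x y
  proof -
    have "(1 - y) / 4 - (1 - x) / 4 = (x - y) / 4" by (simp add: diff_divide_distrib)
    then show ?thesis using that by (simp only: abs_divide) (simp add: abs_minus_commute)
  qed
  ultimately have "\<bar>(1 - 1 / b') / 4 - (1 - 1 / b) / 4\<bar> \<le> \<epsilon>" by blast
  moreover have "\<bar>(1 - 1 / b') / 4\<bar> \<le> 3 / 4"
  proof -
    have "\<bar>1 - 1 / b'\<bar> \<le> 1 + 2" by (rule abs_diff_le) (use \<open>\<bar>1 / b'\<bar> \<le> 2\<close> in auto)
    then show ?thesis by (simp add: abs_divide)
  qed
  ultimately have "\<bar>a' * ((1 - 1 / b') / 4) - a * ((1 - 1 / b) / 4)\<bar> \<le> \<epsilon> * (3 / 4) + 3 * \<epsilon>"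
    using assms by (intro abs_mult_diff_le) auto
  also have "\<epsilon> * (3 / 4) + 3 * \<epsilon> \<le> 4 * \<epsilon>" using \<epsilon> by simp
  finally show ?thesis unfolding z[OF assms(2)] z[OF assms(3)] .
qed

text \<open>All bounds are read off \<open>ar2_coeffs_yw\<close>: a leading factor 1 / g 0 of order
  \<open>d\<close> multiplies a quantity that is bounded and moves by O(\<eta>). \<open>B\<close> is
  the Lipschitz constant of the lag-one correlation in terms of d \<eta>, and \<open>D0\<close>
  bounds 1 / (1 - \<rho>^2). The first four conclusions locate both pairs within O(d) of (p, q); the
  last two compare the pairs at the finer scale d \<eta>.\<close>

lemma ar2_perturbation:
  assumes q: "-1 \<le> q" "q \<le> 0" and p: "\<bar>p\<bar> \<le> (1 - q) * c" and c: "0 \<le> c" "c < 1"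
    and d: "0 < d" "d \<le> 1" and \<eta>: "0 \<le> \<eta>" and W: "0 < W" and V: "0 \<le> V" and A: "0 \<le> A"
    and g: "0 < g 0" "0 < g' 0" "1 / g 0 \<le> W * d" "1 / g' 0 \<le> W * d" "\<bar>1 / g' 0 - 1 / g 0\<bar> \<le> A * (d * \<eta>)"
    and y: "\<And>k. k \<le> 2 \<Longrightarrow> \<bar>yw p q g k\<bar> \<le> V" "\<And>k. k \<le> 2 \<Longrightarrow> \<bar>yw p q g' k\<bar> \<le> V"
      "\<And>k. k \<le> 2 \<Longrightarrow> \<bar>yw p q g' k - yw p q g k\<bar> \<le> \<eta>"
    and small: "V * W * d \<le> (1 - c) / 2"
    and D0: "D0 = 1 / (1 - ((1 + c) / 2)\<^sup>2)" and B: "B = W + V * A"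
    and D: "D = A * (2 * V * D0) + W * ((2 + V * B) * D0 + 2 * V * (2 * D0\<^sup>2 * B))"
  shows "\<bar>ar2_a1 (\<lambda>h. g h / g 0) - p\<bar> \<le> W * d * (2 * V * D0)"
    "\<bar>ar2_a2 (\<lambda>h. g h / g 0) - q\<bar> \<le> W * d * (2 * V * D0)"
    "\<bar>ar2_a1 (\<lambda>h. g' h / g' 0) - p\<bar> \<le> W * d * (2 * V * D0)"
    "\<bar>ar2_a2 (\<lambda>h. g' h / g' 0) - q\<bar> \<le> W * d * (2 * V * D0)"
    "\<bar>ar2_a1 (\<lambda>h. g' h / g' 0) - ar2_a1 (\<lambda>h. g h / g 0)\<bar> \<le> D * (d * \<eta>)"
    "\<bar>ar2_a2 (\<lambda>h. g' h / g' 0) - ar2_a2 (\<lambda>h. g h / g 0)\<bar> \<le> D * (d * \<eta>)"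
proof -
  define m where "m = (1 + c) / 2"
  define w w' where "w = 1 / g 0" and "w' = 1 / g' 0"
  define v1 v2 v1' v2' where "v1 = yw p q g 1" and "v2 = yw p q g 2" and "v1' = yw p q g' 1" and "v2' = yw p q g' 2"
  define \<rho> \<rho>' where "\<rho> = (v1 * w + p) / (1 - q)" and "\<rho>' = (v1' * w' + p) / (1 - q)"
  have m: "0 \<le> m" "m < 1" using c by (auto simp: m_def)
  have B0: "0 \<le> B" using W V A B by simp
  have w: "\<bar>w\<bar> \<le> W * d" "\<bar>w'\<bar> \<le> W * d" "\<bar>w' - w\<bar> \<le> A * (d * \<eta>)" using g by (auto simp: w_def w'_def)
  have v: "\<bar>v1\<bar> \<le> V" "\<bar>v2\<bar> \<le> V" "\<bar>v1'\<bar> \<le> V" "\<bar>v2'\<bar> \<le> V" "\<bar>v1' - v1\<bar> \<le> \<eta>" "\<bar>v2' - v2\<bar> \<le> \<eta>"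
    using y by (auto simp: v1_def v2_def v1'_def v2'_def)
  have q1: "1 \<le> 1 - q" using q by simp
  \<comment> \<open>The hypothesis on \<open>p\<close> puts p / (1 - q) into [-c, c], and
    \<open>small\<close> makes the residual shift it by at most half the distance from c to 1. So
    both lag-one correlations stay in [-m, m] with m < 1.\<close>
  have bnd: "\<bar>(x * u + p) / (1 - q)\<bar> \<le> m" if "\<bar>x\<bar> \<le> V" "\<bar>u\<bar> \<le> W * d" for x u
  proof -
    have "\<bar>x * u\<bar> \<le> V * (W * d)" using that by (rule abs_mult_le)
    also have "\<dots> \<le> (1 - c) / 2" using small by (simp add: mult.assoc)
    also have "\<dots> \<le> (1 - q) * ((1 - c) / 2)" using mult_right_mono[OF q1, of "(1 - c) / 2"] c by simp
    finally have "\<bar>x * u + p\<bar> \<le> (1 - q) * ((1 - c) / 2) + (1 - q) * c" using p by linarith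
    also have "\<dots> = m * (1 - q)" by (simp add: m_def field_simps)
    finally show ?thesis using q1 by (simp add: abs_divide pos_divide_le_eq)
  qed
  have \<rho>: "\<bar>\<rho>\<bar> \<le> m" "\<bar>\<rho>'\<bar> \<le> m" unfolding \<rho>_def \<rho>'_def by (intro bnd v w)+
  have d\<eta>: "0 \<le> d * \<eta>" "d * \<eta> \<le> \<eta>" using d \<eta> by (auto simp: mult_left_le_one_le)
  have \<rho>d: "\<bar>\<rho>' - \<rho>\<bar> \<le> B * (d * \<eta>)"
  proof -
    have "\<rho>' - \<rho> = (v1' * w' - v1 * w) / (1 - q)" by (simp add: \<rho>_def \<rho>'_def diff_divide_distrib[symmetric])
    also have "\<bar>\<dots>\<bar> \<le> \<bar>v1' * w' - v1 * w\<bar>" using q1 by (simp add: abs_divide divide_le_eq mult_le_cancel_left1)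
    also have "\<dots> \<le> \<eta> * (W * d) + V * (A * (d * \<eta>))" using v w by (intro abs_mult_diff_le)
    also have "\<dots> = B * (d * \<eta>)" by (simp add: B algebra_simps)
    finally show ?thesis .
  qed
  have m2: "1 - m\<^sup>2 > 0" using m by (simp add: power_less_one_iff abs_square_less_1)
  have Db: "\<bar>1 / (1 - x\<^sup>2)\<bar> \<le> D0" "x\<^sup>2 \<noteq> 1" if "\<bar>x\<bar> \<le> m" for x
  proof -
    have "x\<^sup>2 \<le> m\<^sup>2" using that m by (intro power2_le_iff_abs_le[THEN iffD2]) auto
    then have "1 - m\<^sup>2 \<le> 1 - x\<^sup>2" by simp
    with m2 show "\<bar>1 / (1 - x\<^sup>2)\<bar> \<le> D0" "x\<^sup>2 \<noteq> 1" unfolding D0 m_def[symmetric] by (auto intro!: divide_left_mono)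
  qed
  have D00: "0 \<le> D0" using Db[OF \<rho>(1)] by linarith
  have Dd: "\<bar>1 / (1 - \<rho>'\<^sup>2) - 1 / (1 - \<rho>\<^sup>2)\<bar> \<le> 2 * D0\<^sup>2 * (B * (d * \<eta>))"
  proof -
    have "1 / (1 - \<rho>'\<^sup>2) - 1 / (1 - \<rho>\<^sup>2) = (1 / (1 - \<rho>'\<^sup>2)) * ((1 / (1 - \<rho>\<^sup>2)) * ((\<rho>' + \<rho>) * (\<rho>' - \<rho>)))"
      using Db(2)[OF \<rho>(1)] Db(2)[OF \<rho>(2)] by (simp add: divide_simps) (simp add: power2_eq_square algebra_simps)
    also have "\<bar>\<dots>\<bar> \<le> D0 * (D0 * (2 * (B * (d * \<eta>))))"
      using \<rho> m by (intro abs_mult_le Db \<rho>d) auto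
    finally show ?thesis by (simp add: power2_eq_square mult_ac)
  qed
  have N: "\<bar>x - u * z\<bar> \<le> 2 * V" if "\<bar>x\<bar> \<le> V" "\<bar>u\<bar> \<le> m" "\<bar>z\<bar> \<le> V" for x u z
  proof -
    have "\<bar>u * z\<bar> \<le> 1 * V" using that m by (intro abs_mult_le) auto
    with that show ?thesis by linarith
  qed
  have Nd: "\<bar>(x' - \<rho>' * z') - (x - \<rho> * z)\<bar> \<le> (2 + V * B) * \<eta>"
    if "\<bar>x' - x\<bar> \<le> \<eta>" "\<bar>z' - z\<bar> \<le> \<eta>" "\<bar>z'\<bar> \<le> V" for x x' z z'
  proof -
    have "\<bar>\<rho>' * z' - \<rho> * z\<bar> \<le> B * (d * \<eta>) * V + 1 * \<eta>"
      using \<rho> m \<rho>d that by (intro abs_mult_diff_le) auto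
    \<comment> \<open>A spare factor \<open>d\<close> is given up here: the leading 1 / g 0 supplies
      the one that the rate needs.\<close>
    also have "\<dots> \<le> B * \<eta> * V + 1 * \<eta>" using d\<eta> B0 V by (intro add_right_mono mult_right_mono mult_left_mono) auto
    finally show ?thesis using that(1) by (simp add: algebra_simps)
  qed
  have F: "\<bar>u * ((x - k * z) * (1 / (1 - k\<^sup>2)))\<bar> \<le> W * d * (2 * V * D0)"
    if "\<bar>u\<bar> \<le> W * d" "\<bar>x\<bar> \<le> V" "\<bar>k\<bar> \<le> m" "\<bar>z\<bar> \<le> V" for u x k z
    using that by (intro abs_mult_le N Db)
  have Fd: "\<bar>w' * ((x' - \<rho>' * z') * (1 / (1 - \<rho>'\<^sup>2))) - w * ((x - \<rho> * z) * (1 / (1 - \<rho>\<^sup>2)))\<bar> \<le> D * (d * \<eta>)"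
    if "\<bar>x' - x\<bar> \<le> \<eta>" "\<bar>z' - z\<bar> \<le> \<eta>" "\<bar>x\<bar> \<le> V" "\<bar>z\<bar> \<le> V" "\<bar>x'\<bar> \<le> V" "\<bar>z'\<bar> \<le> V" for x x' z z'
  proof -
    have "\<bar>w' * ((x' - \<rho>' * z') * (1 / (1 - \<rho>'\<^sup>2))) - w * ((x - \<rho> * z) * (1 / (1 - \<rho>\<^sup>2)))\<bar>
      \<le> A * (d * \<eta>) * (2 * V * D0) + W * d * ((2 + V * B) * \<eta> * D0 + 2 * V * (2 * D0\<^sup>2 * (B * (d * \<eta>))))"
      using that w \<rho> by (intro abs_mult_diff_le abs_mult_le N Db Dd Nd)
    also have "\<dots> \<le> A * (d * \<eta>) * (2 * V * D0) + W * d * ((2 + V * B) * \<eta> * D0 + 2 * V * (2 * D0\<^sup>2 * (B * \<eta>)))"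
      using W V d \<eta> B0 d\<eta> by (intro add_mono mult_left_mono order_refl) auto
    also have "\<dots> = D * (d * \<eta>)" unfolding D by (simp add: algebra_simps)
    finally show ?thesis .
  qed
  have a: "ar2_a1 (\<lambda>h. g h / g 0) = p + w * ((v1 - \<rho> * v2) * (1 / (1 - \<rho>\<^sup>2)))"
    "ar2_a2 (\<lambda>h. g h / g 0) = q + w * ((v2 - \<rho> * v1) * (1 / (1 - \<rho>\<^sup>2)))"
    "ar2_a1 (\<lambda>h. g' h / g' 0) = p + w' * ((v1' - \<rho>' * v2') * (1 / (1 - \<rho>'\<^sup>2)))"
    "ar2_a2 (\<lambda>h. g' h / g' 0) = q + w' * ((v2' - \<rho>' * v1') * (1 / (1 - \<rho>'\<^sup>2)))"
    using ar2_coeffs_yw[of g q \<rho> p] ar2_coeffs_yw[of g' q \<rho>' p] g q1 Db(2)[OF \<rho>(1)] Db(2)[OF \<rho>(2)]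
    by (simp_all add: \<rho>_def[symmetric] \<rho>'_def[symmetric] w_def w'_def v1_def v2_def v1'_def v2'_def \<rho>_def \<rho>'_def)
  show "\<bar>ar2_a1 (\<lambda>h. g h / g 0) - p\<bar> \<le> W * d * (2 * V * D0)"
    "\<bar>ar2_a2 (\<lambda>h. g h / g 0) - q\<bar> \<le> W * d * (2 * V * D0)"
    "\<bar>ar2_a1 (\<lambda>h. g' h / g' 0) - p\<bar> \<le> W * d * (2 * V * D0)"
    "\<bar>ar2_a2 (\<lambda>h. g' h / g' 0) - q\<bar> \<le> W * d * (2 * V * D0)"
    unfolding a add_diff_cancel_left' by (intro F v w \<rho>)+
  show "\<bar>ar2_a1 (\<lambda>h. g' h / g' 0) - ar2_a1 (\<lambda>h. g h / g 0)\<bar> \<le> D * (d * \<eta>)"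
    "\<bar>ar2_a2 (\<lambda>h. g' h / g' 0) - ar2_a2 (\<lambda>h. g h / g 0)\<bar> \<le> D * (d * \<eta>)"
    unfolding a add_diff_cancel_left by (intro Fd v)+
qed

text \<open>A purely deterministic statement whose constants depend only on \<open>l\<close>,
  \<open>\<kappa>\<close> and \<open>V\<close>, uniformly in \<open>d\<close> and in both functions.
  Nothing is assumed about the size of \<open>g' 0\<close>: that it is at least of order 1/d follows
  from \<open>yw_inverse_bound\<close> once \<open>\<eta>\<close> is small.\<close>

lemma ar2_stability:
  assumes l: "0 < sin l" and \<kappa>: "0 < \<kappa>" and V: "0 \<le> V"
  shows "\<exists>D>0. \<exists>d0>0. \<exists>\<eta>0>0. \<forall>d \<eta> g g'. 0 < d \<longrightarrow> d \<le> d0 \<longrightarrow> 0 \<le> \<eta> \<longrightarrow> \<eta> \<le> \<eta>0 \<longrightarrow> \<kappa> \<le> d * g 0 \<longrightarrow>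
    (\<forall>k\<le>2. \<bar>yw (2 * (1 - d) * cos l) (- (1 - d)\<^sup>2) g k\<bar> \<le> V) \<longrightarrow>
    (\<forall>k\<le>2. \<bar>yw (2 * (1 - d) * cos l) (- (1 - d)\<^sup>2) g' k - yw (2 * (1 - d) * cos l) (- (1 - d)\<^sup>2) g k\<bar> \<le> \<eta>) \<longrightarrow>
    \<bar>ar2_a1 (\<lambda>h. g' h / g' 0) - ar2_a1 (\<lambda>h. g h / g 0)\<bar> \<le> D * (d * \<eta>) \<and>
    \<bar>ar2_a2 (\<lambda>h. g' h / g' 0) - ar2_a2 (\<lambda>h. g h / g 0)\<bar> \<le> D * (d * \<eta>) \<and>
    ar2_a2 (\<lambda>h. g' h / g' 0) < 0 \<and>
    \<bar>peak_freq (\<lambda>h. g' h / g' 0) - peak_freq (\<lambda>h. g h / g 0)\<bar> \<le> D * (d * \<eta>)"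
proof -
  define c where "c = \<bar>cos l\<bar>"
  have c: "0 \<le> c" "c < 1"
  proof -
    have "(cos l)\<^sup>2 < 1" using l by (simp add: cos_squared_eq)
    then show "0 \<le> c" "c < 1" by (auto simp: c_def abs_square_less_1)
  qed
  define m where "m = (1 + c) / 2"
  have m: "0 < m" "m < 1" using c by (auto simp: m_def)
  \<comment> \<open>The 2 allows for \<open>g' 0\<close>, of which only the lower bound \<kappa> /
    (2 d) will be known. Likewise V + 1 covers the perturbed Yule-Walker values, as
    \<open>\<eta>\<close> is at most 1.\<close>
  define W where "W = 2 / \<kappa>"
  define V' where "V' = V + 1"
  define A where "A = 6 * W\<^sup>2 / (sin l)\<^sup>2"
  define D0 where "D0 = 1 / (1 - ((1 + c) / 2)\<^sup>2)"
  define B where "B = W + V' * A"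
  define D where "D = A * (2 * V' * D0) + W * ((2 + V' * B) * D0 + 2 * V' * (2 * D0\<^sup>2 * B))"
  \<comment> \<open>Distance of the coefficients from (2 cos l, -1) in units of \<open>d\<close>: 2
    for the point (p, q), the rest for the distance to (p, q).\<close>
  define \<kappa>' where "\<kappa>' = 2 + W * (2 * V' * D0)"
  \<comment> \<open>The four entries in order: 1 - d is at least 1/2; the lag-one correlations stay
    in [-m, m]; a_2 stays within 1/2 of -1; the argument of the arccosine stays within (1 - c) / 2
    of cos l. The 4 is the Lipschitz constant of \<open>peak_arg_lipschitz\<close>.\<close>
  define d0 where "d0 = Min {1/2, (1 - c) / 2 / (V' * W), 1 / (2 * \<kappa>'), (1 - c) / 2 / (4 * \<kappa>')}"
  \<comment> \<open>The second entry keeps the change 6 \<eta> / (d sin^2 l) of g 0 below \<kappa> /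
    (2 d), half of its lower bound.\<close>
  define \<eta>0 where "\<eta>0 = min 1 (\<kappa> * (sin l)\<^sup>2 / 12)"
  define L where "L = 1 / sqrt (1 - m\<^sup>2)"
  have W: "0 < W" using \<kappa> by (simp add: W_def)
  have V': "0 < V'" "1 \<le> V'" using V by (auto simp: V'_def)
  have m2: "0 < 1 - m\<^sup>2" using m by (simp add: power_less_one_iff abs_square_less_1)
  have D0: "0 < D0" using m2 by (simp add: D0_def m_def)
  have A: "0 < A" using W l by (simp add: A_def)
  have B: "0 < B" using W V' A by (simp add: B_def add_pos_pos)
  have D: "0 < D" unfolding D_def using A B W V' D0 by (intro add_pos_pos mult_pos_pos) auto
  have \<kappa>': "0 < \<kappa>'" using W V' D0 by (simp add: \<kappa>'_def add_pos_pos)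
  have d0: "0 < d0" using c V' W \<kappa>' by (simp add: d0_def)
  have \<eta>0: "0 < \<eta>0" using \<kappa> l by (simp add: \<eta>0_def)
  have L: "0 < L" using m2 by (simp add: L_def)
  define D' where "D' = D + L * (4 * D)"
  have D': "0 < D'" "D \<le> D'" "L * (4 * D) \<le> D'" using D L by (auto simp: D'_def add_pos_pos)
  show ?thesis
  proof (rule exI[of _ D'], intro conjI D', rule exI[of _ d0], intro conjI d0, rule exI[of _ \<eta>0], intro conjI \<eta>0 allI impI)
    fix d \<eta> :: real and g g' :: "int \<Rightarrow> real"
    define p q where "p = 2 * (1 - d) * cos l" and "q = - (1 - d)\<^sup>2"
    assume d: "0 < d" "d \<le> d0" and \<eta>: "0 \<le> \<eta>" "\<eta> \<le> \<eta>0" and g0: "\<kappa> \<le> d * g 0"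
      and y: "\<forall>k\<le>2. \<bar>yw p q g k\<bar> \<le> V" and y': "\<forall>k\<le>2. \<bar>yw p q g' k - yw p q g k\<bar> \<le> \<eta>"
    have ds: "d \<le> 1/2" "d \<le> (1 - c) / 2 / (V' * W)" "d \<le> 1 / (2 * \<kappa>')" "d \<le> (1 - c) / 2 / (4 * \<kappa>')"
      using d(2) by (auto simp: d0_def)
    have q: "-1 \<le> q" "q \<le> 0" using d ds by (auto simp: q_def power_le_one)
    have pc: "\<bar>p\<bar> \<le> (1 - q) * c"
    proof -
      have "2 * (1 - d) \<le> 1 - q" using zero_le_power2[of d] by (simp add: q_def power2_eq_square algebra_simps)
      then have "2 * (1 - d) * c \<le> (1 - q) * c" using c by (intro mult_right_mono) auto
      then show ?thesis using ds by (simp add: p_def abs_mult c_def)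
    qed
    have gd: "\<bar>g' 0 - g 0\<bar> \<le> 6 * \<eta> / (d * (sin l)\<^sup>2)"
      using y' d ds by (intro yw_inverse_bound[OF l]) (auto simp: p_def q_def)
    have "6 * \<eta> / (d * (sin l)\<^sup>2) \<le> 6 * (\<kappa> * (sin l)\<^sup>2 / 12) / (d * (sin l)\<^sup>2)"
      using \<eta> d l by (intro divide_right_mono mult_left_mono) (auto simp: \<eta>0_def)
    also have "\<dots> = \<kappa> / (2 * d)" using l by (simp add: field_simps)
    finally have e: "6 * \<eta> / (d * (sin l)\<^sup>2) \<le> \<kappa> / (2 * d)" .
    have g1: "\<kappa> / d \<le> g 0" using g0 d by (simp add: field_simps)
    have g2: "\<kappa> / (2 * d) \<le> g 0"
      using g1 \<kappa> d by (intro order_trans[OF divide_left_mono g1]) auto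
    have "\<kappa> / d = \<kappa> / (2 * d) + \<kappa> / (2 * d)" by simp
    then have g3: "\<kappa> / (2 * d) \<le> g' 0" using g1 gd e by linarith
    have pos: "0 < \<kappa> / (2 * d)" using \<kappa> d by simp
    have gp: "0 < g 0" "0 < g' 0" using g2 g3 pos by linarith+
    have w: "1 / g 0 \<le> W * d" "1 / g' 0 \<le> W * d"
      using le_imp_inverse_le[OF g2 pos] le_imp_inverse_le[OF g3 pos] by (simp_all add: W_def inverse_eq_divide mult.commute)
    \<comment> \<open>Two reciprocals of order \<open>d\<close> meet one factor 1/d from the
      Yule-Walker inversion; the net gain is one factor \<open>d\<close>.\<close>
    have wd: "\<bar>1 / g' 0 - 1 / g 0\<bar> \<le> A * (d * \<eta>)"
    proof -
      have "1 / g' 0 - 1 / g 0 = (1 / g' 0) * ((1 / g 0) * (g 0 - g' 0))" using gp by (simp add: field_simps)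
      also have "\<bar>\<dots>\<bar> \<le> (W * d) * ((W * d) * (6 * \<eta> / (d * (sin l)\<^sup>2)))"
        using w gp gd by (intro abs_mult_le) (auto simp: abs_minus_commute)
      also have "\<dots> = A * (d * \<eta>)" using d by (simp add: A_def power2_eq_square)
      finally show ?thesis .
    qed
    have y2: "\<bar>yw p q g k\<bar> \<le> V'" "\<bar>yw p q g' k\<bar> \<le> V'" if "k \<le> 2" for k
    proof -
      have 1: "\<bar>yw p q g k\<bar> \<le> V" using y that by blast
      then show "\<bar>yw p q g k\<bar> \<le> V'" by (simp add: V'_def)
      have "\<bar>yw p q g' k - yw p q g k\<bar> \<le> \<eta>" using y' that by blast
      moreover have "\<eta> \<le> 1" using \<eta> by (simp add: \<eta>0_def)
      moreover note 1
      ultimately show "\<bar>yw p q g' k\<bar> \<le> V'" unfolding V'_def by linarith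
    qed
    have small: "V' * W * d \<le> (1 - c) / 2" using ds(2) V' W by (simp add: field_simps)
    have d1: "d \<le> 1" using ds(1) by simp
    note * = ar2_perturbation[OF q pc c d(1) d1 \<eta>(1) W less_imp_le[OF V'(1)] less_imp_le[OF A] gp w wd y2 y'[rule_format] small D0_def B_def D_def]
    define a b a' b' where "a = ar2_a1 (\<lambda>h. g h / g 0)" and "b = ar2_a2 (\<lambda>h. g h / g 0)"
      and "a' = ar2_a1 (\<lambda>h. g' h / g' 0)" and "b' = ar2_a2 (\<lambda>h. g' h / g' 0)"
    have dif: "\<bar>a' - a\<bar> \<le> D * (d * \<eta>)" "\<bar>b' - b\<bar> \<le> D * (d * \<eta>)"
      using *(5,6) by (simp_all add: a_def b_def a'_def b'_def)
    have pq: "\<bar>p - 2 * cos l\<bar> \<le> 2 * d" "\<bar>q - (-1)\<bar> \<le> 2 * d"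
    proof -
      have "p - 2 * cos l = (- 2 * d) * cos l" by (simp add: p_def algebra_simps)
      also have "\<bar>\<dots>\<bar> \<le> (2 * d) * 1" using d by (intro abs_mult_le) auto
      finally show "\<bar>p - 2 * cos l\<bar> \<le> 2 * d" by simp
      have "q - (-1) = d * (2 - d)" by (simp add: q_def power2_eq_square algebra_simps)
      also have "\<bar>\<dots>\<bar> \<le> d * 2" using d d1 by (intro abs_mult_le) auto
      finally show "\<bar>q - (-1)\<bar> \<le> 2 * d" by simp
    qed
    have near: "\<bar>a - 2 * cos l\<bar> \<le> \<kappa>' * d" "\<bar>b - (-1)\<bar> \<le> \<kappa>' * d" "\<bar>a' - 2 * cos l\<bar> \<le> \<kappa>' * d" "\<bar>b' - (-1)\<bar> \<le> \<kappa>' * d"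
    proof -
      have tri: "\<bar>x - z\<bar> \<le> P + Q" if "\<bar>y - z\<bar> \<le> P" "\<bar>x - y\<bar> \<le> Q" for x y z P Q :: real
        using that by linarith
      have e: "\<kappa>' * d = 2 * d + W * d * (2 * V' * D0)" by (simp add: \<kappa>'_def algebra_simps)
      show "\<bar>a - 2 * cos l\<bar> \<le> \<kappa>' * d" unfolding e a_def by (rule tri[OF pq(1) *(1)])
      show "\<bar>b - (-1)\<bar> \<le> \<kappa>' * d" unfolding e b_def by (rule tri[OF pq(2) *(2)])
      show "\<bar>a' - 2 * cos l\<bar> \<le> \<kappa>' * d" unfolding e a'_def by (rule tri[OF pq(1) *(3)])
      show "\<bar>b' - (-1)\<bar> \<le> \<kappa>' * d" unfolding e b'_def by (rule tri[OF pq(2) *(4)])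
    qed
    have kd: "\<kappa>' * d \<le> 1/2" "4 * (\<kappa>' * d) \<le> (1 - c) / 2"
      using ds(3,4) \<kappa>' by (simp_all add: field_simps)
    have b: "b \<in> {-3/2..-1/2}" "b' \<in> {-3/2..-1/2}"
      using abs_le_D1[OF order_trans[OF near(2) kd(1)]] abs_le_D2[OF order_trans[OF near(2) kd(1)]]
        abs_le_D1[OF order_trans[OF near(4) kd(1)]] abs_le_D2[OF order_trans[OF near(4) kd(1)]]
      by simp_all
    have a: "\<bar>a\<bar> \<le> 3" "\<bar>2 * cos l\<bar> \<le> 3"
    proof -
      show "\<bar>2 * cos l\<bar> \<le> 3" using c by (simp add: c_def abs_mult)
      have "\<bar>2 * cos l\<bar> \<le> 2" by (simp add: abs_mult)
      with order_trans[OF near(1) kd(1)] show "\<bar>a\<bar> \<le> 3" by linarith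
    qed
    define z where "z x y = x * (1 - y) / (- 4 * y)" for x y :: real
    have z1: "\<bar>z a b - z (2 * cos l) (-1)\<bar> \<le> 4 * (\<kappa>' * d)" "\<bar>z a' b' - z (2 * cos l) (-1)\<bar> \<le> 4 * (\<kappa>' * d)"
      unfolding z_def by (intro peak_arg_lipschitz a b near; simp)+
    have z2: "\<bar>z a' b' - z a b\<bar> \<le> 4 * (D * (d * \<eta>))"
      unfolding z_def by (intro peak_arg_lipschitz a b dif)
    have "z (2 * cos l) (-1) = cos l" by (simp add: z_def)
    have zm: "\<bar>u\<bar> \<le> m" if "\<bar>u - z (2 * cos l) (-1)\<bar> \<le> 4 * (\<kappa>' * d)" for u
    proof -
      have "\<bar>u - cos l\<bar> \<le> (1 - c) / 2"
        using order_trans[OF that kd(2)] by (simp add: \<open>z (2 * cos l) (-1) = cos l\<close>)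
      then have "\<bar>u\<bar> \<le> c + (1 - c) / 2" unfolding c_def by linarith
      then show ?thesis by (simp add: m_def field_simps)
    qed
    have "\<bar>arccos (z a' b') - arccos (z a b)\<bar> \<le> L * \<bar>z a' b' - z a b\<bar>"
      unfolding L_def by (rule arccos_lipschitz[OF zm[OF z1(1)] zm[OF z1(2)] m(2)])
    also have "\<dots> \<le> L * (4 * (D * (d * \<eta>)))" using z2 L by (intro mult_left_mono) auto
    also have "\<dots> = (L * (4 * D)) * (d * \<eta>)" by simp
    also have "\<dots> \<le> D' * (d * \<eta>)" using D'(3) d \<eta> by (intro mult_right_mono) auto
    finally have pk: "\<bar>arccos (z a' b') - arccos (z a b)\<bar> \<le> D' * (d * \<eta>)" .
    have dif': "\<bar>a' - a\<bar> \<le> D' * (d * \<eta>)" "\<bar>b' - b\<bar> \<le> D' * (d * \<eta>)"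
      using d \<eta> by (intro order_trans[OF dif(1)] order_trans[OF dif(2)] mult_right_mono D'(2); simp)+
    show "\<bar>ar2_a1 (\<lambda>h. g' h / g' 0) - ar2_a1 (\<lambda>h. g h / g 0)\<bar> \<le> D' * (d * \<eta>)"
      "\<bar>ar2_a2 (\<lambda>h. g' h / g' 0) - ar2_a2 (\<lambda>h. g h / g 0)\<bar> \<le> D' * (d * \<eta>)"
      using dif' by (simp_all add: a_def b_def a'_def b'_def)
    show "ar2_a2 (\<lambda>h. g' h / g' 0) < 0" using b(2) by (simp add: b'_def)
    show "\<bar>peak_freq (\<lambda>h. g' h / g' 0) - peak_freq (\<lambda>h. g h / g 0)\<bar> \<le> D' * (d * \<eta>)"
      using pk by (simp add: peak_freq_def z_def a_def b_def a'_def b'_def)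
  qed
qed

subsection \<open>Moments of filtered stationary processes\<close>

text \<open>Jensen's inequality for the fourth power, by two applications of Cauchy-Schwarz. With
  the weights |b_j| it bounds the fourth power of a filtered series by a series of fourth powers,
  which can be integrated term by term.\<close>

lemma sum_weighted_pow4_le:
  fixes w x :: "'i \<Rightarrow> real"
  assumes "\<And>i. i \<in> A \<Longrightarrow> 0 \<le> w i"
  shows "(\<Sum>i\<in>A. w i * x i) ^ 4 \<le> (\<Sum>i\<in>A. w i) ^ 3 * (\<Sum>i\<in>A. w i * x i ^ 4)"
proof -
  define W where "W = (\<Sum>i\<in>A. w i)"
  have W: "0 \<le> W" unfolding W_def using assms by (intro sum_nonneg)
  have cs: "(\<Sum>i\<in>A. w i * y i)\<^sup>2 \<le> W * (\<Sum>i\<in>A. w i * (y i)\<^sup>2)" for y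
  proof -
    have "(\<Sum>i\<in>A. w i * y i) = (\<Sum>i\<in>A. sqrt (w i) * (sqrt (w i) * y i))"
      using assms by (intro sum.cong) (auto simp flip: mult.assoc)
    then have "(\<Sum>i\<in>A. w i * y i)\<^sup>2 = (\<Sum>i\<in>A. sqrt (w i) * (sqrt (w i) * y i))\<^sup>2" by simp
    also have "\<dots> \<le> (\<Sum>i\<in>A. (sqrt (w i))\<^sup>2) * (\<Sum>i\<in>A. (sqrt (w i) * y i)\<^sup>2)"
      by (rule Cauchy_Schwarz_ineq_sum)
    also have "(\<Sum>i\<in>A. (sqrt (w i))\<^sup>2) = W" unfolding W_def using assms by (intro sum.cong) auto
    also have "(\<Sum>i\<in>A. (sqrt (w i) * y i)\<^sup>2) = (\<Sum>i\<in>A. w i * (y i)\<^sup>2)"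
      using assms by (intro sum.cong) (auto simp: power_mult_distrib)
    finally show ?thesis .
  qed
  have "(\<Sum>i\<in>A. w i * x i) ^ 4 = ((\<Sum>i\<in>A. w i * x i)\<^sup>2)\<^sup>2" by simp
  also have "\<dots> \<le> (W * (\<Sum>i\<in>A. w i * (x i)\<^sup>2))\<^sup>2" by (intro power_mono cs) auto
  also have "\<dots> = W\<^sup>2 * (\<Sum>i\<in>A. w i * (x i)\<^sup>2)\<^sup>2" by (simp add: power_mult_distrib)
  also have "\<dots> \<le> W\<^sup>2 * (W * (\<Sum>i\<in>A. w i * ((x i)\<^sup>2)\<^sup>2))" by (intro mult_left_mono cs) auto
  finally show ?thesis by (simp add: W_def power2_eq_square[of "sum w A"] power3_eq_cube mult.assoc)
qed

text \<open>Schur's test, from |c_i c_l| <= (c_i^2 + c_l^2) / 2. It replaces the square of an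
  absolute sum of filter coefficients, of order 1/d^2, by their square sum, of order 1/d.\<close>

lemma sum_quadratic_form_le:
  fixes g :: "'i \<Rightarrow> 'i \<Rightarrow> real"
  assumes "finite A" "\<And>i. i \<in> A \<Longrightarrow> (\<Sum>l\<in>A. \<bar>g i l\<bar>) \<le> G" "\<And>l. l \<in> A \<Longrightarrow> (\<Sum>i\<in>A. \<bar>g i l\<bar>) \<le> G"
  shows "(\<Sum>i\<in>A. \<Sum>l\<in>A. \<bar>c i\<bar> * \<bar>c l\<bar> * \<bar>g i l\<bar>) \<le> G * (\<Sum>i\<in>A. (c i)\<^sup>2)"
proof -
  have "(\<Sum>i\<in>A. \<Sum>l\<in>A. \<bar>c i\<bar> * \<bar>c l\<bar> * \<bar>g i l\<bar>)
    \<le> (\<Sum>i\<in>A. \<Sum>l\<in>A. ((c i)\<^sup>2 / 2 + (c l)\<^sup>2 / 2) * \<bar>g i l\<bar>)"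
  proof (intro sum_mono mult_right_mono)
    fix i l show "\<bar>c i\<bar> * \<bar>c l\<bar> \<le> (c i)\<^sup>2 / 2 + (c l)\<^sup>2 / 2"
      using sum_squares_bound[of "\<bar>c i\<bar>" "\<bar>c l\<bar>"] by simp
  qed simp
  also have "\<dots> = (\<Sum>i\<in>A. (c i)\<^sup>2 / 2 * (\<Sum>l\<in>A. \<bar>g i l\<bar>)) + (\<Sum>l\<in>A. (c l)\<^sup>2 / 2 * (\<Sum>i\<in>A. \<bar>g i l\<bar>))"
    by (simp only: distrib_right sum.distrib sum_distrib_left)
      (subst (3) sum.swap, rule refl)
  also have "\<dots> \<le> (\<Sum>i\<in>A. (c i)\<^sup>2 / 2 * G) + (\<Sum>l\<in>A. (c l)\<^sup>2 / 2 * G)"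
    using assms by (intro add_mono sum_mono mult_left_mono) auto
  also have "\<dots> = G * (\<Sum>i\<in>A. (c i)\<^sup>2)"
    by (simp add: sum_distrib_left sum.distrib[symmetric])
  finally show ?thesis .
qed

lemma integrable_suminf_nonneg:
  fixes f :: "nat \<Rightarrow> 'a \<Rightarrow> real"
  assumes f: "\<And>i. integrable M (f i)" "\<And>i x. 0 \<le> f i x" and s: "summable (\<lambda>i. LINT x|M. f i x)"
  shows "AE x in M. summable (\<lambda>i. f i x)" "integrable M (\<lambda>x. \<Sum>i. f i x)"
proof -
  have [measurable]: "f i \<in> borel_measurable M" for i using f(1) by blast
  have "(\<integral>\<^sup>+x. (\<Sum>i. ennreal (f i x)) \<partial>M) = (\<Sum>i. \<integral>\<^sup>+x. ennreal (f i x) \<partial>M)"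
    by (rule nn_integral_suminf) measurable
  also have "\<dots> = (\<Sum>i. ennreal (LINT x|M. f i x))"
    using f by (simp add: nn_integral_eq_integral)
  also have "\<dots> = ennreal (\<Sum>i. LINT x|M. f i x)"
    using s f by (intro suminf_ennreal2) auto
  finally have "(\<integral>\<^sup>+x. (\<Sum>i. ennreal (f i x)) \<partial>M) \<noteq> \<infinity>" by simp
  then have "AE x in M. (\<Sum>i. ennreal (f i x)) \<noteq> \<infinity>"
    by (intro nn_integral_noteq_infinite) measurable
  then show *: "AE x in M. summable (\<lambda>i. f i x)"
  proof eventually_elim
    case (elim x)
    then show ?case using f(2) by (intro summable_suminf_not_top) auto
  qed
  show "integrable M (\<lambda>x. \<Sum>i. f i x)"
    using f s * by (intro integrable_suminf) auto
qed

section \<open>Square-integrable and fourth-power-integrable variables\<close>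

context prob_space
begin

definition L2 :: "('a \<Rightarrow> real) \<Rightarrow> bool" where
  "L2 f \<longleftrightarrow> f \<in> borel_measurable M \<and> integrable M (\<lambda>x. (f x)\<^sup>2)"

definition L4 :: "('a \<Rightarrow> real) \<Rightarrow> bool" where
  "L4 f \<longleftrightarrow> f \<in> borel_measurable M \<and> integrable M (\<lambda>x. f x ^ 4)"

lemma L2_integrable: "L2 f \<Longrightarrow> integrable M f"
  unfolding L2_def by (blast intro: square_integrable_imp_integrable)

lemma L2_mult:
  assumes "L2 f" "L2 g" shows "integrable M (\<lambda>x. f x * g x)"
proof (rule Bochner_Integration.integrable_bound)
  show "integrable M (\<lambda>x. (f x)\<^sup>2 + (g x)\<^sup>2)" using assms by (auto simp: L2_def)
  show "(\<lambda>x. f x * g x) \<in> borel_measurable M" using assms by (auto simp: L2_def)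
  have "\<bar>f x * g x\<bar> \<le> (f x)\<^sup>2 + (g x)\<^sup>2" for x
  proof -
    have "0 \<le> \<bar>f x\<bar> * \<bar>g x\<bar>" by simp
    moreover have "2 * (\<bar>f x\<bar> * \<bar>g x\<bar>) \<le> (f x)\<^sup>2 + (g x)\<^sup>2"
      using sum_squares_bound[of "\<bar>f x\<bar>" "\<bar>g x\<bar>"] by (simp add: mult.assoc)
    ultimately show ?thesis unfolding abs_mult by linarith
  qed
  then show "AE x in M. norm (f x * g x) \<le> norm ((f x)\<^sup>2 + (g x)\<^sup>2)" by simp
qed

lemma L2_dominated:
  assumes "L2 f" "g \<in> borel_measurable M" "AE x in M. \<bar>g x\<bar> \<le> f x"
  shows "L2 g"
proof -
  have "integrable M (\<lambda>x. (g x)\<^sup>2)"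
  proof (rule Bochner_Integration.integrable_bound)
    show "integrable M (\<lambda>x. (f x)\<^sup>2)" using assms by (simp add: L2_def)
    show "(\<lambda>x. (g x)\<^sup>2) \<in> borel_measurable M" using assms by simp
    show "AE x in M. norm ((g x)\<^sup>2) \<le> norm ((f x)\<^sup>2)"
      using assms(3) by eventually_elim (auto simp: abs_le_square_iff[symmetric])
  qed
  with assms(2) show ?thesis by (simp add: L2_def)
qed

lemma L2_add:
  assumes "L2 f" "L2 g" shows "L2 (\<lambda>x. f x + g x)"
proof -
  have "integrable M (\<lambda>x. (f x)\<^sup>2 + (g x)\<^sup>2 + 2 * (f x * g x))"
    using assms L2_mult[OF assms] by (auto simp: L2_def)
  then show ?thesis using assms by (auto simp: L2_def power2_sum mult.assoc)
qed

lemma L2_cmult: "L2 f \<Longrightarrow> L2 (\<lambda>x. c * f x)"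
  by (auto simp: L2_def power_mult_distrib)

lemma L2_const: "L2 (\<lambda>x. c)"
  by (simp add: L2_def)

lemma L2_diff: "L2 f \<Longrightarrow> L2 g \<Longrightarrow> L2 (\<lambda>x. f x - g x)"
  using L2_add[of f "\<lambda>x. -1 * g x"] L2_cmult[of g "-1"] by simp

lemma L2_sum: "(\<And>i. i \<in> A \<Longrightarrow> L2 (f i)) \<Longrightarrow> L2 (\<lambda>x. \<Sum>i\<in>A. f i x)"
  by (induction A rule: infinite_finite_induct) (auto intro: L2_add simp: L2_const)

lemma L4_sq: "L4 f \<Longrightarrow> L2 (\<lambda>x. (f x)\<^sup>2)"
  by (auto simp: L4_def L2_def)

lemma L4_L2: "L4 f \<Longrightarrow> L2 f"
  using L2_integrable[OF L4_sq] by (auto simp: L2_def L4_def)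

lemma L4_abs: "L4 f \<Longrightarrow> L4 (\<lambda>x. \<bar>f x\<bar>)"
  by (auto simp: L4_def power_even_abs)

lemma L4_mult:
  assumes "L4 f" "L4 g" shows "L2 (\<lambda>x. f x * g x)"
  using L2_mult[OF L4_sq[OF assms(1)] L4_sq[OF assms(2)]] assms
  by (auto simp: L4_def L2_def power_mult_distrib)

lemma L4_dominated:
  assumes "L4 f" "g \<in> borel_measurable M" "AE x in M. \<bar>g x\<bar> \<le> f x"
  shows "L4 g"
proof -
  have "AE x in M. \<bar>(g x)\<^sup>2\<bar> \<le> (f x)\<^sup>2"
    using assms(3) by eventually_elim (auto simp: abs_le_square_iff[symmetric])
  then have "L2 (\<lambda>x. (g x)\<^sup>2)" using assms by (intro L2_dominated[OF L4_sq]) auto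
  with assms(2) show ?thesis by (simp add: L4_def L2_def)
qed

lemma L2_expectation_abs_le:
  assumes "L2 f" shows "(expectation (\<lambda>x. \<bar>f x\<bar>))\<^sup>2 \<le> expectation (\<lambda>x. (f x)\<^sup>2)"
proof -
  have a: "L2 (\<lambda>x. \<bar>f x\<bar>)" using assms by (auto simp: L2_def)
  have "0 \<le> variance (\<lambda>x. \<bar>f x\<bar>)" by (rule variance_positive)
  also have "\<dots> = expectation (\<lambda>x. \<bar>f x\<bar>\<^sup>2) - (expectation (\<lambda>x. \<bar>f x\<bar>))\<^sup>2"
    using L2_integrable[OF a] a by (intro variance_eq) (auto simp: L2_def)
  finally show ?thesis by simp
qed

end

section \<open>Linear filters of a fourth-order stationary process\<close>

locale stationary4 = prob_space M for M :: "'a measure" +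
  fixes U :: "int \<Rightarrow> 'a \<Rightarrow> real"
  assumes meas [measurable]: "\<And>t. U t \<in> borel_measurable M"
    and fourth: "\<And>t. integrable M (\<lambda>\<omega>. (U t \<omega>)^4)"
    and mean0: "\<And>t. (LINT \<omega>|M. U t \<omega>) = 0"
    and stat2: "\<And>t h. (LINT \<omega>|M. U (t + h) \<omega> * U t \<omega>) = (LINT \<omega>|M. U h \<omega> * U 0 \<omega>)"
    and stat4: "\<And>t h1 h2 h3. cum4 M (U t) (U (t + h1)) (U (t + h2)) (U (t + h3))
                             = cum4 M (U 0) (U h1) (U h2) (U h3)"
    and sum2: "(\<lambda>h. \<bar>acov M U h\<bar>) summable_on UNIV"
    and sum4: "(\<lambda>(h1, h2, h3). \<bar>cum4 M (U 0) (U h1) (U h2) (U h3)\<bar>) summable_on UNIV"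
begin

abbreviation "\<gamma> \<equiv> acov M U"

definition "\<kappa> = (\<lambda>(h1, h2, h3). cum4 M (U 0) (U h1) (U h2) (U h3))"

definition "G = infsum (\<lambda>h. \<bar>\<gamma> h\<bar>) UNIV"

definition "K = infsum (\<lambda>h. \<bar>\<kappa> h\<bar>) UNIV"

lemma L4_U: "L4 (U t)"
  using fourth meas by (simp add: L4_def)

lemma L2_U: "L2 (U t)"
  by (intro L4_L2 L4_U)

lemma U_cov: "expectation (\<lambda>\<omega>. U s \<omega> * U t \<omega>) = \<gamma> (s - t)"
  using stat2[of t "s - t"] by (simp add: acov_def mean0)

text \<open>The definition of the cumulant solved for the moment. The product is bracketed into two
  pairs because the pairing inside the brackets is the one that the squared mean removes from the
  variance of a sum of products.\<close>

lemma U_fourth_moment: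
  "expectation (\<lambda>\<omega>. U a \<omega> * U b \<omega> * (U c \<omega> * U d \<omega>))
    = \<kappa> (b - a, c - a, d - a) + \<gamma> (a - b) * \<gamma> (c - d) + \<gamma> (a - c) * \<gamma> (b - d) + \<gamma> (a - d) * \<gamma> (b - c)"
  using stat4[of a "b - a" "c - a" "d - a"]
  by (simp add: \<kappa>_def cum4_def mean0 U_cov Let_def mult.assoc)

lemma U_fourth_moment_const: "expectation (\<lambda>\<omega>. U t \<omega> ^ 4) = expectation (\<lambda>\<omega>. U 0 \<omega> ^ 4)"
  using U_fourth_moment[of t t t t] U_fourth_moment[of 0 0 0 0]
  by (simp add: power4_eq_xxxx mult.assoc)

lemma G_nonneg: "0 \<le> G"
  unfolding G_def by (intro infsum_nonneg) simp

lemma K_nonneg: "0 \<le> K"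
  unfolding K_def by (intro infsum_nonneg) simp

lemma sum_acov_le:
  assumes "finite A" "inj_on f A" shows "(\<Sum>i\<in>A. \<bar>\<gamma> (f i)\<bar>) \<le> G"
proof -
  have "(\<Sum>i\<in>A. \<bar>\<gamma> (f i)\<bar>) = (\<Sum>h\<in>f ` A. \<bar>\<gamma> h\<bar>)" using assms by (simp add: sum.reindex)
  also have "\<dots> \<le> G" unfolding G_def using assms by (intro finite_sum_le_infsum sum2) auto
  finally show ?thesis .
qed

lemma sum_cum_le:
  assumes "finite A" "inj_on f A" shows "(\<Sum>i\<in>A. \<bar>\<kappa> (f i)\<bar>) \<le> K"
proof -
  have s: "(\<lambda>h. \<bar>\<kappa> h\<bar>) summable_on UNIV"
    using sum4 by (simp add: \<kappa>_def case_prod_unfold)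
  have "(\<Sum>i\<in>A. \<bar>\<kappa> (f i)\<bar>) = (\<Sum>h\<in>f ` A. \<bar>\<kappa> h\<bar>)" using assms by (simp add: sum.reindex)
  also have "\<dots> \<le> K" unfolding K_def using assms s by (intro finite_sum_le_infsum) auto
  finally show ?thesis .
qed

lemma linear_second_moment:
  assumes "finite A"
  shows "expectation (\<lambda>\<omega>. (\<Sum>i\<in>A. c i * U (\<tau> i) \<omega>) * (\<Sum>l\<in>B. d l * U (\<sigma> l) \<omega>))
    = (\<Sum>i\<in>A. \<Sum>l\<in>B. c i * d l * \<gamma> (\<tau> i - \<sigma> l))"
proof -
  have "expectation (\<lambda>\<omega>. (\<Sum>i\<in>A. c i * U (\<tau> i) \<omega>) * (\<Sum>l\<in>B. d l * U (\<sigma> l) \<omega>))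
    = expectation (\<lambda>\<omega>. \<Sum>i\<in>A. \<Sum>l\<in>B. c i * d l * (U (\<tau> i) \<omega> * U (\<sigma> l) \<omega>))"
    by (simp add: sum_product mult_ac)
  also have "\<dots> = (\<Sum>i\<in>A. \<Sum>l\<in>B. expectation (\<lambda>\<omega>. c i * d l * (U (\<tau> i) \<omega> * U (\<sigma> l) \<omega>)))"
  proof -
    have i: "integrable M (\<lambda>\<omega>. c i * d l * (U (\<tau> i) \<omega> * U (\<sigma> l) \<omega>))" for i l
      by (intro integrable_mult_right L2_mult L2_U)
    show ?thesis
      by (simp only: Bochner_Integration.integral_sum i Bochner_Integration.integrable_sum)
  qed
  finally show ?thesis by (simp add: U_cov)
qed

text \<open>At distinct times every row of the covariance matrix consists of values of the
  autocovariance at distinct lags, so its absolute sum is at most \<open>G\<close> and Schur's test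
  applies.\<close>

lemma linear_second_moment_le:
  assumes "finite A" "inj_on \<tau> A"
  shows "expectation (\<lambda>\<omega>. (\<Sum>i\<in>A. c i * U (\<tau> i) \<omega>)\<^sup>2) \<le> G * (\<Sum>i\<in>A. (c i)\<^sup>2)"
proof -
  have "expectation (\<lambda>\<omega>. (\<Sum>i\<in>A. c i * U (\<tau> i) \<omega>)\<^sup>2) = (\<Sum>i\<in>A. \<Sum>l\<in>A. c i * c l * \<gamma> (\<tau> i - \<tau> l))"
    using linear_second_moment[OF assms(1), of c \<tau> c \<tau> A] by (simp add: power2_eq_square)
  also have "\<dots> \<le> (\<Sum>i\<in>A. \<Sum>l\<in>A. \<bar>c i\<bar> * \<bar>c l\<bar> * \<bar>\<gamma> (\<tau> i - \<tau> l)\<bar>)"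
    by (intro sum_mono) (metis abs_ge_self abs_mult)
  also have "\<dots> \<le> G * (\<Sum>i\<in>A. (c i)\<^sup>2)"
    using assms by (intro sum_quadratic_form_le sum_acov_le) (auto simp: inj_on_def)
  finally show ?thesis .
qed

definition partial_filter :: "(nat \<Rightarrow> real) \<Rightarrow> nat \<Rightarrow> int \<Rightarrow> 'a \<Rightarrow> real" where
  "partial_filter b J t \<omega> = (\<Sum>j<J. b j * U (t - int j) \<omega>)"

definition filtered :: "(nat \<Rightarrow> real) \<Rightarrow> int \<Rightarrow> 'a \<Rightarrow> real" where
  "filtered b t \<omega> = (\<Sum>j. b j * U (t - int j) \<omega>)"

text \<open>A majorant of all truncations of the filter at once. It turns out to have a fourth
  moment, so moments of products of truncated filters pass to the limit by dominated
  convergence.\<close>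

definition envelope :: "(nat \<Rightarrow> real) \<Rightarrow> int \<Rightarrow> 'a \<Rightarrow> real" where
  "envelope b t \<omega> = (\<Sum>j. \<bar>b j\<bar> * \<bar>U (t - int j) \<omega>\<bar>)"

lemma partial_filter_measurable [measurable]: "partial_filter b J t \<in> borel_measurable M"
  unfolding partial_filter_def by measurable

lemma filtered_measurable [measurable]: "filtered b t \<in> borel_measurable M"
  unfolding filtered_def by measurable

lemma envelope_measurable [measurable]: "envelope b t \<in> borel_measurable M"
  unfolding envelope_def by measurable

context
  fixes b :: "nat \<Rightarrow> real"
  assumes b: "summable (\<lambda>j. \<bar>b j\<bar>)"
begin

lemma AE_summable4: "AE \<omega> in M. summable (\<lambda>j. \<bar>b j\<bar> * U (t - int j) \<omega> ^ 4)"
  and integrable_suminf4: "integrable M (\<lambda>\<omega>. \<Sum>j. \<bar>b j\<bar> * U (t - int j) \<omega> ^ 4)"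
proof -
  have i: "integrable M (\<lambda>\<omega>. \<bar>b j\<bar> * U (t - int j) \<omega> ^ 4)" for j
    using fourth by simp
  have e: "expectation (\<lambda>\<omega>. \<bar>b j\<bar> * U (t - int j) \<omega> ^ 4) = \<bar>b j\<bar> * expectation (\<lambda>\<omega>. U 0 \<omega> ^ 4)" for j
    using U_fourth_moment_const[of "t - int j"] by simp
  have s: "summable (\<lambda>j. expectation (\<lambda>\<omega>. \<bar>b j\<bar> * U (t - int j) \<omega> ^ 4))"
    unfolding e using b by (rule summable_mult2)
  note * = integrable_suminf_nonneg[of M "\<lambda>j \<omega>. \<bar>b j\<bar> * U (t - int j) \<omega> ^ 4", OF i _ s]
  show "AE \<omega> in M. summable (\<lambda>j. \<bar>b j\<bar> * U (t - int j) \<omega> ^ 4)"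
    by (rule *(1)) simp
  show "integrable M (\<lambda>\<omega>. \<Sum>j. \<bar>b j\<bar> * U (t - int j) \<omega> ^ 4)"
    by (rule *(2)) simp
qed

lemma AE_summable_abs: "AE \<omega> in M. summable (\<lambda>j. \<bar>b j\<bar> * \<bar>U (t - int j) \<omega>\<bar>)"
  using AE_summable4[of t]
proof eventually_elim
  case (elim \<omega>)
  have le: "\<bar>b j\<bar> * \<bar>U (t - int j) \<omega>\<bar> \<le> \<bar>b j\<bar> + \<bar>b j\<bar> * U (t - int j) \<omega> ^ 4" for j
  proof -
    define u where "u = \<bar>U (t - int j) \<omega>\<bar>"
    \<comment> \<open>Almost sure summability is known for the fourth powers; this passes to first
      powers at the price of the summable series of |b_j|.\<close>
    have "u \<le> 1 + u ^ 4"
    proof (cases "u \<le> 1")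
      case True
      moreover have "0 \<le> u ^ 4" by (simp add: u_def)
      ultimately show ?thesis by linarith
    next
      case False
      then have "u ^ 1 \<le> u ^ 4" by (intro power_increasing) auto
      then show ?thesis by simp
    qed
    then have "\<bar>b j\<bar> * u \<le> \<bar>b j\<bar> * (1 + u ^ 4)" by (intro mult_left_mono) auto
    then show ?thesis by (simp add: u_def ring_distribs)
  qed
  show ?case
  proof (rule summable_comparison_test'[OF summable_add[OF b elim]])
    show "norm (\<bar>b j\<bar> * \<bar>U (t - int j) \<omega>\<bar>) \<le> \<bar>b j\<bar> + \<bar>b j\<bar> * U (t - int j) \<omega> ^ 4" for j
      using le[of j] by (simp only: real_norm_def abs_mult abs_idempotent)
  qed
qed

lemma AE_partial_filter_le: "AE \<omega> in M. \<forall>J. \<bar>partial_filter b J t \<omega>\<bar> \<le> envelope b t \<omega>"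
  using AE_summable_abs[of t]
proof eventually_elim
  case (elim \<omega>)
  show ?case
  proof
    fix J
    have "\<bar>partial_filter b J t \<omega>\<bar> \<le> (\<Sum>j<J. \<bar>b j\<bar> * \<bar>U (t - int j) \<omega>\<bar>)"
      unfolding partial_filter_def by (rule order_trans[OF sum_abs]) (simp add: abs_mult)
    also have "\<dots> \<le> envelope b t \<omega>"
      unfolding envelope_def by (intro sum_le_suminf elim) auto
    finally show "\<bar>partial_filter b J t \<omega>\<bar> \<le> envelope b t \<omega>" .
  qed
qed

lemma AE_partial_filter_tendsto: "AE \<omega> in M. (\<lambda>J. partial_filter b J t \<omega>) \<longlonglongrightarrow> filtered b t \<omega>"
  using AE_summable_abs[of t]
proof eventually_elim
  case (elim \<omega>)
  then have "summable (\<lambda>j. \<bar>b j * U (t - int j) \<omega>\<bar>)" by (simp add: abs_mult)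
  then have "summable (\<lambda>j. b j * U (t - int j) \<omega>)" by (rule summable_rabs_cancel)
  then show ?case unfolding partial_filter_def filtered_def by (rule summable_LIMSEQ)
qed

lemma L4_envelope: "L4 (envelope b t)"
proof -
  have "AE \<omega> in M. \<bar>envelope b t \<omega> ^ 4\<bar> \<le> (\<Sum>j. \<bar>b j\<bar>) ^ 3 * (\<Sum>j. \<bar>b j\<bar> * U (t - int j) \<omega> ^ 4)"
    using AE_summable_abs[of t] AE_summable4[of t]
  proof eventually_elim
    case (elim \<omega>)
    have "(\<Sum>j<J. \<bar>b j\<bar> * \<bar>U (t - int j) \<omega>\<bar>) ^ 4 \<le> (\<Sum>j. \<bar>b j\<bar>) ^ 3 * (\<Sum>j. \<bar>b j\<bar> * U (t - int j) \<omega> ^ 4)" for J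
    proof -
      have "(\<Sum>j<J. \<bar>b j\<bar> * \<bar>U (t - int j) \<omega>\<bar>) ^ 4
          \<le> (\<Sum>j<J. \<bar>b j\<bar>) ^ 3 * (\<Sum>j<J. \<bar>b j\<bar> * \<bar>U (t - int j) \<omega>\<bar> ^ 4)"
        by (rule sum_weighted_pow4_le) simp
      also have "\<dots> \<le> (\<Sum>j. \<bar>b j\<bar>) ^ 3 * (\<Sum>j. \<bar>b j\<bar> * U (t - int j) \<omega> ^ 4)"
        using elim b by (intro mult_mono power_mono)
          (auto simp: power_even_abs intro!: sum_le_suminf sum_nonneg suminf_nonneg)
      finally show ?thesis .
    qed
    then have "(envelope b t \<omega>) ^ 4 \<le> (\<Sum>j. \<bar>b j\<bar>) ^ 3 * (\<Sum>j. \<bar>b j\<bar> * U (t - int j) \<omega> ^ 4)"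
      unfolding envelope_def by (intro LIMSEQ_le_const2[OF tendsto_power[OF summable_LIMSEQ[OF elim(1)]]]) auto
    then show ?case by simp
  qed
  then have "integrable M (\<lambda>\<omega>. envelope b t \<omega> ^ 4)"
    by (intro Bochner_Integration.integrable_bound[OF integrable_mult_right[OF integrable_suminf4[of t],
        of "(\<Sum>j. \<bar>b j\<bar>) ^ 3"]])
      (auto elim!: eventually_mono)
  then show ?thesis by (simp add: L4_def)
qed

lemma AE_filtered_le: "AE \<omega> in M. \<bar>filtered b t \<omega>\<bar> \<le> envelope b t \<omega>"
  using AE_partial_filter_le[of t] AE_partial_filter_tendsto[of t]
  by eventually_elim (intro LIMSEQ_le_const2[OF tendsto_rabs], auto)

lemma L4_filtered: "L4 (filtered b t)"
  by (rule L4_dominated[OF L4_envelope _ AE_filtered_le]) measurable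

lemma filtered_cov_tendsto:
  "(\<lambda>J. expectation (\<lambda>\<omega>. partial_filter b J s \<omega> * partial_filter b J t \<omega>))
    \<longlonglongrightarrow> expectation (\<lambda>\<omega>. filtered b s \<omega> * filtered b t \<omega>)"
proof (rule integral_dominated_convergence)
  show "integrable M (\<lambda>\<omega>. envelope b s \<omega> * envelope b t \<omega>)"
    by (intro L2_mult L4_L2 L4_envelope)
  show "AE \<omega> in M. (\<lambda>J. partial_filter b J s \<omega> * partial_filter b J t \<omega>) \<longlonglongrightarrow> filtered b s \<omega> * filtered b t \<omega>"
    using AE_partial_filter_tendsto[of s] AE_partial_filter_tendsto[of t]
    by eventually_elim (intro tendsto_mult)
  show "AE \<omega> in M. norm (partial_filter b J s \<omega> * partial_filter b J t \<omega>) \<le> envelope b s \<omega> * envelope b t \<omega>" for J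
    using AE_partial_filter_le[of s] AE_partial_filter_le[of t]
    by eventually_elim (auto intro!: abs_mult_le)
qed measurable

lemma cross_cov_tendsto:
  "(\<lambda>J. expectation (\<lambda>\<omega>. U s \<omega> * partial_filter b J t \<omega>)) \<longlonglongrightarrow> expectation (\<lambda>\<omega>. U s \<omega> * filtered b t \<omega>)"
proof (rule integral_dominated_convergence)
  show "integrable M (\<lambda>\<omega>. \<bar>U s \<omega>\<bar> * envelope b t \<omega>)"
    by (intro L2_mult L4_L2 L4_envelope L4_abs L4_U)
  show "AE \<omega> in M. (\<lambda>J. U s \<omega> * partial_filter b J t \<omega>) \<longlonglongrightarrow> U s \<omega> * filtered b t \<omega>"
    using AE_partial_filter_tendsto[of t] by eventually_elim (intro tendsto_mult tendsto_const)
  show "AE \<omega> in M. norm (U s \<omega> * partial_filter b J t \<omega>) \<le> \<bar>U s \<omega>\<bar> * envelope b t \<omega>" for J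
    using AE_partial_filter_le[of t] by eventually_elim (auto intro!: abs_mult_le)
qed measurable

lemma partial_filter_cov:
  "expectation (\<lambda>\<omega>. partial_filter b J s \<omega> * partial_filter b J t \<omega>)
    = (\<Sum>j<J. \<Sum>l<J. b j * b l * \<gamma> (s - t - int j + int l))"
  unfolding partial_filter_def by (subst linear_second_moment) (simp_all add: algebra_simps)

lemma cross_cov_partial:
  "expectation (\<lambda>\<omega>. U s \<omega> * partial_filter b J t \<omega>) = (\<Sum>j<J. b j * \<gamma> (s - t + int j))"
  using linear_second_moment[of "{()}" "\<lambda>_. 1" "\<lambda>_. s" b "\<lambda>j. t - int j" "{..<J}"]
  by (simp add: partial_filter_def algebra_simps)

text \<open>Each truncated covariance depends on the two times only through their difference, and
  limits are unique; no infinite double series has to be handled.\<close>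

lemma filtered_cov_shift:
  assumes "s - t = s' - t'"
  shows "expectation (\<lambda>\<omega>. filtered b s \<omega> * filtered b t \<omega>) = expectation (\<lambda>\<omega>. filtered b s' \<omega> * filtered b t' \<omega>)"
  using filtered_cov_tendsto[of s t] filtered_cov_tendsto[of s' t'] assms
  unfolding partial_filter_cov by (auto intro: LIMSEQ_unique)

lemma cross_cov_shift:
  assumes "s - t = s' - t'"
  shows "expectation (\<lambda>\<omega>. U s \<omega> * filtered b t \<omega>) = expectation (\<lambda>\<omega>. U s' \<omega> * filtered b t' \<omega>)"
  using cross_cov_tendsto[of s t] cross_cov_tendsto[of s' t'] assms
  unfolding cross_cov_partial by (auto intro: LIMSEQ_unique)

lemma filtered_mean: "expectation (filtered b t) = 0"
proof -
  have "(\<lambda>J. expectation (partial_filter b J t)) \<longlonglongrightarrow> expectation (filtered b t)"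
  proof (rule integral_dominated_convergence)
    show "integrable M (envelope b t)" by (intro L2_integrable L4_L2 L4_envelope)
    show "AE \<omega> in M. (\<lambda>J. partial_filter b J t \<omega>) \<longlonglongrightarrow> filtered b t \<omega>"
      by (rule AE_partial_filter_tendsto)
    show "AE \<omega> in M. norm (partial_filter b J t \<omega>) \<le> envelope b t \<omega>" for J
      using AE_partial_filter_le[of t] by eventually_elim auto
  qed measurable
  moreover have "expectation (partial_filter b J t) = 0" for J
    unfolding partial_filter_def
    by (subst Bochner_Integration.integral_sum) (auto intro!: L2_integrable L2_U simp: mean0)
  ultimately show ?thesis by (simp add: LIMSEQ_const_iff)
qed

lemma acov_filtered: "acov M (filtered b) h = expectation (\<lambda>\<omega>. filtered b h \<omega> * filtered b 0 \<omega>)"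
  by (simp add: acov_def filtered_mean)

lemma filtered_second_moment_le:
  assumes "summable (\<lambda>j. (b j)\<^sup>2)"
  shows "expectation (\<lambda>\<omega>. (filtered b t \<omega>)\<^sup>2) \<le> G * (\<Sum>j. (b j)\<^sup>2)"
proof -
  have "expectation (\<lambda>\<omega>. partial_filter b J t \<omega> * partial_filter b J t \<omega>) \<le> G * (\<Sum>j. (b j)\<^sup>2)" for J
  proof -
    have "expectation (\<lambda>\<omega>. partial_filter b J t \<omega> * partial_filter b J t \<omega>) \<le> G * (\<Sum>j<J. (b j)\<^sup>2)"
      using linear_second_moment_le[of "{..<J}" "\<lambda>j. t - int j" b]
      by (simp add: partial_filter_def power2_eq_square inj_on_def)
    also have "\<dots> \<le> G * (\<Sum>j. (b j)\<^sup>2)"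
      using assms G_nonneg by (intro mult_left_mono sum_le_suminf) auto
    finally show ?thesis .
  qed
  then show ?thesis using LIMSEQ_le_const2[OF filtered_cov_tendsto[of t t]] by (auto simp: power2_eq_square)
qed

text \<open>The sum over the filter index falls on the autocovariance, so only the supremum of
  \<open>b\<close> enters. Hence the cross-covariances stay bounded as d tends to 0, although the
  variance of the filtered process grows like 1/d.\<close>

lemma cross_cov_le:
  assumes "\<And>j. \<bar>b j\<bar> \<le> B"
  shows "\<bar>expectation (\<lambda>\<omega>. U s \<omega> * filtered b t \<omega>)\<bar> \<le> B * G"
proof -
  have B: "0 \<le> B" using assms[of 0] by linarith
  have "\<bar>expectation (\<lambda>\<omega>. U s \<omega> * partial_filter b J t \<omega>)\<bar> \<le> B * G" for J
  proof -
    have "\<bar>\<Sum>j<J. b j * \<gamma> (s - t + int j)\<bar> \<le> (\<Sum>j<J. B * \<bar>\<gamma> (s - t + int j)\<bar>)"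
      using assms by (intro order_trans[OF sum_abs] sum_mono) (auto simp: abs_mult intro: mult_right_mono)
    also have "\<dots> \<le> B * G"
      unfolding sum_distrib_left[symmetric] using B by (intro mult_left_mono sum_acov_le) (auto simp: inj_on_def)
    finally show ?thesis unfolding cross_cov_partial .
  qed
  then show ?thesis using LIMSEQ_le_const2[OF tendsto_rabs[OF cross_cov_tendsto[of s t]]] by auto
qed

end
end

section \<open>Variance of sums of innovation times filtered value\<close>

context stationary4
begin

context
  fixes b :: "nat \<Rightarrow> real"
  assumes b: "summable (\<lambda>j. \<bar>b j\<bar>)"
begin

text \<open>Each connected term keeps one free time index, which gives the factor
  \<open>card T\<close>, and none produces the square of the absolute sum of \<open>b\<close>. For
  the resonant filter the bracket is therefore of order 1/d and not 1/d^2. The truncation makes all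
  moments finite sums.\<close>

lemma partial_cross_variance_le:
  fixes T :: "int set" and J :: nat and k :: int
  assumes T: "finite T" and B: "\<And>j. \<bar>b j\<bar> \<le> B" and b2: "summable (\<lambda>j. (b j)\<^sup>2)"
  defines "S \<equiv> \<lambda>\<omega>. \<Sum>t\<in>T. U t \<omega> * partial_filter b J (t - k) \<omega>"
  shows "expectation (\<lambda>\<omega>. (S \<omega>)\<^sup>2) - (expectation S)\<^sup>2
    \<le> real (card T) * (B\<^sup>2 * K + G\<^sup>2 * (\<Sum>j. (b j)\<^sup>2) + B * G\<^sup>2 * (\<Sum>j. \<bar>b j\<bar>))"
proof -
  define P where "P = T \<times> {..<J}"
  define \<rho> :: "int \<times> nat \<Rightarrow> int" where "\<rho> p = fst p - k - int (snd p)" for p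
  define \<beta> where "\<beta> p = b (snd p)" for p :: "int \<times> nat"
  have sum_P: "sum h P = (\<Sum>t\<in>T. \<Sum>j<J. h (t, j))" for h :: "int \<times> nat \<Rightarrow> real"
    by (simp add: P_def sum.cartesian_product)
  have P: "finite P" using T by (simp add: P_def)
  have B0: "0 \<le> B" using B[of 0] by linarith
  have S: "S \<omega> = (\<Sum>p\<in>P. \<beta> p * (U (fst p) \<omega> * U (\<rho> p) \<omega>))" for \<omega>
    unfolding S_def P_def partial_filter_def sum_distrib_left
    by (simp add: sum.cartesian_product case_prod_unfold \<beta>_def \<rho>_def mult_ac)
  have i1: "L2 (\<lambda>\<omega>. U s \<omega> * U t \<omega>)" for s t by (intro L4_mult L4_U)
  have ES: "expectation S = (\<Sum>p\<in>P. \<beta> p * \<gamma> (fst p - \<rho> p))"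
    unfolding S using L2_integrable[OF i1]
    by (subst Bochner_Integration.integral_sum) (auto simp: U_cov)
  have ESsq: "(expectation S)\<^sup>2 = (\<Sum>p\<in>P. \<Sum>q\<in>P. \<beta> p * \<gamma> (fst p - \<rho> p) * (\<beta> q * \<gamma> (fst q - \<rho> q)))"
    unfolding ES power2_eq_square sum_product ..
  have "expectation (\<lambda>\<omega>. (S \<omega>)\<^sup>2) = expectation (\<lambda>\<omega>. \<Sum>p\<in>P. \<Sum>q\<in>P. \<beta> p * \<beta> q *
      (U (fst p) \<omega> * U (\<rho> p) \<omega> * (U (fst q) \<omega> * U (\<rho> q) \<omega>)))"
    unfolding S power2_eq_square sum_product by (simp add: mult_ac)
  also have "\<dots> = (\<Sum>p\<in>P. \<Sum>q\<in>P. \<beta> p * \<beta> q * expectation (\<lambda>\<omega>. U (fst p) \<omega> * U (\<rho> p) \<omega> * (U (fst q) \<omega> * U (\<rho> q) \<omega>)))"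
  proof -
    have i: "integrable M (\<lambda>\<omega>. \<beta> p * \<beta> q * (U (fst p) \<omega> * U (\<rho> p) \<omega> * (U (fst q) \<omega> * U (\<rho> q) \<omega>)))" for p q
      by (intro integrable_mult_right L2_mult i1)
    show ?thesis
      by (simp only: Bochner_Integration.integral_sum i Bochner_Integration.integrable_sum)
        (simp only: integral_mult_right_zero)
  qed
  finally have ES2: "expectation (\<lambda>\<omega>. (S \<omega>)\<^sup>2) = \<dots>" .
  \<comment> \<open>The connected parts: the joint cumulant, the pairing of like factors (innovation
    with innovation, filter term with filter term), and the crossed pairing. The pairing inside each
    product cancels against the squared mean.\<close>
  define c1 c2 c3 where "c1 p q = \<kappa> (\<rho> p - fst p, fst q - fst p, \<rho> q - fst p)"
    and "c2 p q = \<gamma> (fst p - fst q) * \<gamma> (\<rho> p - \<rho> q)" and "c3 p q = \<gamma> (fst p - \<rho> q) * \<gamma> (\<rho> p - fst q)"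
    for p q :: "int \<times> nat"
  have "expectation (\<lambda>\<omega>. (S \<omega>)\<^sup>2) - (expectation S)\<^sup>2
    = (\<Sum>p\<in>P. \<Sum>q\<in>P. \<beta> p * \<beta> q * (c1 p q + c2 p q + c3 p q))"
    unfolding ES2 ESsq sum_subtractf[symmetric]
    by (intro sum.cong refl) (simp only: U_fourth_moment c1_def c2_def c3_def, simp add: algebra_simps)
  also have "\<dots> \<le> (\<Sum>p\<in>P. \<Sum>q\<in>P. \<bar>\<beta> p\<bar> * \<bar>\<beta> q\<bar> * (\<bar>c1 p q\<bar> + \<bar>c2 p q\<bar> + \<bar>c3 p q\<bar>))"
  proof (intro sum_mono)
    fix p q
    have "\<beta> p * \<beta> q * (c1 p q + c2 p q + c3 p q) \<le> \<bar>\<beta> p * \<beta> q * (c1 p q + c2 p q + c3 p q)\<bar>" by (rule abs_ge_self)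
    also have "\<dots> \<le> \<bar>\<beta> p\<bar> * \<bar>\<beta> q\<bar> * (\<bar>c1 p q\<bar> + \<bar>c2 p q\<bar> + \<bar>c3 p q\<bar>)"
      unfolding abs_mult by (intro mult_left_mono abs_add_le) auto
    finally show "\<beta> p * \<beta> q * (c1 p q + c2 p q + c3 p q) \<le> \<bar>\<beta> p\<bar> * \<bar>\<beta> q\<bar> * (\<bar>c1 p q\<bar> + \<bar>c2 p q\<bar> + \<bar>c3 p q\<bar>)" .
  qed
  also have "\<dots> = (\<Sum>p\<in>P. \<Sum>q\<in>P. \<bar>\<beta> p\<bar> * \<bar>\<beta> q\<bar> * \<bar>c1 p q\<bar>) + (\<Sum>p\<in>P. \<Sum>q\<in>P. \<bar>\<beta> p\<bar> * \<bar>\<beta> q\<bar> * \<bar>c2 p q\<bar>)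
     + (\<Sum>p\<in>P. \<Sum>q\<in>P. \<bar>\<beta> p\<bar> * \<bar>\<beta> q\<bar> * \<bar>c3 p q\<bar>)"
    by (simp add: distrib_left sum.distrib)
  finally have main: "expectation (\<lambda>\<omega>. (S \<omega>)\<^sup>2) - (expectation S)\<^sup>2 \<le> \<dots>" .
  have "(\<Sum>p\<in>P. \<Sum>q\<in>P. \<bar>\<beta> p\<bar> * \<bar>\<beta> q\<bar> * \<bar>c1 p q\<bar>) \<le> (\<Sum>p\<in>P. \<Sum>q\<in>P. B\<^sup>2 * \<bar>c1 p q\<bar>)"
    using B B0 by (intro sum_mono mult_right_mono) (auto simp: \<beta>_def power2_eq_square intro!: mult_mono)
  also have "\<dots> = (\<Sum>t\<in>T. B\<^sup>2 * (\<Sum>x\<in>{..<J} \<times> P. \<bar>c1 (t, fst x) (snd x)\<bar>))"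
  proof -
    have "(\<Sum>p\<in>P. \<Sum>q\<in>P. B\<^sup>2 * \<bar>c1 p q\<bar>) = (\<Sum>t\<in>T. \<Sum>j<J. \<Sum>q\<in>P. B\<^sup>2 * \<bar>c1 (t, j) q\<bar>)"
      by (rule sum_P)
    moreover have "(\<Sum>x\<in>{..<J} \<times> P. \<bar>c1 (t, fst x) (snd x)\<bar>) = (\<Sum>j<J. \<Sum>q\<in>P. \<bar>c1 (t, j) q\<bar>)" for t
      by (simp add: sum.cartesian_product case_prod_unfold)
    ultimately show ?thesis by (simp only: sum_distrib_left)
  qed
  also have "\<dots> \<le> (\<Sum>t\<in>T. B\<^sup>2 * K)"
  proof (intro sum_mono mult_left_mono)
    fix t
    \<comment> \<open>For fixed \<open>t\<close> the three lags determine the first filter index,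
      then the second time, then the second filter index. No lag triple occurs twice, so the
      cumulants add up to at most \<open>K\<close>.\<close>
    have "inj_on (\<lambda>x. (\<rho> (t, fst x) - t, fst (snd x) - t, \<rho> (snd x) - t)) ({..<J} \<times> P)"
      by (auto simp: inj_on_def \<rho>_def)
    then show "(\<Sum>x\<in>{..<J} \<times> P. \<bar>c1 (t, fst x) (snd x)\<bar>) \<le> K"
      using sum_cum_le[of "{..<J} \<times> P"] P by (simp add: c1_def)
  qed simp
  also have "\<dots> = real (card T) * (B\<^sup>2 * K)" by simp
  finally have 1: "(\<Sum>p\<in>P. \<Sum>q\<in>P. \<bar>\<beta> p\<bar> * \<bar>\<beta> q\<bar> * \<bar>c1 p q\<bar>) \<le> real (card T) * (B\<^sup>2 * K)" .
  have swap: "(\<Sum>p\<in>P. \<Sum>q\<in>P. f (fst p) (snd p) (fst q) (snd q)) = (\<Sum>t\<in>T. \<Sum>s\<in>T. \<Sum>j<J. \<Sum>l<J. f t j s l)"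
    for f :: "int \<Rightarrow> nat \<Rightarrow> int \<Rightarrow> nat \<Rightarrow> real"
  proof -
    have "(\<Sum>p\<in>P. \<Sum>q\<in>P. f (fst p) (snd p) (fst q) (snd q)) = (\<Sum>t\<in>T. \<Sum>j<J. \<Sum>s\<in>T. \<Sum>l<J. f t j s l)"
      by (simp only: sum_P fst_conv snd_conv)
    also have "\<dots> = (\<Sum>t\<in>T. \<Sum>s\<in>T. \<Sum>j<J. \<Sum>l<J. f t j s l)"
      by (intro sum.cong refl sum.swap)
    finally show ?thesis .
  qed
  have g: "(\<Sum>s\<in>T. \<bar>\<gamma> (t - s)\<bar>) \<le> G" for t
    using T by (intro sum_acov_le) (auto simp: inj_on_def)
  have pos: "0 \<le> G * (\<Sum>j. (b j)\<^sup>2)" using G_nonneg b2 by (intro mult_nonneg_nonneg suminf_nonneg) auto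
  \<comment> \<open>For fixed times the filter part is a quadratic form in \<open>b\<close>, handled
    by Schur's test; the covariance of the innovations then sums over \<open>s\<close> to at most
    \<open>G\<close>.\<close>
  have "(\<Sum>p\<in>P. \<Sum>q\<in>P. \<bar>\<beta> p\<bar> * \<bar>\<beta> q\<bar> * \<bar>c2 p q\<bar>)
    = (\<Sum>t\<in>T. \<Sum>s\<in>T. \<bar>\<gamma> (t - s)\<bar> * (\<Sum>j<J. \<Sum>l<J. \<bar>b j\<bar> * \<bar>b l\<bar> * \<bar>\<gamma> (t - s - int j + int l)\<bar>))"
    unfolding sum_distrib_left
    using swap[of "\<lambda>t j s l. \<bar>b j\<bar> * \<bar>b l\<bar> * \<bar>\<gamma> (t - s) * \<gamma> (t - k - int j - (s - k - int l))\<bar>"]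
    by (simp add: \<beta>_def c2_def \<rho>_def abs_mult algebra_simps)
  also have "\<dots> \<le> (\<Sum>t\<in>T. \<Sum>s\<in>T. \<bar>\<gamma> (t - s)\<bar> * (G * (\<Sum>j. (b j)\<^sup>2)))"
  proof (intro sum_mono mult_left_mono)
    fix t s
    have "(\<Sum>j<J. \<Sum>l<J. \<bar>b j\<bar> * \<bar>b l\<bar> * \<bar>\<gamma> (t - s - int j + int l)\<bar>) \<le> G * (\<Sum>j<J. (b j)\<^sup>2)"
      by (intro sum_quadratic_form_le sum_acov_le) (auto simp: inj_on_def)
    also have "\<dots> \<le> G * (\<Sum>j. (b j)\<^sup>2)"
      using b2 G_nonneg by (intro mult_left_mono sum_le_suminf) auto
    finally show "(\<Sum>j<J. \<Sum>l<J. \<bar>b j\<bar> * \<bar>b l\<bar> * \<bar>\<gamma> (t - s - int j + int l)\<bar>) \<le> G * (\<Sum>j. (b j)\<^sup>2)" .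
  qed simp
  also have "\<dots> = (\<Sum>t\<in>T. (\<Sum>s\<in>T. \<bar>\<gamma> (t - s)\<bar>) * (G * (\<Sum>j. (b j)\<^sup>2)))"
    by (simp only: sum_distrib_right)
  also have "\<dots> \<le> (\<Sum>t\<in>T. G * (G * (\<Sum>j. (b j)\<^sup>2)))"
    by (intro sum_mono mult_right_mono g pos)
  also have "\<dots> = real (card T) * (G\<^sup>2 * (\<Sum>j. (b j)\<^sup>2))" by (simp add: power2_eq_square)
  finally have 2: "(\<Sum>p\<in>P. \<Sum>q\<in>P. \<bar>\<beta> p\<bar> * \<bar>\<beta> q\<bar> * \<bar>c2 p q\<bar>) \<le> real (card T) * (G\<^sup>2 * (\<Sum>j. (b j)\<^sup>2))" .
  \<comment> \<open>In the crossed pairing each covariance contains one filter index. The sum over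
    \<open>l\<close> is absorbed by one covariance at the price of the bound \<open>B\<close>, the
    sum over \<open>s\<close> by the other, and the absolute sum of \<open>b\<close> over
    \<open>j\<close> is left.\<close>
  have "(\<Sum>p\<in>P. \<Sum>q\<in>P. \<bar>\<beta> p\<bar> * \<bar>\<beta> q\<bar> * \<bar>c3 p q\<bar>)
    = (\<Sum>t\<in>T. \<Sum>s\<in>T. \<Sum>j<J. \<Sum>l<J. \<bar>b j\<bar> * \<bar>b l\<bar> * (\<bar>\<gamma> (t - k - int j - s)\<bar> * \<bar>\<gamma> (t - s + k + int l)\<bar>))"
    using swap[of "\<lambda>t j s l. \<bar>b j\<bar> * \<bar>b l\<bar> * \<bar>\<gamma> (t - (s - k - int l)) * \<gamma> (t - k - int j - s)\<bar>"]
    by (simp add: \<beta>_def c3_def \<rho>_def abs_mult algebra_simps)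
  also have "\<dots> \<le> (\<Sum>t\<in>T. \<Sum>s\<in>T. \<Sum>j<J. \<Sum>l<J. \<bar>b j\<bar> * B * (\<bar>\<gamma> (t - k - int j - s)\<bar> * \<bar>\<gamma> (t - s + k + int l)\<bar>))"
    using B by (intro sum_mono mult_right_mono mult_left_mono) auto
  also have "\<dots> = (\<Sum>t\<in>T. \<Sum>s\<in>T. \<Sum>j<J. \<bar>b j\<bar> * B * (\<bar>\<gamma> (t - k - int j - s)\<bar> * (\<Sum>l<J. \<bar>\<gamma> (t - s + k + int l)\<bar>)))"
    by (simp only: sum_distrib_left)
  also have "\<dots> \<le> (\<Sum>t\<in>T. \<Sum>s\<in>T. \<Sum>j<J. \<bar>b j\<bar> * B * (\<bar>\<gamma> (t - k - int j - s)\<bar> * G))"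
    using B0 by (intro sum_mono mult_left_mono sum_acov_le) (auto simp: inj_on_def)
  also have "\<dots> = (\<Sum>t\<in>T. \<Sum>j<J. \<bar>b j\<bar> * B * ((\<Sum>s\<in>T. \<bar>\<gamma> (t - k - int j - s)\<bar>) * G))"
    unfolding sum_distrib_left sum_distrib_right by (intro sum.cong refl sum.swap)
  also have "\<dots> \<le> (\<Sum>t\<in>T. \<Sum>j<J. \<bar>b j\<bar> * B * (G * G))"
    using B0 G_nonneg by (intro sum_mono mult_left_mono mult_right_mono g) auto
  also have "\<dots> = real (card T) * ((\<Sum>j<J. \<bar>b j\<bar>) * B * (G * G))"
    by (simp add: sum_distrib_right)
  also have "\<dots> \<le> real (card T) * ((\<Sum>j. \<bar>b j\<bar>) * B * (G * G))"
    using B0 G_nonneg b by (intro mult_left_mono mult_right_mono sum_le_suminf) auto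
  finally have 3: "(\<Sum>p\<in>P. \<Sum>q\<in>P. \<bar>\<beta> p\<bar> * \<bar>\<beta> q\<bar> * \<bar>c3 p q\<bar>) \<le> real (card T) * (B * G\<^sup>2 * (\<Sum>j. \<bar>b j\<bar>))"
    by (simp add: power2_eq_square mult_ac)
  have "(\<Sum>p\<in>P. \<Sum>q\<in>P. \<bar>\<beta> p\<bar> * \<bar>\<beta> q\<bar> * \<bar>c1 p q\<bar>) + (\<Sum>p\<in>P. \<Sum>q\<in>P. \<bar>\<beta> p\<bar> * \<bar>\<beta> q\<bar> * \<bar>c2 p q\<bar>)
     + (\<Sum>p\<in>P. \<Sum>q\<in>P. \<bar>\<beta> p\<bar> * \<bar>\<beta> q\<bar> * \<bar>c3 p q\<bar>)
    \<le> real (card T) * (B\<^sup>2 * K + G\<^sup>2 * (\<Sum>j. (b j)\<^sup>2) + B * G\<^sup>2 * (\<Sum>j. \<bar>b j\<bar>))"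
    unfolding distrib_left by (intro add_mono 1 2 3)
  with main show ?thesis by (rule order_trans)
qed

text \<open>The truncated bound does not depend on \<open>J\<close> and survives the limit; one
  square-integrable majorant serves all truncations.\<close>

lemma cross_variance_le:
  fixes T :: "int set" and k :: int
  assumes T: "finite T" and B: "\<And>j. \<bar>b j\<bar> \<le> B" and b2: "summable (\<lambda>j. (b j)\<^sup>2)"
  defines "S \<equiv> \<lambda>\<omega>. \<Sum>t\<in>T. U t \<omega> * filtered b (t - k) \<omega>"
  shows "L2 S" "variance S
    \<le> real (card T) * (B\<^sup>2 * K + G\<^sup>2 * (\<Sum>j. (b j)\<^sup>2) + B * G\<^sup>2 * (\<Sum>j. \<bar>b j\<bar>))"
proof -
  define R where "R J \<omega> = (\<Sum>t\<in>T. U t \<omega> * partial_filter b J (t - k) \<omega>)" for J \<omega>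
  define E where "E \<omega> = (\<Sum>t\<in>T. \<bar>U t \<omega>\<bar> * envelope b (t - k) \<omega>)" for \<omega>
  have [measurable]: "R J \<in> borel_measurable M" for J unfolding R_def by measurable
  have [measurable]: "S \<in> borel_measurable M" unfolding S_def by measurable
  show LS: "L2 S" unfolding S_def by (intro L2_sum L4_mult L4_U L4_filtered b)
  have LE: "L2 E" unfolding E_def by (intro L2_sum L4_mult L4_abs L4_U L4_envelope b)
  have lim: "AE \<omega> in M. (\<lambda>J. R J \<omega>) \<longlonglongrightarrow> S \<omega>"
  proof -
    have "AE \<omega> in M. \<forall>t\<in>T. (\<lambda>J. partial_filter b J (t - k) \<omega>) \<longlonglongrightarrow> filtered b (t - k) \<omega>"
      using T AE_partial_filter_tendsto[OF b] by (subst AE_finite_all) auto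
    then show ?thesis
      unfolding R_def S_def by eventually_elim (intro tendsto_sum tendsto_mult tendsto_const; simp)
  qed
  have bnd: "AE \<omega> in M. \<forall>J. \<bar>R J \<omega>\<bar> \<le> E \<omega>"
  proof -
    have "AE \<omega> in M. \<forall>t\<in>T. \<forall>J. \<bar>partial_filter b J (t - k) \<omega>\<bar> \<le> envelope b (t - k) \<omega>"
      using T AE_partial_filter_le[OF b] by (subst AE_finite_all) auto
    then show ?thesis
    proof eventually_elim
      case (elim \<omega>)
      show ?case unfolding R_def E_def using elim
        by (intro allI order_trans[OF sum_abs] sum_mono abs_mult_le) auto
    qed
  qed
  have l1: "(\<lambda>J. expectation (R J)) \<longlonglongrightarrow> expectation S"
  proof (rule integral_dominated_convergence[OF _ _ L2_integrable[OF LE] lim])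
    show "AE \<omega> in M. norm (R J \<omega>) \<le> E \<omega>" for J using bnd by eventually_elim auto
  qed measurable
  have l2: "(\<lambda>J. expectation (\<lambda>\<omega>. (R J \<omega>)\<^sup>2)) \<longlonglongrightarrow> expectation (\<lambda>\<omega>. (S \<omega>)\<^sup>2)"
  proof (rule integral_dominated_convergence)
    show "integrable M (\<lambda>\<omega>. (E \<omega>)\<^sup>2)" using LE by (simp add: L2_def)
    show "AE \<omega> in M. norm ((R J \<omega>)\<^sup>2) \<le> (E \<omega>)\<^sup>2" for J
      using bnd by eventually_elim (auto simp: abs_le_square_iff[symmetric] intro: order_trans)
    show "AE \<omega> in M. (\<lambda>J. (R J \<omega>)\<^sup>2) \<longlonglongrightarrow> (S \<omega>)\<^sup>2"
      using lim by eventually_elim (intro tendsto_power)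
  qed measurable
  have "expectation (\<lambda>\<omega>. (S \<omega>)\<^sup>2) - (expectation S)\<^sup>2
    \<le> real (card T) * (B\<^sup>2 * K + G\<^sup>2 * (\<Sum>j. (b j)\<^sup>2) + B * G\<^sup>2 * (\<Sum>j. \<bar>b j\<bar>))"
  proof (rule LIMSEQ_le_const2[OF tendsto_diff[OF l2 tendsto_power[OF l1]]])
    show "\<exists>N. \<forall>J\<ge>N. expectation (\<lambda>\<omega>. (R J \<omega>)\<^sup>2) - (expectation (R J))\<^sup>2
      \<le> real (card T) * (B\<^sup>2 * K + G\<^sup>2 * (\<Sum>j. (b j)\<^sup>2) + B * G\<^sup>2 * (\<Sum>j. \<bar>b j\<bar>))"
      unfolding R_def using partial_cross_variance_le[OF T B b2] by blast
  qed
  moreover have "variance S = expectation (\<lambda>\<omega>. (S \<omega>)\<^sup>2) - (expectation S)\<^sup>2"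
    using L2_integrable[OF LS] LS by (intro variance_eq) (auto simp: L2_def)
  ultimately show "variance S \<le> real (card T) * (B\<^sup>2 * K + G\<^sup>2 * (\<Sum>j. (b j)\<^sup>2) + B * G\<^sup>2 * (\<Sum>j. \<bar>b j\<bar>))"
    by simp
qed

text \<open>The covariance form of the coefficients is the integral of fU against the squared modulus of
  their trigonometric polynomial, and bounding fU below by m leaves the Parseval integral.\<close>

lemma filtered_second_moment_ge:
  assumes spec: "\<And>h::int. ((\<lambda>l. fU l * cos (real_of_int h * l)) has_integral \<gamma> h) {-pi..pi}"
    and m: "\<And>l. l \<in> {-pi..pi} \<Longrightarrow> m \<le> fU l" and b2: "summable (\<lambda>j. (b j)\<^sup>2)"
  shows "2 * pi * m * (\<Sum>j. (b j)\<^sup>2) \<le> expectation (\<lambda>\<omega>. (filtered b t \<omega>)\<^sup>2)"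
proof -
  have partial: "2 * pi * m * (\<Sum>j<J. (b j)\<^sup>2) \<le> expectation (\<lambda>\<omega>. partial_filter b J t \<omega> * partial_filter b J t \<omega>)" for J
  proof -
    define Q where "Q l = (\<Sum>j<J. \<Sum>i<J. b j * b i * cos (real_of_int (int i - int j) * l))" for l
    have Q: "Q l = (\<Sum>j<J. b j * cos (real j * l))\<^sup>2 + (\<Sum>j<J. b j * sin (real j * l))\<^sup>2" for l
      unfolding Q_def power2_eq_square sum_product sum.distrib[symmetric]
      by (intro sum.cong refl) (simp add: left_diff_distrib cos_diff algebra_simps)
    have cos_int: "((\<lambda>l. cos (real_of_int h * l)) has_integral (if h = 0 then 2 * pi else 0)) {-pi..pi}" for h :: int
    proof (cases "h = 0")
      case True
      then show ?thesis using has_integral_const_real[of "1::real" "-pi" pi] by simp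
    next
      case False
      have "((\<lambda>l. cos (real_of_int h * l)) has_integral
          (sin (real_of_int h * pi) / real_of_int h - sin (real_of_int h * - pi) / real_of_int h)) {-pi..pi}"
        using False by (intro fundamental_theorem_of_calculus)
          (auto intro!: derivative_eq_intros simp flip: has_real_derivative_iff_has_vector_derivative)
      moreover have "sin (real_of_int h * pi) = 0" by (rule sin_zero_iff_int2[THEN iffD2]) blast
      ultimately show ?thesis using False by simp
    qed
    have I1: "((\<lambda>l. m * Q l) has_integral m * (\<Sum>j<J. \<Sum>i<J. b j * b i * (if int i - int j = 0 then 2 * pi else 0))) {-pi..pi}"
      unfolding Q_def by (intro has_integral_mult_right has_integral_sum cos_int) auto
    have I2: "((\<lambda>l. fU l * Q l) has_integral (\<Sum>j<J. \<Sum>i<J. b j * b i * \<gamma> (int i - int j))) {-pi..pi}"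
    proof -
      have "((\<lambda>l. \<Sum>j<J. \<Sum>i<J. b j * b i * (fU l * cos (real_of_int (int i - int j) * l)))
          has_integral (\<Sum>j<J. \<Sum>i<J. b j * b i * \<gamma> (int i - int j))) {-pi..pi}"
        by (intro has_integral_mult_right has_integral_sum spec) auto
      then show ?thesis by (simp add: Q_def sum_distrib_left mult_ac)
    qed
    have "m * (\<Sum>j<J. \<Sum>i<J. b j * b i * (if int i - int j = 0 then 2 * pi else 0)) \<le> (\<Sum>j<J. \<Sum>i<J. b j * b i * \<gamma> (int i - int j))"
      using m by (intro has_integral_le[OF I1 I2] mult_right_mono) (auto simp: Q)
    moreover have "(\<Sum>i<J. b j * b i * (if int i - int j = 0 then 2 * pi else 0)) = 2 * pi * (b j)\<^sup>2" if "j < J" for j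
    proof -
      have "(\<Sum>i<J. b j * b i * (if int i - int j = 0 then 2 * pi else 0)) = (\<Sum>i<J. if i = j then 2 * pi * (b j)\<^sup>2 else 0)"
        by (intro sum.cong refl) (auto simp: power2_eq_square)
      then show ?thesis using that by simp
    qed
    then have "(\<Sum>j<J. \<Sum>i<J. b j * b i * (if int i - int j = 0 then 2 * pi else 0)) = (\<Sum>j<J. 2 * pi * (b j)\<^sup>2)"
      by (intro sum.cong refl) auto
    ultimately have "m * (\<Sum>j<J. 2 * pi * (b j)\<^sup>2) \<le> (\<Sum>j<J. \<Sum>i<J. b j * b i * \<gamma> (int i - int j))" by simp
    then show ?thesis unfolding partial_filter_cov[OF b]
      by (simp add: sum_distrib_left[symmetric] mult_ac)
  qed
  have "2 * pi * m * (\<Sum>j. (b j)\<^sup>2) \<le> expectation (\<lambda>\<omega>. filtered b t \<omega> * filtered b t \<omega>)"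
    by (rule LIMSEQ_le[OF tendsto_mult[OF tendsto_const summable_LIMSEQ[OF b2]] filtered_cov_tendsto[OF b]])
      (use partial in auto)
  then show ?thesis by (simp add: power2_eq_square)
qed

end
end

subsection \<open>Rate of the Yule--Walker statistics\<close>

text \<open>Outside [-1, 1] the defining description of \<open>arccos\<close> has no witness, and it
  is the same unsatisfiable predicate for all such arguments. So \<open>arccos\<close> is constant
  there, with \<open>arccos 2\<close> as representative, and continuous inside.\<close>

lemma borel_measurable_arccos [measurable]: "(arccos :: real \<Rightarrow> real) \<in> borel_measurable borel"
proof -
  have "arccos y = (if y \<in> {-1..1} then arccos y else arccos 2)" for y :: real
  proof (cases "y \<in> {-1..1}")
    case False
    have no: "\<not> (0 \<le> x \<and> x \<le> pi \<and> cos x = z)" if "z \<notin> {-1..1}" for x z :: real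
      using that cos_le_one[of x] cos_ge_minus_one[of x] by auto
    have "arccos y = arccos 2"
      unfolding arccos_def using no[OF False] no[of 2] by (intro arg_cong[where f = The] ext) auto
    then show ?thesis using False by simp
  qed simp
  then have "arccos = (\<lambda>y::real. if y \<in> {-1..1} then arccos y else arccos 2)" by blast
  also have "\<dots> \<in> borel_measurable borel"
    by (intro borel_measurable_continuous_on_if continuous_on_arccos' continuous_on_const) auto
  finally show ?thesis .
qed

context stationary4
begin

context
  fixes lam0 d :: real
  assumes lam0: "0 < sin lam0" and d: "d \<in> {0<..<1}"
begin

abbreviation "X \<equiv> Xproc lam0 d U"
abbreviation "p \<equiv> 2 * (1 - d) * cos lam0"
abbreviation "q \<equiv> - (1 - d)\<^sup>2"

lemma X_filtered: "X = filtered (bcoef lam0 d)"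
  by (intro ext) (simp add: Xproc_def filtered_def)

lemmas summable_b = summable_abs_bcoef[OF lam0 d]
lemmas summable_b2 = summable_bcoef_sq[OF lam0 d]

lemma X_measurable [measurable]: "X t \<in> borel_measurable M"
  unfolding X_filtered by measurable

lemma L4_X: "L4 (X t)"
  unfolding X_filtered by (rule L4_filtered[OF summable_b])

lemma L2_X: "L2 (X t)"
  by (intro L4_L2 L4_X)

text \<open>The coefficient recurrence, carried over to the absolutely convergent series by
  splitting off leading terms. The exceptional null set is common to all times, because the
  estimator uses many times of one path.\<close>

lemma AE_innovation: "AE \<omega> in M. \<forall>t. U t \<omega> = X t \<omega> - p * X (t - 1) \<omega> + (1 - d)\<^sup>2 * X (t - 2) \<omega>"
proof -
  have "AE \<omega> in M. \<forall>t. summable (\<lambda>j. \<bar>bcoef lam0 d j\<bar> * \<bar>U (t - int j) \<omega>\<bar>)"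
    using AE_summable_abs[OF summable_b] by (simp add: AE_all_countable)
  then show ?thesis
  proof eventually_elim
    case (elim \<omega>)
    show ?case
    proof
      fix t
      define b where "b = bcoef lam0 d"
      have s: "summable (\<lambda>j. b j * U (t - int j) \<omega>)" for t
      proof (rule summable_rabs_cancel)
        show "summable (\<lambda>j. \<bar>b j * U (t - int j) \<omega>\<bar>)" using elim by (simp add: abs_mult b_def)
      qed
      have b: "b 0 = 1" "b (Suc 0) = p" "b (Suc (Suc j)) = p * b (Suc j) - (1 - d)\<^sup>2 * b j" for j
        using bcoef_rec[of lam0 d] lam0 by (auto simp: b_def)
      define Y where "Y t = (\<Sum>j. b j * U (t - int j) \<omega>)" for t
      have Y1: "Y t = U t \<omega> + (\<Sum>j. b (Suc j) * U (t - 1 - int j) \<omega>)" for t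
        using suminf_split_head[OF s[of t]] by (simp add: Y_def b algebra_simps)
      have s1: "summable (\<lambda>j. b (Suc j) * U (t - 1 - int j) \<omega>)" for t
        using s[of t] by (subst (asm) summable_Suc_iff[symmetric]) (simp add: algebra_simps)
      have s2: "summable (\<lambda>j. b (Suc (Suc j)) * U (t - 2 - int j) \<omega>)"
        using s1[of t] by (subst (asm) summable_Suc_iff[symmetric]) (simp add: algebra_simps)
      have "(\<Sum>j. b (Suc j) * U (t - 1 - int j) \<omega>) = p * U (t - 1) \<omega> + (\<Sum>j. b (Suc (Suc j)) * U (t - 2 - int j) \<omega>)"
        using suminf_split_head[OF s1[of t]] by (simp add: b(2) algebra_simps)
      also have "(\<Sum>j. b (Suc (Suc j)) * U (t - 2 - int j) \<omega>)
        = (\<Sum>j. p * (b (Suc j) * U (t - 2 - int j) \<omega>) - (1 - d)\<^sup>2 * (b j * U (t - 2 - int j) \<omega>))"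
        by (simp add: b(3) left_diff_distrib mult.assoc)
      also have "\<dots> = p * (\<Sum>j. b (Suc j) * U (t - 2 - int j) \<omega>) - (1 - d)\<^sup>2 * Y (t - 2)"
        using s1[of "t - 1"] s[of "t - 2"]
        by (subst suminf_diff[symmetric]) (auto simp: Y_def suminf_mult summable_mult)
      finally have "Y t = U t \<omega> + (p * U (t - 1) \<omega> + (p * (\<Sum>j. b (Suc j) * U (t - 2 - int j) \<omega>) - (1 - d)\<^sup>2 * Y (t - 2)))"
        by (simp add: Y1)
      also have "(\<Sum>j. b (Suc j) * U (t - 2 - int j) \<omega>) = Y (t - 1) - U (t - 1) \<omega>"
        using Y1[of "t - 1"] by simp
      finally have "Y t = U t \<omega> + p * Y (t - 1) - (1 - d)\<^sup>2 * Y (t - 2)" by (simp add: right_diff_distrib)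
      then show "U t \<omega> = X t \<omega> - p * X (t - 1) \<omega> + (1 - d)\<^sup>2 * X (t - 2) \<omega>"
        by (simp add: Xproc_def Y_def b_def)
    qed
  qed
qed

lemma acov_X: "acov M X h = expectation (\<lambda>\<omega>. X h \<omega> * X 0 \<omega>)"
  unfolding X_filtered by (rule acov_filtered[OF summable_b])

lemma acov_X_abs: "acov M X \<bar>h\<bar> = acov M X h"
proof (cases "0 \<le> h")
  case False
  have "acov M X (- h) = expectation (\<lambda>\<omega>. X 0 \<omega> * X h \<omega>)"
    unfolding acov_X unfolding X_filtered by (rule filtered_cov_shift[OF summable_b]) simp
  then show ?thesis using False by (simp add: acov_X mult.commute)
qed simp

lemma yw_acov_X: "yw p q (acov M X) k = expectation (\<lambda>\<omega>. U (int k) \<omega> * X 0 \<omega>)"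
proof -
  have i: "integrable M (\<lambda>\<omega>. X s \<omega> * X t \<omega>)" for s t by (intro L2_mult L2_X)
  have "expectation (\<lambda>\<omega>. U (int k) \<omega> * X 0 \<omega>)
    = expectation (\<lambda>\<omega>. X (int k) \<omega> * X 0 \<omega> - p * (X (int k - 1) \<omega> * X 0 \<omega>) - q * (X (int k - 2) \<omega> * X 0 \<omega>))"
  proof (rule integral_cong_AE)
    show "AE \<omega> in M. U (int k) \<omega> * X 0 \<omega>
      = X (int k) \<omega> * X 0 \<omega> - p * (X (int k - 1) \<omega> * X 0 \<omega>) - q * (X (int k - 2) \<omega> * X 0 \<omega>)"
      using AE_innovation
    proof eventually_elim
      case (elim \<omega>)
      show ?case by (subst elim[rule_format]) (simp add: algebra_simps)
    qed
  qed measurable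
  also have "\<dots> = acov M X (int k) - p * acov M X (int k - 1) - q * acov M X (int k - 2)"
    unfolding acov_X using i by (subst Bochner_Integration.integral_diff; simp)+
  finally show ?thesis by (simp add: yw_def acov_X_abs)
qed

lemma yw_acov_X_le: "\<bar>yw p q (acov M X) k\<bar> \<le> G / sin lam0"
  unfolding yw_acov_X unfolding X_filtered
  using cross_cov_le[OF summable_b bcoef_abs_le'[OF lam0 d]] by simp

lemma X_second_moment_le: "expectation (\<lambda>\<omega>. (X t \<omega>)\<^sup>2) \<le> G / ((sin lam0)\<^sup>2 * d)"
proof -
  have "expectation (\<lambda>\<omega>. (X t \<omega>)\<^sup>2) \<le> G * (\<Sum>j. (bcoef lam0 d j)\<^sup>2)"
    unfolding X_filtered by (rule filtered_second_moment_le[OF summable_b summable_b2])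
  also have "\<dots> \<le> G * (1 / ((sin lam0)\<^sup>2 * d))"
    by (intro mult_left_mono suminf_bcoef_sq_le lam0 d G_nonneg)
  finally show ?thesis by simp
qed

definition "cross_sum n k \<omega> = (\<Sum>t=1..n. U (int t) \<omega> * X (int t - int k) \<omega>)"

lemma cross_sum_set: "cross_sum n k = (\<lambda>\<omega>. \<Sum>t\<in>int ` {1..n}. U t \<omega> * filtered (bcoef lam0 d) (t - int k) \<omega>)"
  unfolding cross_sum_def X_filtered by (intro ext) (simp add: sum.reindex)

lemma expectation_cross_sum: "expectation (cross_sum n k) = real n * yw p q (acov M X) k"
proof -
  have "expectation (cross_sum n k) = (\<Sum>t=1..n. expectation (\<lambda>\<omega>. U (int t) \<omega> * X (int t - int k) \<omega>))"
    unfolding cross_sum_def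
    by (intro Bochner_Integration.integral_sum L2_mult L2_U L2_X)
  also have "\<dots> = (\<Sum>t=1..n. yw p q (acov M X) k)"
    unfolding yw_acov_X unfolding X_filtered by (intro sum.cong refl cross_cov_shift[OF summable_b]) simp
  finally show ?thesis by simp
qed

text \<open>Of the three variance terms the cumulant one is bounded and is enlarged by 1/d, giving
  \<open>K\<close>; the two covariance terms are of order 1/d and give 2 G^2. The mean absolute
  deviation is at most the root of the variance.\<close>

lemma cross_sum_L1:
  shows "L2 (cross_sum n k)"
    "expectation (\<lambda>\<omega>. \<bar>cross_sum n k \<omega> - real n * yw p q (acov M X) k\<bar>) \<le> sqrt (real n * ((K + 2 * G\<^sup>2) / ((sin lam0)\<^sup>2 * d)))"
proof -
  note V = cross_variance_le[where T = "int ` {1..n}" and k = "int k", OF summable_b _ bcoef_abs_le'[OF lam0 d] summable_b2,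
      OF finite_imageI[OF finite_atLeastAtMost]]
  show L: "L2 (cross_sum n k)" unfolding cross_sum_set by (rule V(1))
  have c: "card (int ` {1..n}) = n" by (subst card_image) auto
  have "variance (cross_sum n k) \<le> real n * ((1 / sin lam0)\<^sup>2 * K + G\<^sup>2 * (\<Sum>j. (bcoef lam0 d j)\<^sup>2) + 1 / sin lam0 * G\<^sup>2 * (\<Sum>j. \<bar>bcoef lam0 d j\<bar>))"
    unfolding cross_sum_set using V(2) unfolding c .
  also have "\<dots> \<le> real n * (K / ((sin lam0)\<^sup>2 * d) + G\<^sup>2 * (1 / ((sin lam0)\<^sup>2 * d)) + 1 / sin lam0 * G\<^sup>2 * (1 / (sin lam0 * d)))"
  proof (intro mult_left_mono add_mono suminf_bcoef_sq_le suminf_abs_bcoef_le lam0 d)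
    have "(1 / sin lam0)\<^sup>2 * K = K / ((sin lam0)\<^sup>2 * 1)" by (simp add: power_divide)
    also have "\<dots> \<le> K / ((sin lam0)\<^sup>2 * d)"
      using lam0 d K_nonneg by (intro divide_left_mono mult_left_mono) auto
    finally show "(1 / sin lam0)\<^sup>2 * K \<le> K / ((sin lam0)\<^sup>2 * d)" .
  qed (use lam0 in auto)
  also have "\<dots> = real n * ((K + 2 * G\<^sup>2) / ((sin lam0)\<^sup>2 * d))"
    by (simp add: power2_eq_square[of "sin lam0"] add_divide_distrib mult.assoc)
  finally have v: "variance (cross_sum n k) \<le> \<dots>" .
  have "(expectation (\<lambda>\<omega>. \<bar>cross_sum n k \<omega> - real n * yw p q (acov M X) k\<bar>))\<^sup>2 \<le> variance (cross_sum n k)"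
    unfolding expectation_cross_sum by (intro L2_expectation_abs_le L2_diff L L2_const)
  with v show "expectation (\<lambda>\<omega>. \<bar>cross_sum n k \<omega> - real n * yw p q (acov M X) k\<bar>) \<le> sqrt (real n * ((K + 2 * G\<^sup>2) / ((sin lam0)\<^sup>2 * d)))"
    by (intro real_le_rsqrt) linarith
qed

lemma U_sum_sq: 
  assumes "\<bar>e\<bar> = (1::real)"
  shows "L2 (\<lambda>\<omega>. \<Sum>t=1..n. e ^ t * U (int t) \<omega>)" "expectation (\<lambda>\<omega>. (\<Sum>t=1..n. e ^ t * U (int t) \<omega>)\<^sup>2) \<le> real n * G"
proof -
  show "L2 (\<lambda>\<omega>. \<Sum>t=1..n. e ^ t * U (int t) \<omega>)" by (intro L2_sum L2_cmult L2_U)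
  have "(e ^ t)\<^sup>2 = 1" for t
    using assms by (metis power2_abs power_abs power_one)
  then show "expectation (\<lambda>\<omega>. (\<Sum>t=1..n. e ^ t * U (int t) \<omega>)\<^sup>2) \<le> real n * G"
    using linear_second_moment_le[of "{1..n}" int "\<lambda>t. e ^ t"] by (simp add: mult.commute)
qed

lemma gamma_hat_measurable [measurable]: "(\<lambda>\<omega>. gamma_hat n (\<lambda>t. X t \<omega>) h) \<in> borel_measurable M"
  unfolding gamma_hat_def periodogram_def by measurable

text \<open>The six squares in \<open>bdry\<close> turn 1044 into 6264, and the plain and
  alternating sums of the innovations turn 8 into 16. Since n d >= 1 and d < 1, the resulting orders
  1 / (n d) and 1/n are both absorbed by 1 / sqrt (n d).\<close>

lemma yw_gamma_hat_L1:
  assumes n: "2 < n" "1 \<le> real n * d" and k: "k \<le> 2"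
  defines "D \<equiv> \<lambda>\<omega>. \<bar>yw p q (gamma_hat n (\<lambda>t. X t \<omega>)) k - yw p q (acov M X) k\<bar>"
  shows "integrable M D" "expectation D
    \<le> (sqrt ((K + 2 * G\<^sup>2) / (sin lam0)\<^sup>2) + 6264 * G / (sin lam0)^6 + 16 * G / (sin lam0)^4) / sqrt (real n * d)"
proof -
  define s where "s = sin lam0"
  define A where "A \<omega> = \<bar>cross_sum n k \<omega> - real n * yw p q (acov M X) k\<bar>" for \<omega>
  define Q where "Q \<omega> = bdry n (\<lambda>t. X t \<omega>)" for \<omega>
  define V1 V2 where "V1 = (\<lambda>\<omega>. (\<Sum>t=1..n. U (int t) \<omega>)\<^sup>2)" and "V2 = (\<lambda>\<omega>. (\<Sum>t=1..n. (-1) ^ t * U (int t) \<omega>)\<^sup>2)"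
  define R where "R \<omega> = 1 / real n * A \<omega> + 1044 / s^4 / real n * Q \<omega> + 8 / s^4 / (real n)\<^sup>2 * (V1 \<omega> + V2 \<omega>)" for \<omega>
  have s: "0 < s" using lam0 by (simp add: s_def)
  have sq: "integrable M (\<lambda>\<omega>. (X t \<omega>)\<^sup>2)" for t using L2_X by (simp add: L2_def)
  have Ai: "integrable M A" unfolding A_def
    by (intro integrable_abs L2_integrable L2_diff cross_sum_L1(1) L2_const)
  have Qi: "integrable M Q" unfolding Q_def bdry_def by (intro Bochner_Integration.integrable_add sq)
  have Vi: "integrable M V1" "integrable M V2"
    using U_sum_sq(1)[of 1 n] U_sum_sq(1)[of "-1" n] by (simp_all add: L2_def V1_def V2_def)
  have Ri: "integrable M R" unfolding R_def by (intro Bochner_Integration.integrable_add integrable_mult_right Ai Qi Vi)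
  have Dm: "D \<in> borel_measurable M" unfolding D_def yw_def by measurable
  have D0: "0 \<le> D \<omega>" for \<omega> by (simp add: D_def)
  have DR: "AE \<omega> in M. D \<omega> \<le> R \<omega>"
    using AE_innovation
  proof eventually_elim
    case (elim \<omega>)
    have 1: "\<bar>yw p q (gamma_hat n (\<lambda>t. X t \<omega>)) k - cross_sum n k \<omega> / real n\<bar>
      \<le> 1044 / s^4 * Q \<omega> / real n + 8 / s^4 * (V1 \<omega> + V2 \<omega>) / (real n)\<^sup>2"
      unfolding cross_sum_def s_def Q_def V1_def V2_def
      using n(1) d k lam0 elim by (intro yw_gamma_hat) auto
    have "\<bar>cross_sum n k \<omega> / real n - yw p q (acov M X) k\<bar> = A \<omega> / real n"
    proof -
      have "cross_sum n k \<omega> / real n - yw p q (acov M X) k = (cross_sum n k \<omega> - real n * yw p q (acov M X) k) / real n"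
        using n by (simp add: diff_divide_distrib)
      then show ?thesis by (simp add: A_def abs_divide)
    qed
    with 1 show "D \<omega> \<le> R \<omega>" unfolding D_def R_def by simp
  qed
  show "integrable M D"
    by (rule Bochner_Integration.integrable_bound[OF Ri Dm]) (use DR D0 in \<open>auto elim!: eventually_mono\<close>)
  then have "expectation D \<le> expectation R" using Ri DR by (rule integral_mono_AE)
  also have "expectation R = 1 / real n * expectation A + 1044 / s^4 / real n * expectation Q
      + 8 / s^4 / (real n)\<^sup>2 * (expectation V1 + expectation V2)"
    unfolding R_def using Ai Qi Vi by simp
  also have "\<dots> \<le> 1 / real n * sqrt (real n * ((K + 2 * G\<^sup>2) / (s\<^sup>2 * d))) + 1044 / s^4 / real n * (6 * (G / (s\<^sup>2 * d)))
      + 8 / s^4 / (real n)\<^sup>2 * (real n * G + real n * G)"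
  proof (intro add_mono mult_left_mono)
    show "expectation A \<le> sqrt (real n * ((K + 2 * G\<^sup>2) / (s\<^sup>2 * d)))"
      unfolding A_def s_def by (rule cross_sum_L1(2))
    have "expectation Q = expectation (\<lambda>\<omega>. (X (- 1) \<omega>)\<^sup>2) + expectation (\<lambda>\<omega>. (X 0 \<omega>)\<^sup>2) + expectation (\<lambda>\<omega>. (X 1 \<omega>)\<^sup>2)
      + expectation (\<lambda>\<omega>. (X 2 \<omega>)\<^sup>2) + expectation (\<lambda>\<omega>. (X (int n - 1) \<omega>)\<^sup>2) + expectation (\<lambda>\<omega>. (X (int n) \<omega>)\<^sup>2)"
      unfolding Q_def bdry_def using sq by simp
    also have "\<dots> \<le> G / (s\<^sup>2 * d) + G / (s\<^sup>2 * d) + G / (s\<^sup>2 * d) + G / (s\<^sup>2 * d) + G / (s\<^sup>2 * d) + G / (s\<^sup>2 * d)"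
      unfolding s_def by (intro add_mono X_second_moment_le)
    finally show "expectation Q \<le> 6 * (G / (s\<^sup>2 * d))" by linarith
    show "expectation V1 \<le> real n * G" "expectation V2 \<le> real n * G"
      using U_sum_sq(2)[of 1 n] U_sum_sq(2)[of "-1" n] by (simp_all add: V1_def V2_def)
  qed (use s in auto)
  also have "\<dots> = sqrt ((K + 2 * G\<^sup>2) / s\<^sup>2) / sqrt (real n * d) + 6264 * G / s^6 / (real n * d) + 16 * G / s^4 / real n"
  proof -
    have nn: "0 < real n" using n by simp
    have "1 / real n * sqrt (real n * ((K + 2 * G\<^sup>2) / (s\<^sup>2 * d))) = sqrt ((K + 2 * G\<^sup>2) / s\<^sup>2) / sqrt (real n * d)"
    proof -
      have "1 / real n * sqrt (real n * ((K + 2 * G\<^sup>2) / (s\<^sup>2 * d))) = sqrt (real n * ((K + 2 * G\<^sup>2) / (s\<^sup>2 * d)) / (real n)\<^sup>2)"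
        by (subst real_sqrt_divide[of _ "(real n)\<^sup>2"]) simp
      also have "real n * ((K + 2 * G\<^sup>2) / (s\<^sup>2 * d)) / (real n)\<^sup>2 = (K + 2 * G\<^sup>2) / s\<^sup>2 / (real n * d)"
        using nn by (simp add: power2_eq_square)
      finally show ?thesis by (simp only: real_sqrt_divide)
    qed
    moreover have "1044 / s^4 / real n * (6 * (G / (s\<^sup>2 * d))) = 6264 * G / s^6 / (real n * d)"
      by (simp add: mult.assoc mult.left_commute[of _ "real n"] flip: power_add)
    moreover have "8 / s^4 / (real n)\<^sup>2 * (real n * G + real n * G) = 16 * G / s^4 / real n"
      using nn by (simp add: power2_eq_square)
    ultimately show ?thesis by simp
  qed
  also have "\<dots> \<le> sqrt ((K + 2 * G\<^sup>2) / s\<^sup>2) / sqrt (real n * d) + 6264 * G / s^6 / sqrt (real n * d) + 16 * G / s^4 / sqrt (real n * d)"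
  proof -
    have nd: "0 < real n * d" using n by linarith
    have a: "sqrt (real n * d) \<le> real n * d"
    proof -
      have "sqrt (real n * d) * 1 \<le> sqrt (real n * d) * sqrt (real n * d)"
        using n by (intro mult_left_mono) auto
      then show ?thesis using nd by simp
    qed
    have b: "real n * d \<le> real n * 1" using d by (intro mult_left_mono) auto
    have "6264 * G / s^6 / (real n * d) \<le> 6264 * G / s^6 / sqrt (real n * d)"
      using a nd G_nonneg s d n(1) by (intro divide_left_mono mult_pos_pos) auto
    moreover have "16 * G / s^4 / real n \<le> 16 * G / s^4 / sqrt (real n * d)"
      using order_trans[OF a b] nd G_nonneg s d n(1) by (intro divide_left_mono mult_pos_pos) auto
    ultimately show ?thesis by simp
  qed
  finally show "expectation D \<le> (sqrt ((K + 2 * G\<^sup>2) / (sin lam0)\<^sup>2) + 6264 * G / (sin lam0)^6 + 16 * G / (sin lam0)^4) / sqrt (real n * d)"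
    by (simp add: s_def add_divide_distrib)
qed

end
end

text \<open>The left side is sqrt (d / n), and \<open>d\<close> is at most of order
  n^(-\<alpha>).\<close>

lemma powr_rate:
  fixes n :: nat and c \<alpha> d :: real
  assumes "0 < n" "0 \<le> d" "d \<le> c * real n powr (- \<alpha>)" "0 \<le> c"
  shows "d * (1 / sqrt (real n * d)) \<le> sqrt c * real n powr (- (1 + \<alpha>) / 2)"
proof -
  have "d * (1 / sqrt (real n * d)) = sqrt d / sqrt (real n)"
    using assms by (cases "d = 0") (auto simp: real_sqrt_mult field_simps)
  also have "\<dots> \<le> sqrt (c * real n powr (- \<alpha>)) / sqrt (real n)"
    using assms by (intro divide_right_mono) auto
  also have "\<dots> = sqrt c * (real n powr (- \<alpha> / 2) * real n powr (- 1 / 2))"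
  proof -
    have "sqrt (real n powr (- \<alpha>)) = real n powr (- \<alpha> / 2)"
      by (simp only: powr_half_sqrt[symmetric] powr_ge_zero powr_powr) simp
    moreover have "1 / sqrt (real n) = real n powr (- 1 / 2)"
      using powr_minus_divide[of "real n" "1/2"] by (simp add: powr_half_sqrt)
    ultimately show ?thesis by (metis real_sqrt_mult times_divide_eq_right mult.right_neutral mult.assoc)
  qed
  also have "real n powr (- \<alpha> / 2) * real n powr (- 1 / 2) = real n powr (- (1 + \<alpha>) / 2)"
  proof -
    have "- \<alpha> / 2 + - 1 / 2 = - (1 + \<alpha>) / 2" by (simp add: field_simps)
    then show ?thesis by (simp only: powr_add[symmetric])
  qed
  finally show ?thesis .
qed

context stationary4
begin

text \<open>It suffices to bound the estimation errors on the event that the three Yule--Walker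
  statistics deviate by at most a constant times the reciprocal root of n d, which by Markov has
  probability close to 1.\<close>

lemma bigOP_on_transfer:
  fixes \<delta> r :: "nat \<Rightarrow> real" and Y :: "nat \<Rightarrow> 'a \<Rightarrow> real" and E :: "nat \<Rightarrow> 'a set"
  assumes lam0: "0 < sin lam0" and \<delta>: "\<And>n. \<delta> n \<in> {0<..<1}"
    and inf: "filterlim (\<lambda>n. real n * \<delta> n) at_top sequentially"
    and D: "0 < D" and c: "0 < c" and \<eta>0: "0 < \<eta>0"
    and r: "\<forall>\<^sub>F n in sequentially. \<delta> n * (1 / sqrt (real n * \<delta> n)) \<le> c * r n"
    and meas: "\<And>n. Y n \<in> borel_measurable M" "\<And>n. {\<omega> \<in> space M. \<omega> \<in> E n} \<in> sets M"
    and stable: "\<forall>\<^sub>F n in sequentially. \<forall>\<omega>\<in>space M. \<forall>\<eta>. 0 \<le> \<eta> \<longrightarrow> \<eta> \<le> \<eta>0 \<longrightarrow>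
      (\<forall>k\<le>2. \<bar>yw (2 * (1 - \<delta> n) * cos lam0) (- (1 - \<delta> n)\<^sup>2) (gamma_hat n (\<lambda>t. Xproc lam0 (\<delta> n) U t \<omega>)) k
        - yw (2 * (1 - \<delta> n) * cos lam0) (- (1 - \<delta> n)\<^sup>2) (acov M (Xproc lam0 (\<delta> n) U)) k\<bar> \<le> \<eta>) \<longrightarrow>
      \<omega> \<in> E n \<and> \<bar>Y n \<omega>\<bar> \<le> D * (\<delta> n * \<eta>)"
  shows "bigOP_on M E Y r"
  unfolding bigOP_on_def
proof (intro allI impI)
  fix \<epsilon> :: real assume \<epsilon>: "0 < \<epsilon>"
  define C where "C = sqrt ((K + 2 * G\<^sup>2) / (sin lam0)\<^sup>2) + 6264 * G / (sin lam0)^6 + 16 * G / (sin lam0)^4"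
  have C: "0 \<le> C" using K_nonneg G_nonneg lam0 by (simp add: C_def)
  \<comment> \<open>Chosen so that Markov's bound 3 C / L is at most \<open>\<epsilon>\<close>; the
    added 1 keeps \<open>L\<close> positive when \<open>C\<close> vanishes.\<close>
  define L where "L = (3 * C + 1) / \<epsilon>"
  have L: "0 < L" using C \<epsilon> by (simp add: L_def add_nonneg_pos)
  have e1: "\<forall>\<^sub>F n in sequentially. 1 \<le> real n * \<delta> n" "\<forall>\<^sub>F n in sequentially. (L / \<eta>0)\<^sup>2 \<le> real n * \<delta> n"
    using inf by (auto simp: filterlim_at_top)
  have "\<forall>\<^sub>F n in sequentially.
    1 - \<epsilon> \<le> prob {\<omega> \<in> space M. \<omega> \<in> E n \<and> \<bar>Y n \<omega>\<bar> \<le> D * L * c * r n}"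
    using e1 r stable eventually_gt_at_top[of "2::nat"]
  proof eventually_elim
    case (elim n)
    define T where "T k \<omega> = \<bar>yw (2 * (1 - \<delta> n) * cos lam0) (- (1 - \<delta> n)\<^sup>2) (gamma_hat n (\<lambda>t. Xproc lam0 (\<delta> n) U t \<omega>)) k
        - yw (2 * (1 - \<delta> n) * cos lam0) (- (1 - \<delta> n)\<^sup>2) (acov M (Xproc lam0 (\<delta> n) U)) k\<bar>" for k \<omega>
    \<comment> \<open>One application of Markov's inequality to the sum controls all three
      deviations on a single event.\<close>
    define S where "S \<omega> = (\<Sum>k\<le>2. T k \<omega>)" for \<omega>
    define \<eta> where "\<eta> = L / sqrt (real n * \<delta> n)"
    have nd: "0 < real n * \<delta> n" using elim by linarith
    have \<eta>: "0 < \<eta>" using L nd by (simp add: \<eta>_def)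
    have \<eta>le: "\<eta> \<le> \<eta>0"
    proof -
      have "L / \<eta>0 \<le> sqrt (real n * \<delta> n)" using elim(2) by (rule real_le_rsqrt)
      then show ?thesis using nd \<eta>0 by (simp add: \<eta>_def field_simps)
    qed
    note T1 = yw_gamma_hat_L1[OF lam0 \<delta> elim(5,1)]
    have Ti: "integrable M (T k)" and Te: "expectation (T k) \<le> C / sqrt (real n * \<delta> n)" if "k \<le> 2" for k
      using T1[OF that] unfolding T_def[abs_def] C_def by auto
    have T0: "0 \<le> T k \<omega>" for k \<omega> by (simp add: T_def)
    have Si: "integrable M S" unfolding S_def by (intro Bochner_Integration.integrable_sum Ti) auto
    have "expectation S = (\<Sum>k\<le>2. expectation (T k))"
      unfolding S_def by (intro Bochner_Integration.integral_sum Ti) auto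
    also have "\<dots> \<le> (\<Sum>k\<le>(2::nat). C / sqrt (real n * \<delta> n))" by (intro sum_mono Te) auto
    finally have Se: "expectation S \<le> 3 * C / sqrt (real n * \<delta> n)" by simp
    have "prob {\<omega> \<in> space M. \<eta> \<le> S \<omega>} \<le> expectation S / \<eta>"
    proof (rule integral_Markov_inequality_measure[OF Si sets.top _ \<eta>])
      show "AE \<omega> in M. 0 \<le> S \<omega>" unfolding S_def by (intro AE_I2 sum_nonneg T0)
    qed
    also have "\<dots> \<le> 3 * C / sqrt (real n * \<delta> n) / \<eta>"
      using Se \<eta> by (intro divide_right_mono) auto
    also have "\<dots> = 3 * C / L"
    proof -
      have "3 * C / w / (L / w) = 3 * C / L" if "0 < w" for w using that by simp
      then show ?thesis using nd unfolding \<eta>_def by (simp only: real_sqrt_gt_0_iff)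
    qed
    also have "\<dots> \<le> \<epsilon>" using C \<epsilon> by (simp add: L_def field_simps)
    finally have small: "prob {\<omega> \<in> space M. \<eta> \<le> S \<omega>} \<le> \<epsilon>" .
    have [measurable]: "S \<in> borel_measurable M" using Si by blast
    have [measurable]: "Y n \<in> borel_measurable M" by (rule meas)
    have sub: "space M - {\<omega> \<in> space M. \<eta> \<le> S \<omega>} \<subseteq> {\<omega> \<in> space M. \<omega> \<in> E n \<and> \<bar>Y n \<omega>\<bar> \<le> D * L * c * r n}"
    proof
      fix \<omega> assume "\<omega> \<in> space M - {\<omega> \<in> space M. \<eta> \<le> S \<omega>}"
      then have \<omega>: "\<omega> \<in> space M" "S \<omega> \<le> \<eta>" by auto
      have "T k \<omega> \<le> \<eta>" if "k \<le> 2" for k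
      proof -
        have "T k \<omega> \<le> S \<omega>" unfolding S_def using that T0 by (intro member_le_sum) auto
        with \<omega>(2) show ?thesis by linarith
      qed
      then have *: "\<omega> \<in> E n \<and> \<bar>Y n \<omega>\<bar> \<le> D * (\<delta> n * \<eta>)"
        using elim(4)[rule_format, OF \<omega>(1), of \<eta>] \<eta> \<eta>le unfolding T_def by auto
      have "D * (\<delta> n * \<eta>) = D * L * (\<delta> n * (1 / sqrt (real n * \<delta> n)))" by (simp add: \<eta>_def)
      also have "\<dots> \<le> D * L * (c * r n)" using elim(3) D L by (intro mult_left_mono) auto
      finally show "\<omega> \<in> {\<omega> \<in> space M. \<omega> \<in> E n \<and> \<bar>Y n \<omega>\<bar> \<le> D * L * c * r n}"
        using * \<omega>(1) by (simp add: mult.assoc)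
    qed
    have "1 - \<epsilon> \<le> 1 - prob {\<omega> \<in> space M. \<eta> \<le> S \<omega>}" using small by simp
    also have "\<dots> = prob (space M - {\<omega> \<in> space M. \<eta> \<le> S \<omega>})" by (rule prob_compl[symmetric]) measurable
    also have "\<dots> \<le> prob {\<omega> \<in> space M. \<omega> \<in> E n \<and> \<bar>Y n \<omega>\<bar> \<le> D * L * c * r n}"
    proof (rule finite_measure_mono[OF sub])
      have "{\<omega> \<in> space M. \<omega> \<in> E n \<and> \<bar>Y n \<omega>\<bar> \<le> D * L * c * r n}
        = {\<omega> \<in> space M. \<omega> \<in> E n} \<inter> {\<omega> \<in> space M. \<bar>Y n \<omega>\<bar> \<le> D * L * c * r n}" by auto
      also have "\<dots> \<in> sets M" by (intro sets.Int meas) measurable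
      finally show "{\<omega> \<in> space M. \<omega> \<in> E n \<and> \<bar>Y n \<omega>\<bar> \<le> D * L * c * r n} \<in> sets M" .
    qed
    finally show ?case .
  qed
  then obtain N where "\<forall>n\<ge>N. 1 - \<epsilon> \<le> prob {\<omega> \<in> space M. \<omega> \<in> E n \<and> \<bar>Y n \<omega>\<bar> \<le> D * L * c * r n}"
    by (auto simp: eventually_sequentially)
  then show "\<exists>K>0. \<exists>N. \<forall>n\<ge>N. 1 - \<epsilon> \<le> prob {\<omega> \<in> space M. \<omega> \<in> E n \<and> \<bar>Y n \<omega>\<bar> \<le> K * r n}"
    using D L c by (intro exI[of _ "D * L * c"] conjI exI[of _ N]) auto
qed

end

text \<open>The weight is at least 1 away from 0, and the single term at 0 is added back.\<close>

lemma summable_on_drop_weight: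
  fixes f :: "int \<Rightarrow> real"
  assumes "(\<lambda>h. \<bar>real_of_int h\<bar> * \<bar>f h\<bar>) summable_on UNIV"
  shows "(\<lambda>h. \<bar>f h\<bar>) summable_on UNIV"
proof -
  have "(\<lambda>h. \<bar>f h\<bar>) summable_on (UNIV - {0})"
  proof (rule summable_on_comparison_test)
    show "(\<lambda>h. \<bar>real_of_int h\<bar> * \<bar>f h\<bar>) summable_on (UNIV - {0})"
      by (rule summable_on_subset_banach[OF assms]) simp
    fix h :: int assume "h \<in> UNIV - {0}"
    then have "1 \<le> \<bar>real_of_int h\<bar>" by (cases "0 < h") auto
    then show "\<bar>f h\<bar> \<le> \<bar>real_of_int h\<bar> * \<bar>f h\<bar>" using mult_right_mono[of 1 _ "\<bar>f h\<bar>"] by simp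
  qed simp
  then have "(\<lambda>h. \<bar>f h\<bar>) summable_on ((UNIV - {0}) \<union> {0})"
    by (intro summable_on_Un_disjoint) auto
  then show ?thesis by (simp add: Un_absorb2)
qed

theorem theorem1:
  fixes M :: "'a measure" and U :: "int \<Rightarrow> 'a \<Rightarrow> real"
    and fU :: "real \<Rightarrow> real" and lam0 \<alpha> :: real and \<delta> :: "nat \<Rightarrow> real"
  assumes "prob_space M"
    and "lam0 \<in> {0<..<pi}"
    and meas: "\<And>t. U t \<in> borel_measurable M"
    and fourth: "\<And>t. integrable M (\<lambda>\<omega>. (U t \<omega>)^4)"
    and mean0: "\<And>t. (LINT \<omega>|M. U t \<omega>) = 0"
    and stat2: "\<And>t h. (LINT \<omega>|M. U (t + h) \<omega> * U t \<omega>) = (LINT \<omega>|M. U h \<omega> * U 0 \<omega>)"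
    and stat4: "\<And>t h1 h2 h3. cum4 M (U t) (U (t + h1)) (U (t + h2)) (U (t + h3))
                             = cum4 M (U 0) (U h1) (U h2) (U h3)"
    and spec: "\<And>h::int. ((\<lambda>l. fU l * cos (real_of_int h * l)) has_integral acov M U h) {-pi..pi}"
    and even: "\<And>l. fU (- l) = fU l"
    and cont: "continuous_on {0..pi} fU"
    and pos: "(INF l\<in>{0..pi}. fU l) > 0"
    and sum2: "(\<lambda>h::int. \<bar>real_of_int h\<bar> * \<bar>acov M U h\<bar>) summable_on UNIV"
    and sum4: "(\<lambda>(h1::int, h2::int, h3::int).
                 (1 + \<bar>real_of_int h1\<bar> + \<bar>real_of_int h2\<bar> + \<bar>real_of_int h3\<bar>)
                 * \<bar>cum4 M (U 0) (U h1) (U h2) (U h3)\<bar>) summable_on UNIV"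
    and "\<alpha> \<in> {0<..<1/3}"
    and "\<And>n. \<delta> n \<in> {0<..<1}"
    and "\<exists>c1>0. \<exists>c2>0. \<forall>\<^sub>F n in sequentially.
           c1 * real n powr (- \<alpha>) \<le> \<delta> n \<and> \<delta> n \<le> c2 * real n powr (- \<alpha>)"
  shows
    "bigOP M (\<lambda>n \<omega>. ar2_a1 (rho_hat n (\<lambda>t. Xproc lam0 (\<delta> n) U t \<omega>))
                      - ar2_a1 (acor M (Xproc lam0 (\<delta> n) U)))
             (\<lambda>n. real n powr (- (1 + \<alpha>) / 2))
   \<and> bigOP M (\<lambda>n \<omega>. ar2_a2 (rho_hat n (\<lambda>t. Xproc lam0 (\<delta> n) U t \<omega>))
                      - ar2_a2 (acor M (Xproc lam0 (\<delta> n) U)))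
             (\<lambda>n. real n powr (- (1 + \<alpha>) / 2))
   \<and> bigOP_on M (\<lambda>n. {\<omega>. ar2_a2 (rho_hat n (\<lambda>t. Xproc lam0 (\<delta> n) U t \<omega>)) < 0})
             (\<lambda>n \<omega>. peak_freq (rho_hat n (\<lambda>t. Xproc lam0 (\<delta> n) U t \<omega>))
                      - peak_freq (acor M (Xproc lam0 (\<delta> n) U)))
             (\<lambda>n. real n powr (- (1 + \<alpha>) / 2))"
proof -
  interpret prob_space M by fact
  interpret stationary4 M U
  proof
    show "U t \<in> borel_measurable M" for t by (rule meas)
    show "integrable M (\<lambda>\<omega>. (U t \<omega>)^4)" for t by (rule fourth)
    show "(LINT \<omega>|M. U t \<omega>) = 0" for t by (rule mean0)
    show "(LINT \<omega>|M. U (t + h) \<omega> * U t \<omega>) = (LINT \<omega>|M. U h \<omega> * U 0 \<omega>)" for t h by (rule stat2)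
    show "cum4 M (U t) (U (t + h1)) (U (t + h2)) (U (t + h3)) = cum4 M (U 0) (U h1) (U h2) (U h3)"
      for t h1 h2 h3 by (rule stat4)
    show "(\<lambda>h. \<bar>acov M U h\<bar>) summable_on UNIV" by (rule summable_on_drop_weight[OF sum2])
    show "(\<lambda>(h1, h2, h3). \<bar>cum4 M (U 0) (U h1) (U h2) (U h3)\<bar>) summable_on UNIV"
    proof (rule summable_on_comparison_test[OF sum4])
      show "(case h of (h1, h2, h3) \<Rightarrow> \<bar>cum4 M (U 0) (U h1) (U h2) (U h3)\<bar>)
        \<le> (case h of (h1, h2, h3) \<Rightarrow> (1 + \<bar>real_of_int h1\<bar> + \<bar>real_of_int h2\<bar> + \<bar>real_of_int h3\<bar>)
           * \<bar>cum4 M (U 0) (U h1) (U h2) (U h3)\<bar>)" for h :: "int \<times> int \<times> int"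
        using mult_right_mono[of 1 "1 + \<bar>real_of_int (fst h)\<bar> + \<bar>real_of_int (fst (snd h))\<bar> + \<bar>real_of_int (snd (snd h))\<bar>"
            "\<bar>cum4 M (U 0) (U (fst h)) (U (fst (snd h))) (U (snd (snd h)))\<bar>"]
        by (simp add: case_prod_unfold)
    qed auto
  qed
  have lam0: "0 < sin lam0" using assms(2) by (intro sin_gt_zero) auto
  define m where "m = (INF l\<in>{0..pi}. fU l)"
  have m: "0 < m" using pos by (simp add: m_def)
  have fU: "m \<le> fU l" if "l \<in> {-pi..pi}" for l
  proof -
    \<comment> \<open>The infimum is a lower bound of the values only for a set bounded below;
      continuity on the compact interval supplies this.\<close>
    have bdd: "bdd_below (fU ` {0..pi})"
      using cont by (intro bounded_imp_bdd_below compact_imp_bounded compact_continuous_image) auto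
    have "m \<le> fU \<bar>l\<bar>" unfolding m_def using that by (intro cINF_lower[OF bdd]) auto
    then show ?thesis using even[of l] by (cases "0 \<le> l") auto
  qed
  obtain c1 c2 where c: "0 < c1" "0 < c2" and \<delta>c: "\<forall>\<^sub>F n in sequentially.
      c1 * real n powr (- \<alpha>) \<le> \<delta> n \<and> \<delta> n \<le> c2 * real n powr (- \<alpha>)"
    using assms(16) by blast
  have \<delta>: "\<delta> n \<in> {0<..<1}" for n by fact
  have \<alpha>: "0 < \<alpha>" "\<alpha> < 1" using assms(14) by auto
  \<comment> \<open>The constant 2 pi m / 32 combines the spectral lower bound 2 pi m times the
    square sum of the coefficients with the lower bound 1 / (32 d) of that sum. The bound G / sin
    lam0 on the Yule-Walker values comes from \<open>yw_acov_X_le\<close>.\<close>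
  obtain D d0 \<eta>0 where D: "0 < D" "0 < d0" "0 < \<eta>0" and st: "\<And>d \<eta> g g'. 0 < d \<Longrightarrow> d \<le> d0 \<Longrightarrow> 0 \<le> \<eta> \<Longrightarrow> \<eta> \<le> \<eta>0 \<Longrightarrow>
    2 * pi * m / 32 \<le> d * g 0 \<Longrightarrow>
    (\<forall>k\<le>2. \<bar>yw (2 * (1 - d) * cos lam0) (- (1 - d)\<^sup>2) g k\<bar> \<le> G / sin lam0) \<Longrightarrow>
    (\<forall>k\<le>2. \<bar>yw (2 * (1 - d) * cos lam0) (- (1 - d)\<^sup>2) g' k - yw (2 * (1 - d) * cos lam0) (- (1 - d)\<^sup>2) g k\<bar> \<le> \<eta>) \<Longrightarrow>
    \<bar>ar2_a1 (\<lambda>h. g' h / g' 0) - ar2_a1 (\<lambda>h. g h / g 0)\<bar> \<le> D * (d * \<eta>) \<and>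
    \<bar>ar2_a2 (\<lambda>h. g' h / g' 0) - ar2_a2 (\<lambda>h. g h / g 0)\<bar> \<le> D * (d * \<eta>) \<and>
    ar2_a2 (\<lambda>h. g' h / g' 0) < 0 \<and>
    \<bar>peak_freq (\<lambda>h. g' h / g' 0) - peak_freq (\<lambda>h. g h / g 0)\<bar> \<le> D * (d * \<eta>)"
    using ar2_stability[OF lam0, of "2 * pi * m / 32" "G / sin lam0"] m G_nonneg lam0 by auto
  have lim0: "\<delta> \<longlonglongrightarrow> 0"
  proof (rule tendsto_sandwich[OF _ _ tendsto_const])
    show "\<forall>\<^sub>F n in sequentially. 0 \<le> \<delta> n" using \<delta> by (auto intro!: always_eventually less_imp_le)
    show "\<forall>\<^sub>F n in sequentially. \<delta> n \<le> c2 * real n powr (- \<alpha>)" using \<delta>c by eventually_elim simp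
    show "(\<lambda>n. c2 * real n powr (- \<alpha>)) \<longlonglongrightarrow> 0" using \<alpha> by real_asymp
  qed
  have inf: "filterlim (\<lambda>n. real n * \<delta> n) at_top sequentially"
  proof (rule filterlim_at_top_mono)
    show "filterlim (\<lambda>n. real n * (c1 * real n powr (- \<alpha>))) at_top sequentially"
      using \<alpha> c by real_asymp
    show "\<forall>\<^sub>F n in sequentially. real n * (c1 * real n powr (- \<alpha>)) \<le> real n * \<delta> n"
      using \<delta>c by eventually_elim (intro mult_left_mono, auto)
  qed
  have rate: "\<forall>\<^sub>F n in sequentially. \<delta> n * (1 / sqrt (real n * \<delta> n)) \<le> sqrt c2 * real n powr (- (1 + \<alpha>) / 2)"
    using \<delta>c eventually_gt_at_top[of 0]
  proof eventually_elim
    case (elim n)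
    then show ?case using \<delta>[of n] c by (intro powr_rate) auto
  qed
  define g where "g n = acov M (Xproc lam0 (\<delta> n) U)" for n
  define g' where "g' n \<omega> = gamma_hat n (\<lambda>t. Xproc lam0 (\<delta> n) U t \<omega>)" for n \<omega>
  have rho: "rho_hat n (\<lambda>t. Xproc lam0 (\<delta> n) U t \<omega>) = (\<lambda>h. g' n \<omega> h / g' n \<omega> 0)"
    "acor M (Xproc lam0 (\<delta> n) U) = (\<lambda>h. g n h / g n 0)" for n \<omega>
    by (auto simp: rho_hat_def acor_def g_def g'_def)
  \<comment> \<open>The threshold 1/2 is the range of \<open>suminf_bcoef_sq_ge\<close>, and
    \<open>d0\<close> that of the stability result.\<close>
  have small: "\<forall>\<^sub>F n in sequentially. \<delta> n < min d0 (1/2)"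
    using lim0 D by (intro order_tendstoD) auto
  define P where "P = (\<lambda>d (\<eta>::real) (g :: int \<Rightarrow> real) (g' :: int \<Rightarrow> real). \<forall>k\<le>2.
    \<bar>yw (2 * (1 - d) * cos lam0) (- (1 - d)\<^sup>2) g' k - yw (2 * (1 - d) * cos lam0) (- (1 - d)\<^sup>2) g k\<bar> \<le> \<eta>)"
  have st': "\<forall>\<^sub>F n in sequentially. \<forall>\<omega> \<eta>. 0 \<le> \<eta> \<longrightarrow> \<eta> \<le> \<eta>0 \<longrightarrow> P (\<delta> n) \<eta> (g n) (g' n \<omega>) \<longrightarrow>
    \<bar>ar2_a1 (\<lambda>h. g' n \<omega> h / g' n \<omega> 0) - ar2_a1 (\<lambda>h. g n h / g n 0)\<bar> \<le> D * (\<delta> n * \<eta>) \<and>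
    \<bar>ar2_a2 (\<lambda>h. g' n \<omega> h / g' n \<omega> 0) - ar2_a2 (\<lambda>h. g n h / g n 0)\<bar> \<le> D * (\<delta> n * \<eta>) \<and>
    ar2_a2 (\<lambda>h. g' n \<omega> h / g' n \<omega> 0) < 0 \<and>
    \<bar>peak_freq (\<lambda>h. g' n \<omega> h / g' n \<omega> 0) - peak_freq (\<lambda>h. g n h / g n 0)\<bar> \<le> D * (\<delta> n * \<eta>)"
    using small
  proof eventually_elim
    case (elim n)
    have d: "0 < \<delta> n" "\<delta> n \<le> d0" "\<delta> n \<in> {0<..1/2}" using \<delta>[of n] elim by auto
    have "2 * pi * m * (\<Sum>j. (bcoef lam0 (\<delta> n) j)\<^sup>2) \<le> g n 0"
      using filtered_second_moment_ge[OF summable_b[OF lam0 \<delta>] spec fU summable_b2[OF lam0 \<delta>]]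
      unfolding g_def acov_X[OF lam0 \<delta>] by (simp add: X_filtered[OF lam0 \<delta>] power2_eq_square)
    moreover have "2 * pi * m * (1 / (32 * \<delta> n)) \<le> 2 * pi * m * (\<Sum>j. (bcoef lam0 (\<delta> n) j)\<^sup>2)"
      using m by (intro mult_left_mono suminf_bcoef_sq_ge lam0 d) auto
    ultimately have "2 * pi * m * (1 / (32 * \<delta> n)) \<le> g n 0" by linarith
    then have "\<delta> n * (2 * pi * m * (1 / (32 * \<delta> n))) \<le> \<delta> n * g n 0" using d by (intro mult_left_mono) auto
    then have g0: "2 * pi * m / 32 \<le> \<delta> n * g n 0" using d by simp
    have v: "\<forall>k\<le>2. \<bar>yw (2 * (1 - \<delta> n) * cos lam0) (- (1 - \<delta> n)\<^sup>2) (g n) k\<bar> \<le> G / sin lam0"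
      unfolding g_def using yw_acov_X_le[OF lam0 \<delta>] by blast
    show ?case unfolding P_def using st[OF d(1,2) _ _ g0 v] by blast
  qed
  have gm [measurable]: "(\<lambda>\<omega>. g' n \<omega> h) \<in> borel_measurable M" for n h
    unfolding g'_def by (rule gamma_hat_measurable[OF lam0 \<delta>])
  have am [measurable]: "(\<lambda>\<omega>. ar2_a1 (\<lambda>h. g' n \<omega> h / g' n \<omega> 0)) \<in> borel_measurable M"
    "(\<lambda>\<omega>. ar2_a2 (\<lambda>h. g' n \<omega> h / g' n \<omega> 0)) \<in> borel_measurable M" for n
    unfolding ar2_a1_def ar2_a2_def by measurable
  have pm [measurable]: "(\<lambda>\<omega>. peak_freq (\<lambda>h. g' n \<omega> h / g' n \<omega> 0)) \<in> borel_measurable M" for n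
    unfolding peak_freq_def by measurable
  have "0 < sqrt c2" using c by simp
  note T = bigOP_on_transfer[OF lam0 \<delta> inf D(1) this D(3) rate, folded g_def g'_def]
  show ?thesis
    unfolding bigOP_def rho
  proof (intro conjI; rule T)
    show "\<forall>\<^sub>F n in sequentially. \<forall>\<omega>\<in>space M. \<forall>\<eta>. 0 \<le> \<eta> \<longrightarrow> \<eta> \<le> \<eta>0 \<longrightarrow>
      (\<forall>k\<le>2. \<bar>yw (2 * (1 - \<delta> n) * cos lam0) (- (1 - \<delta> n)\<^sup>2) (g' n \<omega>) k - yw (2 * (1 - \<delta> n) * cos lam0) (- (1 - \<delta> n)\<^sup>2) (g n) k\<bar> \<le> \<eta>) \<longrightarrow>
      \<omega> \<in> UNIV \<and> \<bar>ar2_a1 (\<lambda>h. g' n \<omega> h / g' n \<omega> 0) - ar2_a1 (\<lambda>h. g n h / g n 0)\<bar> \<le> D * (\<delta> n * \<eta>)"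
      using st' by eventually_elim (auto simp: P_def)
    show "\<forall>\<^sub>F n in sequentially. \<forall>\<omega>\<in>space M. \<forall>\<eta>. 0 \<le> \<eta> \<longrightarrow> \<eta> \<le> \<eta>0 \<longrightarrow>
      (\<forall>k\<le>2. \<bar>yw (2 * (1 - \<delta> n) * cos lam0) (- (1 - \<delta> n)\<^sup>2) (g' n \<omega>) k - yw (2 * (1 - \<delta> n) * cos lam0) (- (1 - \<delta> n)\<^sup>2) (g n) k\<bar> \<le> \<eta>) \<longrightarrow>
      \<omega> \<in> UNIV \<and> \<bar>ar2_a2 (\<lambda>h. g' n \<omega> h / g' n \<omega> 0) - ar2_a2 (\<lambda>h. g n h / g n 0)\<bar> \<le> D * (\<delta> n * \<eta>)"
      using st' by eventually_elim (auto simp: P_def)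
    \<comment> \<open>The negativity of the estimated a_2 belongs to the event here, and the same
      stability result supplies it together with the bound on the frequency.\<close>
    show "\<forall>\<^sub>F n in sequentially. \<forall>\<omega>\<in>space M. \<forall>\<eta>. 0 \<le> \<eta> \<longrightarrow> \<eta> \<le> \<eta>0 \<longrightarrow>
      (\<forall>k\<le>2. \<bar>yw (2 * (1 - \<delta> n) * cos lam0) (- (1 - \<delta> n)\<^sup>2) (g' n \<omega>) k - yw (2 * (1 - \<delta> n) * cos lam0) (- (1 - \<delta> n)\<^sup>2) (g n) k\<bar> \<le> \<eta>) \<longrightarrow>
      \<omega> \<in> {\<omega>. ar2_a2 (\<lambda>h. g' n \<omega> h / g' n \<omega> 0) < 0} \<and>
      \<bar>peak_freq (\<lambda>h. g' n \<omega> h / g' n \<omega> 0) - peak_freq (\<lambda>h. g n h / g n 0)\<bar> \<le> D * (\<delta> n * \<eta>)"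
      using st' by eventually_elim (auto simp: P_def)
  qed (measurable; simp)+
qed

end
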